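(* Let $k\ge -\tfrac12$ and $M=(a,b;c,d)\in SL(2,\mathbb{R})$ with $b\ne 0$. Let $s,t>0$, $n>0$, $m>1$ and $1\le p,q<\infty$, and let $p'$ be the conjugate exponent of $p$ (with $1/p'=0$ if $p=1$). Consider the following hypothesis (H) on a measurable function $f:\mathbb{R}\to\mathbb{C}$: $$\int_{\mathbb{R}} \frac{e^{spx^2}|f(x)|^p}{(1+|x|)^n}\, d\mu_k(x) <\infty \quad\text{and}\quad \int_{\mathbb{R}} \frac{e^{tq\lambda^2} |D_k^M(f)(\lambda)|^q}{(1+|\lambda|)^m}\, d\lambda <\infty.$$ Then: (i) If $st>\frac{1}{4b^2}$ and $f$ satisfies (H), then $f=0$ a.e. on $\mathbb{R}$. (ii) If $st=\frac{1}{4b^2}$ and $f$ satisfies (H), then $f(x)=Q(x)\,e^{-\left(s+\frac i2\frac ab\right)x^2}$ a.e., where $Q$ is a polynomial with $\deg(Q)\le\min\left\{\frac np+\frac{2k+1}{p'},\frac{m-1}{q}\right\}$. Moreover, if in addition $1<m\le 1+q$ and $n>2k+1$, then $f(x)=C\,e^{-\left(s+\frac i2\frac ab\right)x^2}$ a.e. for some constant $C\in\mathbb{C}$. (iii) If $st<\frac{1}{4b^2}$, then the functions of the form $f(x)=Q(x)\,e^{-\left(\delta+\frac i2\frac ab\right)x^2}$, with $\delta\in\left(s,\frac{1}{4tb^2}\right)$ and $Q$ a polynomial on $\mathbb{R}$, satisfy (H).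
   Context: For $k\ge-\frac12$ let $d\mu_k(x)=\frac{|x|^{2k+1}}{2^{k+1}\Gamma(k+1)}\,dx$ on $\mathbb{R}$, and let $L^p_k(\mathbb{R})=L^p(\mathbb{R},\mu_k)$ (complex-valued functions). Polynomials have complex coefficients. The zero polynomial is regarded as satisfying any degree bound. The Dunkl kernel is $E_k(-i\lambda,x)=j_k(\lambda x)-\frac{i\lambda x}{2(k+1)}j_{k+1}(\lambda x)$, where $j_k(u)=\Gamma(k+1)\sum_{n\ge0}\frac{(-1)^n(u/2)^{2n}}{n!\,\Gamma(n+k+1)}$. For $M=(a,b;c,d)$, meaning the matrix $\begin{bmatrix}a&b\\c&d\end{bmatrix}\in SL(2,\mathbb{R})$, with $b\neq0$, the linear canonical Dunkl transform of $f\in L^1_k(\mathbb{R})$ is $$D_k^M(f)(\lambda)=\frac{1}{(ib)^{k+1}}\int_{\mathbb{R}}f(x)\,e^{\frac i2\left(\frac db\lambda^2+\frac ab x^2\right)}E_k(-i\lambda/b,x)\,d\mu_k(x),$$ with $(ib)^{k+1}$ the principal branch. (The first integrability condition in (H) implies $f\in L^1_k(\mathbb{R})$, so $D_k^M(f)$ is defined.) *)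

theory Defs
  imports "HOL-Analysis.Analysis" "HOL-Computational_Algebra.Polynomial"
begin

(* The density is taken with respect to the completed Lebesgue measure, so that
   "measurable" means Lebesgue measurable.  For k = -1/2 the convention 0 powr 0 = 0
   changes the density only at the single point 0. *)
definition dunkl_measure :: "real \<Rightarrow> real measure" where
  "dunkl_measure k =
     density lebesgue
       (\<lambda>x. ennreal (\<bar>x\<bar> powr (2 * k + 1) / (2 powr (k + 1) * Gamma (k + 1))))"

definition bessel_j :: "real \<Rightarrow> complex \<Rightarrow> complex" where
  "bessel_j k u =
     of_real (Gamma (k + 1)) *
       (\<Sum>n. (-1) ^ n * (u / 2) ^ (2 * n) / of_real (fact n * Gamma (real n + k + 1)))"

(* dunkl_kernel k l x is the value E_k(-i l, x): the factor -i is built in. *)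
definition dunkl_kernel :: "real \<Rightarrow> complex \<Rightarrow> real \<Rightarrow> complex" where
  "dunkl_kernel k l x =
     bessel_j k (l * of_real x)
       - \<i> * l * of_real x / (2 * (of_real k + 1)) * bessel_j (k + 1) (l * of_real x)"

(* Meaningful when M $ 1 $ 2 is nonzero and f is integrable with respect to dunkl_measure k.
   The entry c = M $ 2 $ 1 does not occur.  Complex powr is the principal branch. *)
definition lc_dunkl_transform ::
  "real \<Rightarrow> real^2^2 \<Rightarrow> (real \<Rightarrow> complex) \<Rightarrow> real \<Rightarrow> complex" where
  "lc_dunkl_transform k M f l =
     (let a = M $ 1 $ 1; b = M $ 1 $ 2; d = M $ 2 $ 2 in
       1 / (\<i> * of_real b) powr of_real (k + 1) *
         (LINT x|dunkl_measure k.
            f x * exp (\<i> / 2 * of_real (d / b * l\<^sup>2 + a / b * x\<^sup>2))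
                * dunkl_kernel k (of_real (l / b)) x))"

(* Nonnegative integrals are used, so finiteness does not depend on the convention
   that a non-integrable function has Bochner integral 0. *)
definition condition_H ::
  "real \<Rightarrow> real^2^2 \<Rightarrow> real \<Rightarrow> real \<Rightarrow> real \<Rightarrow> real \<Rightarrow> real \<Rightarrow> real \<Rightarrow> (real \<Rightarrow> complex) \<Rightarrow> bool" where
  "condition_H k M s t n m p q f \<longleftrightarrow>
     f \<in> borel_measurable lebesgue \<and>
     (\<integral>\<^sup>+ x. ennreal (exp (s * p * x\<^sup>2) * cmod (f x) powr p / (1 + \<bar>x\<bar>) powr n)
        \<partial>dunkl_measure k) < \<infinity> \<and>
     (\<integral>\<^sup>+ l. ennreal (exp (t * q * l\<^sup>2) * cmod (lc_dunkl_transform k M f l) powr q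
                       / (1 + \<bar>l\<bar>) powr m) \<partial>lebesgue) < \<infinity>"

(* The reciprocal 1/p' of the conjugate exponent, from 1/p + 1/p' = 1; it is 0 for p = 1. *)
definition inv_conj_exponent :: "real \<Rightarrow> real" where
  "inv_conj_exponent p = 1 - 1 / p"

end

(* The kernel E_k(-iz, x) is a power series in zx whose coefficients are bounded by 1/j!, so a Gaussian
   bound on g(x) = f(x) e^{(i/2)(a/b) x^2} makes F(z) = int g(x) E_k(-iz/b, x) dmu_k an entire function with
   |F(z)| <= C (1 + |z|)^N e^{tau |z|^2}, tau = 1/(4 s b^2).  Hence Phi(z) = F(z) e^{tau z^2} satisfies
   |Phi(z)| <= C (1 + |z|)^N e^{2 tau (Re z)^2}; this crude bound already vanishes to second order at the
   imaginary axis, which is what a Phragmen-Lindelof argument in quadrants of the critical order 2 needs.  On the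
   real axis Phi is only controlled in L^q, so the argument is applied to its primitive, and Phi is a polynomial.
   The transform maps x^n e^{-s x^2} to a polynomial of degree exactly n times e^{-z^2/(4s)}, and it is injective
   because its Taylor coefficients are nonzero multiples of the moments of g; so g is a polynomial times
   e^{-s x^2}.  The degree bounds are read off from (H), which also forces F = 0 when st > 1/(4 b^2). *)
theory Submission
  imports Defs "HOL-Complex_Analysis.Complex_Analysis" "HOL-Probability.Probability" "HOL-Real_Asymp.Real_Asymp"
begin

section \<open>A Phragmen-Lindelof theorem of order two\<close>

text \<open>A quadrant has opening pi/2, for which order 2 is exactly the borderline: no barrier
  exp(-\<delta> z^\<rho>) with \<rho> > 2 decays in all of it. What helps is that |exp(i \<epsilon>
  z^2)| = exp(-2 \<epsilon> Re z Im z) has an exponent vanishing only to first order at the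
  imaginary axis, so for every \<epsilon> > 0 it beats exp(A (Re z)^2) on rays close enough to that
  axis. The narrower sector below such a ray leaves room for \<rho>. The value 1/(4 s b^2) comes
  from completing the square in r|x| - s x^2 with r = |z/b|, whose maximum is r^2/(4s). To pass from
  |f|^p and |Phi|^q to |f| and |Phi|, the inequality y \<le> 1 + y^p takes the place of Hoelder; the
  constant 1 costs only polynomial factors, which every later step tolerates. No inversion formula
  for the Dunkl transform is used: injectivity descends to the classical Fourier transform, because
  the moments of g for mu_k are those of a Lebesgue density with exponential moments. The zero
  polynomial has degree 0 here, so degree arguments must treat it apart.\<close>

lemma phragmen_lindelof_cone:
  fixes f :: "complex \<Rightarrow> complex"
  assumes tau: "0 < \<tau>" "\<tau> < 1" and B: "B \<ge> 0"
    and hol: "f holomorphic_on {w. Re w > -1}"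
    and growth: "\<And>w. \<bar>Im w\<bar> \<le> \<tau> * Re w \<Longrightarrow> norm (f w) \<le> C * exp (B * (norm w)\<^sup>2)"
    and boundary: "\<And>w. \<bar>Im w\<bar> = \<tau> * Re w \<Longrightarrow> norm (f w) \<le> M"
    and w0: "\<bar>Im w0\<bar> \<le> \<tau> * Re w0"
  shows "norm (f w0) \<le> M"
proof -
  define K where "K = {w. \<bar>Im w\<bar> \<le> \<tau> * Re w}"
  have Re_K: "Re w \<ge> 0" if "w \<in> K" for w
    using that tau by (smt (verit) K_def mem_Collect_eq mult_nonneg_nonpos2 mult_pos_neg)
  define \<theta> where "\<theta> = arctan \<tau>"
  have \<theta>: "0 < \<theta>" "\<theta> < pi / 4"
    using tau arctan_less_iff[of \<tau> 1] by (auto simp: \<theta>_def arctan_one)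
  then have "2 < pi / 2 / \<theta>" by (simp add: field_simps)
  \<comment> \<open>The half opening \<theta> is below pi/4, which leaves room for
    \<open>\<rho>\<close>: above 2, so that R^\<rho> beats B R^2 on large arcs, yet with \<rho>
    \<theta> < pi/2, so that the power keeps a positive real part in the cone.\<close>
  then obtain \<rho> where \<rho>: "2 < \<rho>" "\<rho> < pi / 2 / \<theta>" using dense by blast
  have \<rho>\<theta>: "0 < \<rho> * \<theta>" "\<rho> * \<theta> < pi / 2"
    using \<rho> \<theta> by (auto simp: field_simps)
  define c where "c = cos (\<rho> * \<theta>)"
  have c: "c > 0" unfolding c_def using \<rho>\<theta> by (intro cos_gt_zero_pi) auto
  \<comment> \<open>The shift by 1 moves the branch point of the power out of the cone, so the
    barrier is holomorphic at the apex too. Adding 1 increases the modulus and turns the argument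
    towards 0, so the lower bound survives the shift.\<close>
  have barrier: "Re ((w + 1) powr of_real \<rho>) \<ge> c * norm w powr \<rho>" if "w \<in> K" for w
  proof -
    have Re1: "Re (w + 1) \<ge> 1" using Re_K[OF that] by simp
    have ge: "norm w \<le> norm (w + 1)"
      using Re_K[OF that] by (simp add: cmod_def power2_eq_square algebra_simps)
    have nz: "w + 1 \<noteq> 0" using Re1 by (metis not_one_le_zero zero_complex.sel(1))
    have "\<bar>Im (Ln (w + 1))\<bar> = arctan (\<bar>Im w\<bar> / (Re w + 1))"
      using Re1 nz by (subst Im_Ln_eq) (auto simp: abs_real_def arctan_minus divide_less_0_iff field_simps)
    also have "\<dots> \<le> \<theta>"
      unfolding \<theta>_def using that tau Re_K[OF that]
      by (intro arctan_monotone') (simp add: K_def divide_le_eq distrib_left add_increasing2)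
    finally have th: "\<bar>\<rho> * Im (Ln (w + 1))\<bar> \<le> \<rho> * \<theta>" using \<rho> by (simp add: abs_mult)
    have "c \<le> cos \<bar>\<rho> * Im (Ln (w + 1))\<bar>"
      unfolding c_def by (rule cos_monotone_0_pi_le) (use th \<rho>\<theta> in auto)
    then have cc: "c \<le> cos (\<rho> * Im (Ln (w + 1)))" by simp
    have "Re ((w + 1) powr of_real \<rho>) = norm (w + 1) powr \<rho> * cos (\<rho> * Im (Ln (w + 1)))"
      using nz by (simp add: powr_def Re_exp)
    also have "\<dots> \<ge> norm w powr \<rho> * c"
      using ge \<rho> c cc by (intro mult_mono powr_mono2) auto
    finally show ?thesis by (simp add: mult.commute)
  qed
  have closed_K: "closed K"
    unfolding K_def by (intro closed_Collect_le continuous_intros)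
  \<comment> \<open>The same \<open>\<delta>\<close> is the strength of the barrier and the
    tolerance on the arc, so one limit \<delta> -> 0 at the fixed point \<open>w0\<close> removes
    both.\<close>
  have main: "norm (f w0 * exp (- of_real \<delta> * (w0 + 1) powr of_real \<rho>)) \<le> M + \<delta>" if \<delta>: "\<delta> > 0" for \<delta>
  proof -
    define g where "g w = f w * exp (- of_real \<delta> * (w + 1) powr of_real \<rho>)" for w
    have g_le: "norm (g w) \<le> norm (f w) * exp (- \<delta> * c * norm w powr \<rho>)" if "w \<in> K" for w
      unfolding g_def norm_mult using barrier[OF that] \<delta>
      by (intro mult_left_mono) (auto simp: mult_ac)
    have g_hol: "g holomorphic_on {w. Re w > -1}"
      unfolding g_def by (intro holomorphic_intros hol) (auto simp: complex_nonpos_Reals_iff)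
    have "((\<lambda>R. C * exp (B * R\<^sup>2 - \<delta> * c * R powr \<rho>)) \<longlongrightarrow> 0) at_top"
    proof -
      define D where "D = \<delta> * c"
      have "D > 0" using \<delta> c by (simp add: D_def)
      then show ?thesis unfolding D_def[symmetric] using \<rho>(1) B by real_asymp
    qed
    then have "eventually (\<lambda>R. C * exp (B * R\<^sup>2 - \<delta> * c * R powr \<rho>) < \<delta>) at_top"
      using \<delta> by (rule order_tendstoD)
    moreover have "eventually (\<lambda>R. R > norm w0) at_top" by (rule eventually_gt_at_top)
    ultimately obtain R where R: "C * exp (B * R\<^sup>2 - \<delta> * c * R powr \<rho>) < \<delta>" "R > norm w0"
      by (metis (no_types, lifting) eventually_conj eventually_happens' trivial_limit_at_top_linorder)
    define S where "S = K \<inter> cball 0 R"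
    have closed_S: "closed S" unfolding S_def by (intro closed_Int closed_K) auto
    have S_sub: "S \<subseteq> {w. Re w > -1}" using Re_K by (force simp: S_def)
    have "norm (g w0) \<le> M + \<delta>"
    proof (rule maximum_modulus_frontier[of g S])
      show "g holomorphic_on interior S"
        using g_hol S_sub interior_subset by (meson holomorphic_on_subset order_trans)
      show "continuous_on (closure S) g"
        using g_hol S_sub closed_S by (metis closure_closed holomorphic_on_imp_continuous_on holomorphic_on_subset)
      show "bounded S" unfolding S_def by (simp add: bounded_Int)
      show "w0 \<in> S" using w0 R by (auto simp: S_def K_def)
      fix z assume "z \<in> frontier S"
      then have z: "z \<in> S" "z \<notin> interior S" using closed_S by (auto simp: frontier_def)
      have "{w. \<bar>Im w\<bar> < \<tau> * Re w} \<inter> ball 0 R \<subseteq> interior S"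
      proof (rule interior_maximal)
        show "open ({w. \<bar>Im w\<bar> < \<tau> * Re w} \<inter> ball 0 R)"
          by (intro open_Int open_Collect_less continuous_intros) auto
      qed (auto simp: S_def K_def)
      then have "z \<notin> {w. \<bar>Im w\<bar> < \<tau> * Re w} \<inter> ball 0 R" using z by blast
      then have "\<bar>Im z\<bar> = \<tau> * Re z \<or> norm z = R"
        using z(1) by (auto simp: S_def K_def)
      then show "norm (g z) \<le> M + \<delta>"
      proof
        assume b: "\<bar>Im z\<bar> = \<tau> * Re z"
        have "norm (g z) \<le> norm (f z) * exp (- \<delta> * c * norm z powr \<rho>)"
          using z by (intro g_le) (auto simp: S_def)
        also have "\<dots> \<le> norm (f z) * 1"
          using \<delta> c by (intro mult_left_mono) auto
        also have "\<dots> \<le> M" using boundary[OF b] by simp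
        finally show ?thesis using \<delta> by simp
      next
        assume b: "norm z = R"
        have "norm (g z) \<le> norm (f z) * exp (- \<delta> * c * norm z powr \<rho>)"
          using z by (intro g_le) (auto simp: S_def)
        also have "\<dots> \<le> (C * exp (B * (norm z)\<^sup>2)) * exp (- \<delta> * c * norm z powr \<rho>)"
          using z by (intro mult_right_mono growth) (auto simp: S_def K_def)
        also have "\<dots> = C * exp (B * R\<^sup>2 - \<delta> * c * R powr \<rho>)"
          by (simp add: b exp_diff exp_minus field_simps)
        also have "\<dots> < \<delta>" by (rule R)
        finally have "norm (g z) < \<delta>" .
        moreover have "M \<ge> 0" using boundary[of 0] norm_ge_zero by (metis abs_zero mult_zero_right order_trans zero_complex.sel)
        ultimately show ?thesis by linarith
      qed
    qed
    then show ?thesis by (simp add: g_def)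
  qed
  have "((\<lambda>\<delta>. norm (f w0 * exp (- of_real \<delta> * (w0 + 1) powr of_real \<rho>))) \<longlongrightarrow>
          norm (f w0 * exp (- of_real 0 * (w0 + 1) powr of_real \<rho>))) (at_right 0)"
    by (intro tendsto_intros)
  moreover have "((\<lambda>\<delta>. M + \<delta>) \<longlongrightarrow> M + 0) (at_right 0)"
    by (intro tendsto_intros)
  ultimately have "norm (f w0 * exp (- of_real 0 * (w0 + 1) powr of_real \<rho>)) \<le> M + 0"
    using main by (intro tendsto_le[of "at_right 0"])
      (auto simp: eventually_at_right_less intro!: eventually_at_rightI[of 0 1])
  then show ?thesis by simp
qed

text \<open>After multiplication by \<open>exp (i \<epsilon> z^2)\<close> the growth bound becomes polynomial on a ray close to
  the imaginary axis, and the sector below that ray has opening less than \<open>\<pi> / 2\<close>. The sector is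
  written as \<open>(1 + i \<tau>) w\<close> with \<open>w\<close> in the cone of \<open>phragmen_lindelof_cone\<close>; finally \<open>\<epsilon>\<close> tends to \<open>0\<close>.\<close>

lemma phragmen_lindelof_quadrant:
  fixes G :: "complex \<Rightarrow> complex"
  assumes hol: "G holomorphic_on UNIV" and A: "A \<ge> 0" and C: "C \<ge> 0"
    and growth: "\<And>z. norm (G z) \<le> C * (1 + norm z) ^ N * exp (A * (Re z)\<^sup>2)"
    and axis: "\<And>x. norm (G (of_real x)) \<le> C * (1 + \<bar>x\<bar>) ^ N"
    and z: "Re z > 0" "Im z \<ge> 0"
  shows "norm (G z) \<le> C * 4 ^ N * (1 + norm z) ^ N"
proof -
  have eps: "norm (G z) \<le> C * 4 ^ N * (1 + norm z) ^ N * exp (2 * \<epsilon> * Re z * Im z)" if \<epsilon>: "\<epsilon> > 0" for \<epsilon>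
  proof -
    \<comment> \<open>On the upper ray z = u w with Im w = \<tau> Re w one has Re z = (1 - \<tau>^2)
      Re w and Im z = 2 \<tau> Re w. Hence A (Re z)^2 - 2 \<epsilon> Re z Im z is (1 - \<tau>^2) (Re
      w)^2 times the quantity here, which tends to -4 \<epsilon> as \<tau> -> 1.\<close>
    have "((\<lambda>\<tau>. A * (1 - \<tau>\<^sup>2) - 4 * \<epsilon> * \<tau>) \<longlongrightarrow> A * (1 - 1\<^sup>2) - 4 * \<epsilon> * 1) (at_left 1)"
      by (intro tendsto_intros)
    then have e1: "eventually (\<lambda>\<tau>. A * (1 - \<tau>\<^sup>2) - 4 * \<epsilon> * \<tau> < 0) (at_left 1)"
      by (rule order_tendstoD) (use \<epsilon> in auto)
    \<comment> \<open>This places the fixed point z below the upper ray, whose slope 2 \<tau> / (1 -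
      \<tau>^2) becomes infinite as \<tau> -> 1; Re z > 0 makes it possible.\<close>
    have "((\<lambda>\<tau>. Im z * (1 - \<tau>\<^sup>2) - 2 * \<tau> * Re z) \<longlongrightarrow> Im z * (1 - 1\<^sup>2) - 2 * 1 * Re z) (at_left 1)"
      by (intro tendsto_intros)
    then have e2: "eventually (\<lambda>\<tau>. Im z * (1 - \<tau>\<^sup>2) - 2 * \<tau> * Re z < 0) (at_left 1)"
      by (rule order_tendstoD) (use z in auto)
    have e3: "eventually (\<lambda>\<tau>. \<tau> \<in> {0<..<1}) (at_left (1::real))"
      by (rule eventually_at_leftI[of 0]) auto
    obtain \<tau> where t1: "A * (1 - \<tau>\<^sup>2) - 4 * \<epsilon> * \<tau> < 0"
      and t2: "Im z * (1 - \<tau>\<^sup>2) - 2 * \<tau> * Re z < 0" and t3: "0 < \<tau>" "\<tau> < 1"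
      using eventually_happens'[OF _ eventually_conj[OF e1 eventually_conj[OF e2 e3]]]
      by (auto simp: trivial_limit_at_left_real)
    define u where "u = Complex 1 \<tau>"
    have u0: "u \<noteq> 0" by (simp add: u_def complex_eq_iff)
    have nu: "1 \<le> norm u" "norm u \<le> 2"
    proof -
      show "1 \<le> norm u" using abs_Re_le_cmod[of u] by (simp add: u_def)
      show "norm u \<le> 2" using cmod_le[of u] t3 by (simp add: u_def)
    qed
    \<comment> \<open>Dividing by (w + 1)^N turns the polynomial bounds on the two rays into the
      constant that \<open>phragmen_lindelof_cone\<close> asks for; the pole at -1 lies outside Re w
      > -1.\<close>
    define f where "f w = G (u * w) * exp (\<i> * of_real \<epsilon> * (u * w)\<^sup>2) / (w + 1) ^ N" for w
    have w1: "1 + norm w \<le> 2 * norm (w + 1)" "1 \<le> norm (w + 1)" if "Re w \<ge> 0" for w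
    proof -
      have "norm w \<le> norm (w + 1)" using that by (simp add: cmod_def power2_eq_square algebra_simps)
      moreover show "1 \<le> norm (w + 1)" using abs_Re_le_cmod[of "w + 1"] that by simp
      ultimately show "1 + norm w \<le> 2 * norm (w + 1)" by simp
    qed
    have ReK: "Re w \<ge> 0" if "\<bar>Im w\<bar> \<le> \<tau> * Re w" for w
      using that t3 by (smt (verit) mult_pos_neg)
    have nf: "norm (f w) = norm (G (u * w)) * exp (- 2 * \<epsilon> * Re (u * w) * Im (u * w)) / norm (w + 1) ^ N" for w
    proof -
      have "Re (\<i> * of_real \<epsilon> * (u * w)\<^sup>2) = - 2 * \<epsilon> * Re (u * w) * Im (u * w)"
        by (simp add: power2_eq_square algebra_simps)
      then show ?thesis
        by (simp only: f_def norm_divide norm_mult[of "G (u * w)"] norm_power norm_exp_eq_Re)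
    qed
    \<comment> \<open>Origin of the factor 4^N in the conclusion: 2 from |u| \<le> 2, and 2 from 1 +
      |w| \<le> 2 |w + 1|.\<close>
    have quad: "1 + norm (u * w) \<le> 4 * norm (w + 1)" if "Re w \<ge> 0" for w
    proof -
      have "norm u * norm w \<le> 2 * norm w" using nu by (intro mult_right_mono) auto
      then show ?thesis using w1[OF that] by (simp add: norm_mult)
    qed
    define w0 where "w0 = z / u"
    have "norm (f w0) \<le> C * 4 ^ N"
    proof (rule phragmen_lindelof_cone[OF t3, of "A * 4" f "C * 4 ^ N"])
      show "f holomorphic_on {w. -1 < Re w}"
      proof -
        have "(G \<circ> (\<lambda>w. u * w)) holomorphic_on {w. -1 < Re w}"
          by (intro holomorphic_on_compose holomorphic_intros holomorphic_on_subset[OF hol]) auto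
        moreover have "w + 1 \<noteq> 0" if "-1 < Re w" for w
          using that by (auto simp: complex_eq_iff)
        ultimately show ?thesis unfolding f_def o_def
          by (intro holomorphic_intros) auto
      qed
      show "A * 4 \<ge> 0" using A by simp
    next
      fix w assume w: "\<bar>Im w\<bar> \<le> \<tau> * Re w"
      note Rw = ReK[OF w]
      have Re_uw: "Re (u * w) = Re w - \<tau> * Im w" and Im_uw: "Im (u * w) = Im w + \<tau> * Re w"
        by (auto simp: u_def)
      have "\<tau> * Im w \<le> Re w"
      proof -
        have "\<tau> * Im w \<le> \<tau> * (\<tau> * Re w)" using w t3 by (intro mult_left_mono) auto
        also have "\<dots> \<le> 1 * (1 * Re w)" using t3 Rw by (intro mult_mono) auto
        finally show ?thesis by simp
      qed
      then have pos: "Re (u * w) \<ge> 0" "Im (u * w) \<ge> 0" unfolding Re_uw Im_uw using w by linarith+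
      have "norm (f w) \<le> norm (G (u * w)) * 1 / norm (w + 1) ^ N"
        unfolding nf using pos \<epsilon> by (intro divide_right_mono mult_left_mono) (auto simp: mult_nonneg_nonneg)
      also have "\<dots> \<le> C * (4 * norm (w + 1)) ^ N * exp (A * 4 * (norm w)\<^sup>2) / norm (w + 1) ^ N"
      proof (rule divide_right_mono)
        have "A * (Re (u * w))\<^sup>2 \<le> A * 4 * (norm w)\<^sup>2"
        proof -
          have "(Re (u * w))\<^sup>2 \<le> (norm (u * w))\<^sup>2"
            using abs_Re_le_cmod abs_le_square_iff by (metis abs_norm_cancel)
          also have "\<dots> = (norm u)\<^sup>2 * (norm w)\<^sup>2" by (simp add: norm_mult power_mult_distrib)
          also have "\<dots> \<le> 2\<^sup>2 * (norm w)\<^sup>2" using nu by (intro mult_right_mono power_mono) auto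
          finally show ?thesis using A by (simp add: mult_left_mono mult.assoc)
        qed
        then show "norm (G (u * w)) * 1 \<le> C * (4 * norm (w + 1)) ^ N * exp (A * 4 * (norm w)\<^sup>2)"
          using order_trans[OF growth[of "u * w"] mult_mono[OF mult_left_mono[OF power_mono[OF quad[OF Rw]]]]]
          using C by simp
      qed auto
      also have "\<dots> = C * 4 ^ N * exp (A * 4 * (norm w)\<^sup>2)"
        using w1[OF Rw] by (auto simp: power_mult_distrib)
      finally show "norm (f w) \<le> C * 4 ^ N * exp (A * 4 * (norm w)\<^sup>2)" .
    next
      fix w assume w: "\<bar>Im w\<bar> = \<tau> * Re w"
      have Rw: "Re w \<ge> 0" using ReK[of w] w by simp
      have "norm (G (u * w)) * exp (- 2 * \<epsilon> * Re (u * w) * Im (u * w)) \<le> C * (1 + norm (u * w)) ^ N"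
      proof (cases "Im w = \<tau> * Re w")
        case True
        have R: "Re (u * w) = (1 - \<tau>\<^sup>2) * Re w" "Im (u * w) = 2 * \<tau> * Re w"
          using True by (auto simp: u_def power2_eq_square algebra_simps)
        have "norm (G (u * w)) * exp (- 2 * \<epsilon> * Re (u * w) * Im (u * w)) \<le>
              (C * (1 + norm (u * w)) ^ N * exp (A * (Re (u * w))\<^sup>2)) * exp (- 2 * \<epsilon> * Re (u * w) * Im (u * w))"
          by (intro mult_right_mono growth) auto
        also have "\<dots> = C * (1 + norm (u * w)) ^ N * exp ((1 - \<tau>\<^sup>2) * (Re w)\<^sup>2 * (A * (1 - \<tau>\<^sup>2) - 4 * \<epsilon> * \<tau>))"
          unfolding mult.assoc exp_add[symmetric] R by (simp add: power2_eq_square algebra_simps)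
        also have "\<dots> \<le> C * (1 + norm (u * w)) ^ N * 1"
        proof -
          have "\<tau>\<^sup>2 \<le> 1" using t3 by (simp add: power_le_one)
          then show ?thesis using t1 C by (intro mult_left_mono) (auto simp: mult_nonneg_nonpos)
        qed
        finally show ?thesis by simp
      next
        case False
        then have "Im w = - \<tau> * Re w" using w by auto
        then have R: "Re (u * w) = (1 + \<tau>\<^sup>2) * Re w" "Im (u * w) = 0"
          by (auto simp: u_def power2_eq_square algebra_simps)
        then have eq: "u * w = of_real (Re (u * w))" by (simp add: complex_eq_iff)
        have "norm (G (u * w)) \<le> C * (1 + \<bar>Re (u * w)\<bar>) ^ N" by (subst eq) (rule axis)
        also have "\<bar>Re (u * w)\<bar> = norm (u * w)" by (metis eq norm_of_real)
        finally show ?thesis unfolding R by simp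
      qed
      also have "\<dots> \<le> C * (4 * norm (w + 1)) ^ N"
        using quad[OF Rw] C by (intro mult_left_mono power_mono) auto
      finally show "norm (f w) \<le> C * 4 ^ N"
        unfolding nf using w1[OF Rw] C by (subst divide_le_eq) (auto simp: power_mult_distrib mult_ac)
    next
      have "w0 = z * cnj u / of_real ((norm u)\<^sup>2)"
        unfolding w0_def using u0 by (simp add: complex_div_cnj[of z u])
      then have w0e: "Re w0 = (Re z + \<tau> * Im z) / (norm u)\<^sup>2" "Im w0 = (Im z - \<tau> * Re z) / (norm u)\<^sup>2"
        by (auto simp: u_def)
      have "\<bar>Im z - \<tau> * Re z\<bar> \<le> \<tau> * (Re z + \<tau> * Im z)"
        using t2 t3 z by (auto simp: abs_le_iff algebra_simps power2_eq_square mult_nonneg_nonneg)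
      then show "\<bar>Im w0\<bar> \<le> \<tau> * Re w0"
        unfolding w0e by (auto simp: abs_div divide_right_mono)
    qed
    moreover have uw0: "u * w0 = z" using u0 by (simp add: w0_def)
    ultimately have le: "norm (G z) * exp (- 2 * \<epsilon> * Re z * Im z) \<le> C * 4 ^ N * norm (w0 + 1) ^ N"
    proof -
      assume "norm (f w0) \<le> C * 4 ^ N"
      then have "norm (G z) * exp (- 2 * \<epsilon> * Re z * Im z) / norm (w0 + 1) ^ N \<le> C * 4 ^ N"
        unfolding nf uw0 .
      moreover have "w0 + 1 \<noteq> 0"
      proof
        assume "w0 + 1 = 0"
        then have "z = - u" using uw0 by (metis add_eq_0_iff mult.right_neutral mult_minus_right add.commute)
        then show False using z by (simp add: u_def)
      qed
      ultimately show ?thesis by (simp add: divide_simps)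
    qed
    have "norm w0 \<le> norm z" unfolding w0_def norm_divide using nu mult_left_mono[of 1 "norm u" "norm z"] u0 by (simp add: divide_le_eq)
    then have "norm (w0 + 1) \<le> 1 + norm z" using norm_triangle_ineq[of w0 1] by simp
    then have "C * 4 ^ N * norm (w0 + 1) ^ N \<le> C * 4 ^ N * (1 + norm z) ^ N"
      using C by (intro mult_left_mono power_mono) auto
    with le have "norm (G z) * exp (- 2 * \<epsilon> * Re z * Im z) \<le> C * 4 ^ N * (1 + norm z) ^ N" by simp
    then have "norm (G z) * exp (- 2 * \<epsilon> * Re z * Im z) * exp (2 * \<epsilon> * Re z * Im z)
       \<le> C * 4 ^ N * (1 + norm z) ^ N * exp (2 * \<epsilon> * Re z * Im z)" by (rule mult_right_mono) auto
    then show ?thesis by (simp add: mult.assoc flip: exp_add)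
  qed
  have "((\<lambda>\<epsilon>. C * 4 ^ N * (1 + norm z) ^ N * exp (2 * \<epsilon> * Re z * Im z)) \<longlongrightarrow>
      C * 4 ^ N * (1 + norm z) ^ N * exp (2 * 0 * Re z * Im z)) (at_right 0)"
    by (intro tendsto_intros)
  then have "norm (G z) \<le> C * 4 ^ N * (1 + norm z) ^ N * exp (2 * 0 * Re z * Im z)"
    by (rule tendsto_lowerbound) (auto intro!: eventually_at_rightI[of 0 1] eps)
  then show ?thesis by simp
qed

section \<open>Entire functions of Gaussian growth that must be polynomials\<close>

lemma holomorphic_cnj_cnj: "G holomorphic_on UNIV \<Longrightarrow> (\<lambda>z. cnj (G (cnj z))) holomorphic_on UNIV"
proof -
  assume "G holomorphic_on UNIV"
  then have "G holomorphic_on (cnj ` UNIV)" by (rule holomorphic_on_subset) auto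
  from holomorphic_on_compose_cnj_cnj[OF this] show ?thesis by (simp add: o_def)
qed

text \<open>Conjugation handles the fourth quadrant and z -> -z the left half-plane. On the
  imaginary axis, which \<open>phragmen_lindelof_quadrant\<close> leaves out, the growth hypothesis
  is already polynomial. Liouville's theorem finishes.\<close>

lemma phragmen_lindelof_polynomial:
  fixes G :: "complex \<Rightarrow> complex"
  assumes hol: "G holomorphic_on UNIV" and A: "A \<ge> 0" and C: "C \<ge> 0"
    and growth: "\<And>z. norm (G z) \<le> C * (1 + norm z) ^ N * exp (A * (Re z)\<^sup>2)"
    and axis: "\<And>x. norm (G (of_real x)) \<le> C * (1 + \<bar>x\<bar>) ^ N"
  obtains P :: "complex poly" where "\<And>z. G z = poly P z"
proof -
  have right: "norm (H z) \<le> C * 4 ^ N * (1 + norm z) ^ N"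
    if H: "H holomorphic_on UNIV"
      and gr: "\<And>z. norm (H z) \<le> C * (1 + norm z) ^ N * exp (A * (Re z)\<^sup>2)"
      and ax: "\<And>x. norm (H (of_real x)) \<le> C * (1 + \<bar>x\<bar>) ^ N" and z: "Re z > 0" for H z
  proof (cases "Im z \<ge> 0")
    case True
    then show ?thesis using phragmen_lindelof_quadrant[OF H A C gr ax z] by simp
  next
    case False
    have "norm (cnj (H (cnj (cnj z)))) \<le> C * 4 ^ N * (1 + norm (cnj z)) ^ N"
    proof (rule phragmen_lindelof_quadrant[OF holomorphic_cnj_cnj[OF H] A C])
      show "norm (cnj (H (cnj w))) \<le> C * (1 + norm w) ^ N * exp (A * (Re w)\<^sup>2)" for w
        using gr[of "cnj w"] by simp
      show "norm (cnj (H (cnj (of_real x)))) \<le> C * (1 + \<bar>x\<bar>) ^ N" for x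
        using ax[of x] by simp
    qed (use z False in auto)
    then show ?thesis by simp
  qed
  have refl: "(\<lambda>z. G (- z)) holomorphic_on UNIV"
  proof -
    have "(G \<circ> uminus) holomorphic_on UNIV"
      by (rule holomorphic_on_compose[OF _ holomorphic_on_subset[OF hol]]) (auto intro!: holomorphic_intros)
    then show ?thesis by (simp add: o_def)
  qed
  have bound: "norm (G z) \<le> C * 4 ^ N * (1 + norm z) ^ N" for z
  proof -
    consider "Re z > 0" | "Re z < 0" | "Re z = 0" by linarith
    then show ?thesis
    proof cases
      case 1
      then show ?thesis by (rule right[OF hol growth axis])
    next
      case 2
      have "norm (G (- (- z))) \<le> C * 4 ^ N * (1 + norm (- z)) ^ N"
      proof (rule right[OF refl])
        show "norm (G (- w)) \<le> C * (1 + norm w) ^ N * exp (A * (Re w)\<^sup>2)" for w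
          using growth[of "- w"] by simp
        show "norm (G (- of_real x)) \<le> C * (1 + \<bar>x\<bar>) ^ N" for x
          using axis[of "- x"] by simp
      qed (use 2 in auto)
      then show ?thesis by simp
    next
      case 3
      have "norm (G z) \<le> C * 1 * (1 + norm z) ^ N" using growth[of z] 3 by simp
      also have "\<dots> \<le> C * 4 ^ N * (1 + norm z) ^ N"
        using C by (intro mult_right_mono mult_left_mono) auto
      finally show ?thesis .
    qed
  qed
  have "G z = (\<Sum>j\<le>N. (deriv ^^ j) G 0 / fact j * z ^ j)" for z
  proof (rule Liouville_polynomial[OF hol])
    fix w :: complex assume w: "1 \<le> norm w"
    have "norm (G w) \<le> C * 4 ^ N * (2 * norm w) ^ N"
      using w C by (intro order_trans[OF bound] mult_left_mono power_mono) auto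
    then show "norm (G w) \<le> (C * 4 ^ N * 2 ^ N) * norm w ^ N" by (simp add: power_mult_distrib)
  qed
  then have "G z = poly (\<Sum>j\<le>N. monom ((deriv ^^ j) G 0 / fact j) j) z" for z
    by (simp add: poly_sum poly_monom)
  then show thesis by (rule that)
qed

text \<open>A weighted L^q bound says nothing about single points, but on [-R, R] it gives |Phi|
  \<le> 1 + (1 + R)^m' w with w integrable, so the primitive grows polynomially on the real axis.
  Integration along the segment from 0 to z, on which |Re| stays below |Re z|, preserves the factor
  exp(A (Re z)^2). Differentiating the resulting polynomial gives Phi.\<close>

lemma polynomial_of_gaussian_growth:
  fixes \<Phi> :: "complex \<Rightarrow> complex"
  assumes hol: "\<Phi> holomorphic_on UNIV" and A: "A \<ge> 0" and C: "C \<ge> 0"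
    and growth: "\<And>z. norm (\<Phi> z) \<le> C * (1 + norm z) ^ N * exp (A * (Re z)\<^sup>2)"
    and q: "q \<ge> 1" and m: "m \<ge> 0"
    and fin: "(\<integral>\<^sup>+ x. ennreal (norm (\<Phi> (of_real x)) powr q / (1 + \<bar>x\<bar>) powr m) \<partial>lebesgue) < \<infinity>"
  obtains P :: "complex poly" where "\<And>z. \<Phi> z = poly P z"
proof -
  obtain G0 where "\<And>z. z \<in> UNIV \<Longrightarrow> (G0 has_field_derivative \<Phi> z) (at z)"
    by (rule holomorphic_convex_primitive'[OF convex_UNIV open_UNIV hol]) (rule that)
  then have G0: "(G0 has_field_derivative \<Phi> z) (at z)" for z by simp
  define G where "G z = G0 z - G0 0" for z
  have G: "(G has_field_derivative \<Phi> z) (at z within S)" for z S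
    using DERIV_diff[OF G0[of z] DERIV_const[of "G0 0"]]
    unfolding G_def[abs_def] by (simp add: has_field_derivative_at_within)
  have G_0: "G 0 = 0" by (simp add: G_def)
  have G_hol: "G holomorphic_on UNIV" unfolding holomorphic_on_def field_differentiable_def
    by (intro ballI exI) (rule G)
  have cont: "continuous_on UNIV (\<lambda>x::real. \<Phi> (of_real x))"
    by (intro continuous_on_compose2[OF holomorphic_on_imp_continuous_on[OF hol]] continuous_intros) auto
  define w where "w x = norm (\<Phi> (of_real x)) powr q / (1 + \<bar>x\<bar>) powr m" for x :: real
  have w_nn: "w x \<ge> 0" for x by (simp add: w_def)
  have w_cont: "continuous_on UNIV w"
    unfolding w_def using q by (intro continuous_intros continuous_on_powr' cont) (auto simp: add_nonneg_eq_0_iff)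
  have w_int: "integrable lebesgue w"
    using fin w_nn w_cont unfolding w_def[symmetric]
    by (intro integrableI_nonneg measurable_completion) (auto simp: borel_measurable_continuous_onI)
  define I where "I = (LINT x|lebesgue. w x)"
  have I: "I \<ge> 0" unfolding I_def using w_nn by (simp add: integral_nonneg_AE)
  obtain m' :: nat where m': "m \<le> real m'" using real_arch_simple by blast
  define C' where "C' = C + 1 + I"
  have C': "C' \<ge> 0" using C I by (simp add: C'_def)
  have pw: "norm (\<Phi> (of_real x)) \<le> 1 + (1 + R) ^ m' * w x" if "\<bar>x\<bar> \<le> R" for x R :: real
  proof -
    have "norm (\<Phi> (of_real x)) \<le> 1 + norm (\<Phi> (of_real x)) powr q"
    proof (cases "norm (\<Phi> (of_real x)) \<le> 1")
      case True
      then show ?thesis by (simp add: add_increasing2)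
    next
      case False
      then have "norm (\<Phi> (of_real x)) powr 1 \<le> norm (\<Phi> (of_real x)) powr q" using q by (intro powr_mono) auto
      then show ?thesis using False by simp
    qed
    also have "norm (\<Phi> (of_real x)) powr q = (1 + \<bar>x\<bar>) powr m * w x"
      by (simp add: w_def add_nonneg_eq_0_iff)
    also have "\<dots> \<le> (1 + R) ^ m' * w x"
    proof (intro mult_right_mono w_nn)
      have "(1 + \<bar>x\<bar>) powr m \<le> (1 + \<bar>x\<bar>) powr real m'" using m' by (intro powr_mono) auto
      also have "\<dots> = (1 + \<bar>x\<bar>) ^ m'" by (simp add: powr_realpow add_pos_nonneg)
      also have "\<dots> \<le> (1 + R) ^ m'" using that by (intro power_mono) auto
      finally show "(1 + \<bar>x\<bar>) powr m \<le> (1 + R) ^ m'" .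
    qed
    finally show ?thesis by simp
  qed
  have seg: "norm (G (of_real y) - G (of_real x)) \<le> (y - x) + (1 + R) ^ m' * I"
    if xy: "x \<le> y" "\<bar>x\<bar> \<le> R" "\<bar>y\<bar> \<le> R" for x y R :: real
  proof -
    have "((\<lambda>u. \<Phi> (of_real u)) has_integral (G (of_real y) - G (of_real x))) {x..y}"
    proof (rule fundamental_theorem_of_calculus[OF xy(1)])
      fix u assume "u \<in> {x..y}"
      show "((\<lambda>u. G (of_real u)) has_vector_derivative \<Phi> (of_real u)) (at u within {x..y})"
        by (rule has_vector_derivative_real_field) (rule G)
    qed
    moreover have bi: "((\<lambda>u. 1 + (1 + R) ^ m' * w u) has_integral
        (y - x) + (1 + R) ^ m' * integral {x..y} w) {x..y}"
      using w_cont has_integral_const_real[of "1::real" x y] xy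
      by (intro has_integral_add has_integral_mult_right integrable_integral integrable_continuous_interval
         continuous_on_subset[OF w_cont]) auto
    moreover have "norm (\<Phi> (of_real u)) \<le> 1 + (1 + R) ^ m' * w u" if "u \<in> {x..y}" for u
      by (rule pw) (use that xy in auto)
    ultimately have "norm (integral {x..y} (\<lambda>u. \<Phi> (of_real u))) \<le> integral {x..y} (\<lambda>u. 1 + (1 + R) ^ m' * w u)"
      by (intro Henstock_Kurzweil_Integration.integral_norm_bound_integral) (auto simp: has_integral_iff)
    then have "norm (G (of_real y) - G (of_real x)) \<le> (y - x) + (1 + R) ^ m' * integral {x..y} w"
      using \<open>((\<lambda>u. \<Phi> (of_real u)) has_integral _) _\<close> bi by (simp add: has_integral_iff)
    also have "integral {x..y} w \<le> I"
    proof -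
      have "integral {x..y} w \<le> integral UNIV w"
        using w_nn w_int integrable_on_lebesgue[OF w_int]
        by (intro integral_subset_le integrable_continuous_interval continuous_on_subset[OF w_cont]) auto
      also have "\<dots> = I" unfolding I_def by (rule integral_lebesgue[OF w_int])
      finally show ?thesis .
    qed
    finally show ?thesis using xy by (simp add: mult_left_mono)
  qed
  \<comment> \<open>The common exponent covers m' from the weight and N + 1 from the growth bound,
    the extra 1 being due to the length of the segment of integration.\<close>
  have axis: "norm (G (of_real x)) \<le> C' * (1 + \<bar>x\<bar>) ^ (N + m' + 1)" for x :: real
  proof -
    have "norm (G (of_real x)) \<le> \<bar>x\<bar> + (1 + \<bar>x\<bar>) ^ m' * I"
    proof (cases "x \<ge> 0")
      case True
      then show ?thesis using seg[of 0 x "\<bar>x\<bar>"] by (simp add: G_0)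
    next
      case False
      then show ?thesis using seg[of x 0 "\<bar>x\<bar>"] by (simp add: G_0)
    qed
    moreover have "\<bar>x\<bar> \<le> (1 + \<bar>x\<bar>) ^ (N + m' + 1)"
      using self_le_power[of "1 + \<bar>x\<bar>" "N + m' + 1"] by simp
    moreover have "(1 + \<bar>x\<bar>) ^ m' * I \<le> (1 + \<bar>x\<bar>) ^ (N + m' + 1) * I"
      using I by (intro mult_right_mono power_increasing) auto
    ultimately have "norm (G (of_real x)) \<le> (1 + I) * (1 + \<bar>x\<bar>) ^ (N + m' + 1)"
      unfolding distrib_right by (simp only: mult_1 mult.commute[of I])
    also have "\<dots> \<le> C' * (1 + \<bar>x\<bar>) ^ (N + m' + 1)"
      using C by (intro mult_right_mono) (auto simp: C'_def)
    finally show ?thesis .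
  qed
  have growth': "norm (G z) \<le> C' * (1 + norm z) ^ (N + m' + 1) * exp (A * (Re z)\<^sup>2)" for z
  proof -
    have "norm (G z - G 0) \<le> (C * (1 + norm z) ^ N * exp (A * (Re z)\<^sup>2)) * norm (z - 0)"
    proof (rule field_differentiable_bound[OF _ G])
      fix u assume "u \<in> closed_segment 0 z"
      then obtain t where t: "0 \<le> t" "t \<le> 1" "u = of_real t * z"
        by (auto simp: closed_segment_def scaleR_conv_of_real)
      have "norm (\<Phi> u) \<le> C * (1 + norm u) ^ N * exp (A * (Re u)\<^sup>2)" by (rule growth)
      also have "\<dots> \<le> C * (1 + norm z) ^ N * exp (A * (Re z)\<^sup>2)"
      proof (intro mult_mono mult_left_mono power_mono)
        show "1 + norm u \<le> 1 + norm z" using t by (simp add: norm_mult mult_left_le_one_le)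
        have "t\<^sup>2 \<le> 1" using t by (simp add: power_le_one)
        then have "(Re u)\<^sup>2 \<le> (Re z)\<^sup>2" using t by (simp add: power_mult_distrib mult_left_le_one_le)
        then show "exp (A * (Re u)\<^sup>2) \<le> exp (A * (Re z)\<^sup>2)" using A by (simp add: mult_left_mono)
      qed (use C in auto)
      finally show "norm (\<Phi> u) \<le> C * (1 + norm z) ^ N * exp (A * (Re z)\<^sup>2)" .
    qed auto
    then have "norm (G z) \<le> C * ((1 + norm z) ^ N * norm z) * exp (A * (Re z)\<^sup>2)"
      by (simp add: G_0 mult_ac)
    also have "\<dots> \<le> C' * (1 + norm z) ^ (N + m' + 1) * exp (A * (Re z)\<^sup>2)"
    proof (intro mult_right_mono mult_mono)
      have "(1 + norm z) ^ N * norm z \<le> (1 + norm z) ^ N * (1 + norm z)"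
        by (intro mult_left_mono) auto
      also have "\<dots> = (1 + norm z) ^ (N + 1)" by simp
      also have "\<dots> \<le> (1 + norm z) ^ (N + m' + 1)" by (intro power_increasing) auto
      finally show "(1 + norm z) ^ N * norm z \<le> (1 + norm z) ^ (N + m' + 1)" .
    qed (use C C' I in \<open>auto simp: C'_def\<close>)
    finally show ?thesis .
  qed
  obtain P where P: "\<And>z. G z = poly P z"
    using phragmen_lindelof_polynomial[OF G_hol A C' growth' axis] by blast
  have "\<Phi> z = poly (pderiv P) z" for z
  proof -
    have "G = poly P" using P by auto
    then show ?thesis using G[of z UNIV] poly_DERIV[of P z] DERIV_unique by blast
  qed
  then show thesis by (rule that)
qed

section \<open>The Dunkl kernel as a power series\<close>

lemma exp_series_bound:
  fixes c :: "nat \<Rightarrow> complex"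
  assumes c: "\<And>j. norm (c j) \<le> 1 / fact j"
  shows "summable (\<lambda>j. c j * z ^ j)" and "norm (\<Sum>j<n. c j * z ^ j) \<le> exp (norm z)"
    and "norm (\<Sum>j. c j * z ^ j) \<le> exp (norm z)"
proof -
  have le: "norm (c j * z ^ j) \<le> norm z ^ j / fact j" for j
    using mult_right_mono[OF c[of j], of "norm z ^ j"] by (simp add: norm_mult norm_power)
  have s: "summable (\<lambda>j. norm z ^ j / fact j)"
    using summable_exp[of "norm z"] by (simp add: field_simps)
  have e: "(\<Sum>j. norm z ^ j / fact j) = exp (norm z)"
    by (simp add: exp_def field_simps)
  show 1: "summable (\<lambda>j. c j * z ^ j)"
    by (rule summable_comparison_test'[OF s le])
  show 2: "norm (\<Sum>j<n. c j * z ^ j) \<le> exp (norm z)" for n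
  proof -
    have "norm (\<Sum>j<n. c j * z ^ j) \<le> (\<Sum>j<n. norm z ^ j / fact j)"
      by (rule sum_norm_le) (rule le)
    also have "\<dots> \<le> exp (norm z)" unfolding e[symmetric] by (rule sum_le_suminf[OF s]) auto
    finally show ?thesis .
  qed
  have "(\<lambda>n. norm (\<Sum>j<n. c j * z ^ j)) \<longlonglongrightarrow> norm (\<Sum>j. c j * z ^ j)"
    by (intro tendsto_norm summable_LIMSEQ 1)
  then show "norm (\<Sum>j. c j * z ^ j) \<le> exp (norm z)"
    by (rule LIMSEQ_le_const2) (use 2 in auto)
qed

text \<open>|x|^j / j! is a single term of the series of exp |x|, so one exponential moment controls
  every power.\<close>

lemma moment_integrable:
  fixes g :: "real \<Rightarrow> complex"
  assumes [measurable]: "g \<in> borel_measurable M" "(\<lambda>x. x) \<in> borel_measurable M"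
    and int: "integrable M (\<lambda>x. norm (g x) * exp \<bar>x\<bar>)"
  shows "integrable M (\<lambda>x. g x * of_real x ^ j)"
proof (rule Bochner_Integration.integrable_bound[OF integrable_mult_right[OF int, of "fact j"]])
  show "AE x in M. norm (g x * of_real x ^ j) \<le> norm (fact j * (norm (g x) * exp \<bar>x\<bar>))"
  proof (rule AE_I2)
    fix x :: real
    have "(\<lambda>i. \<bar>x\<bar> ^ i / fact i) sums exp \<bar>x\<bar>"
      using exp_converges[of "\<bar>x\<bar>"] by (simp add: field_simps)
    then have "\<bar>x\<bar> ^ j / fact j \<le> exp \<bar>x\<bar>"
      using sum_le_suminf[of "\<lambda>i. \<bar>x\<bar> ^ i / fact i" "{j}"] by (simp add: sums_iff)
    then have "norm (g x) * \<bar>x\<bar> ^ j \<le> norm (g x) * (fact j * exp \<bar>x\<bar>)"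
      by (intro mult_left_mono) (auto simp: field_simps)
    then show "norm (g x * of_real x ^ j) \<le> norm (fact j * (norm (g x) * exp \<bar>x\<bar>))"
      by (simp add: norm_mult norm_power mult_ac)
  qed
qed measurable

text \<open>Dominated convergence with majorant |g| exp(|z| |x|) exchanges sum and integral. The
  coefficients are left open because the lemma serves both the Dunkl kernel and the classical
  Fourier kernel, with coefficients i^j / j!.\<close>

lemma moment_series:
  fixes g :: "real \<Rightarrow> complex" and z :: complex
  assumes [measurable]: "g \<in> borel_measurable M" "(\<lambda>x. x) \<in> borel_measurable M"
    and int: "\<And>r. integrable M (\<lambda>x. norm (g x) * exp (r * \<bar>x\<bar>))"
    and c: "\<And>j. norm (c j) \<le> 1 / fact j"
  shows "(\<lambda>j. c j * (LINT x|M. g x * of_real x ^ j) * z ^ j) sums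
            (LINT x|M. g x * (\<Sum>j. c j * (z * of_real x) ^ j))" (is ?sums)
    and "norm (LINT x|M. g x * (\<Sum>j. c j * (z * of_real x) ^ j))
           \<le> (LINT x|M. norm (g x) * exp (norm z * \<bar>x\<bar>))" (is ?bound)
    and "integrable M (\<lambda>x. g x * (\<Sum>j. c j * (z * of_real x) ^ j))" (is ?int)
proof -
  define K where "K x = (\<Sum>j. c j * (z * of_real x) ^ j)" for x :: real
  have sumK: "(\<lambda>n. \<Sum>j<n. c j * (z * of_real x) ^ j) \<longlonglongrightarrow> K x" for x
    unfolding K_def by (intro summable_LIMSEQ exp_series_bound c)
  have [measurable]: "K \<in> borel_measurable M"
    by (rule borel_measurable_LIMSEQ_metric[OF _ sumK]) measurable
  have Kb: "norm (K x) \<le> exp (norm z * \<bar>x\<bar>)" for x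
    unfolding K_def using exp_series_bound(3)[of c "z * of_real x"] c by (simp add: norm_mult)
  have lim: "(\<lambda>n. LINT x|M. g x * (\<Sum>j<n. c j * (z * of_real x) ^ j)) \<longlonglongrightarrow> (LINT x|M. g x * K x)"
  proof (rule integral_dominated_convergence[OF _ _ int[of "norm z"]])
    show "AE x in M. (\<lambda>n. g x * (\<Sum>j<n. c j * (z * of_real x) ^ j)) \<longlonglongrightarrow> g x * K x"
      by (intro AE_I2 tendsto_mult tendsto_const sumK)
    fix n
    show "AE x in M. norm (g x * (\<Sum>j<n. c j * (z * of_real x) ^ j)) \<le> norm (g x) * exp (norm z * \<bar>x\<bar>)"
    proof (rule AE_I2)
      fix x
      show "norm (g x * (\<Sum>j<n. c j * (z * of_real x) ^ j)) \<le> norm (g x) * exp (norm z * \<bar>x\<bar>)"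
        using mult_left_mono[OF exp_series_bound(2)[of c "z * of_real x" n] norm_ge_zero[of "g x"]] c
        by (simp add: norm_mult)
    qed
  qed measurable
  have mi: "integrable M (\<lambda>x. g x * of_real x ^ j)" for j
    using moment_integrable[of g M j] int[of 1] by simp
  have "(LINT x|M. g x * (\<Sum>j<n. c j * (z * of_real x) ^ j)) =
        (\<Sum>j<n. c j * (LINT x|M. g x * of_real x ^ j) * z ^ j)" for n
  proof -
    have "(LINT x|M. g x * (\<Sum>j<n. c j * (z * of_real x) ^ j)) =
          (LINT x|M. (\<Sum>j<n. (c j * z ^ j) * (g x * of_real x ^ j)))"
      by (simp add: sum_distrib_left power_mult_distrib mult_ac)
    also have "\<dots> = (\<Sum>j<n. (c j * z ^ j) * (LINT x|M. g x * of_real x ^ j))"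
      using mi by (subst Bochner_Integration.integral_sum) auto
    finally show ?thesis by (simp add: mult_ac)
  qed
  with lim show ?sums unfolding sums_def K_def by simp
  have le: "norm (g x * K x) \<le> norm (g x) * exp (norm z * \<bar>x\<bar>)" for x
    using mult_left_mono[OF Kb[of x] norm_ge_zero[of "g x"]] by (simp add: norm_mult)
  have gi: "integrable M (\<lambda>x. g x * K x)"
    by (rule Bochner_Integration.integrable_bound[OF int[of "norm z"]]) (auto intro!: AE_I2 le simp: order_trans[OF le])
  then show ?int unfolding K_def .
  show ?bound unfolding K_def[symmetric]
    by (rule Bochner_Integration.integral_norm_bound_integral[OF gi int le])
qed

text \<open>Even indices come from j_k, odd ones from j_(k+1). Gamma quotients are written as rising
  factorials, and the denominator k + 1 of the odd part is absorbed through (k+1) (k+2)_i =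
  (k+1)_(i+1). For k = -1/2 this is (-i)^j / j!, the Fourier kernel.\<close>

definition dunkl_coeff :: "real \<Rightarrow> nat \<Rightarrow> complex" where
  "dunkl_coeff k j =
     (if even j then (- 1) ^ (j div 2) / of_real (4 ^ (j div 2) * fact (j div 2) * pochhammer (k + 1) (j div 2))
      else - \<i> * (- 1) ^ (j div 2) /
        of_real (2 * 4 ^ (j div 2) * fact (j div 2) * pochhammer (k + 1) (Suc (j div 2))))"

text \<open>In the induction the new factor 2i + 1 is at most 2 (k + 1 + i): this is where k \<ge>
  -1/2 enters, with equality throughout for k = -1/2.\<close>

lemma fact_even_le:
  assumes k: "k \<ge> - 1 / 2"
  shows "fact (2 * i) \<le> 4 ^ i * fact i * pochhammer (k + 1 :: real) i"
proof (induction i)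
  case (Suc i)
  have pp: "pochhammer (k + 1) i > 0" using k by (intro pochhammer_pos) auto
  have "fact (2 * Suc i) = (real (2 * i + 2) * real (2 * i + 1)) * fact (2 * i)"
    by (simp add: fact_Suc algebra_simps)
  also have "\<dots> \<le> (real (2 * i + 2) * (2 * (k + 1 + real i))) * (4 ^ i * fact i * pochhammer (k + 1) i)"
    using Suc k pp by (intro mult_mono) auto
  also have "\<dots> = 4 ^ Suc i * fact (Suc i) * pochhammer (k + 1) (Suc i)"
    by (simp add: pochhammer_Suc algebra_simps)
  finally show ?case .
qed auto

lemma norm_dunkl_coeff_le:
  assumes k: "k \<ge> - 1 / 2"
  shows "norm (dunkl_coeff k j) \<le> 1 / fact j"
proof -
  have pp: "pochhammer (k + 1) i > 0" for i using k by (intro pochhammer_pos) auto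
  show ?thesis
  proof (cases "even j")
    case True
    then obtain i where i: "j = 2 * i" by blast
    show ?thesis using fact_even_le[OF k, of i] pp[of i]
      by (simp add: i dunkl_coeff_def norm_divide norm_mult norm_power abs_mult divide_simps del: fact_Suc)
  next
    case False
    then obtain i where i: "j = 2 * i + 1" using oddE by blast
    \<comment> \<open>The odd case is the even estimate for i + 1 with the common factor 2i + 2
      cancelled.\<close>
    have "(2 * real i + 2) * fact (2 * i + 1) = fact (2 * Suc i)"
      by (simp add: fact_Suc algebra_simps)
    also have "\<dots> \<le> 4 ^ Suc i * fact (Suc i) * pochhammer (k + 1) (Suc i)"
      by (rule fact_even_le[OF k])
    also have "\<dots> = (2 * real i + 2) * (2 * 4 ^ i * fact i * pochhammer (k + 1) (Suc i))"
      by (simp add: fact_Suc algebra_simps)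
    finally have "fact (2 * i + 1) \<le> 2 * 4 ^ i * fact i * pochhammer (k + 1) (Suc i)"
      by (rule mult_left_le_imp_le) simp
    then show ?thesis using pp[of "Suc i"]
      by (simp add: i dunkl_coeff_def norm_divide norm_mult norm_power abs_mult divide_simps del: fact_Suc)
  qed
qed

lemma dunkl_coeff_nonzero: "k \<ge> - 1 / 2 \<Longrightarrow> dunkl_coeff k j \<noteq> 0"
  using pochhammer_pos[of "k + 1"] by (simp add: dunkl_coeff_def less_imp_neq[symmetric])

lemma bessel_j_sums:
  assumes k: "k \<ge> - 1 / 2"
  shows "(\<lambda>i. (- 1) ^ i / of_real (4 ^ i * fact i * pochhammer (k + 1) i) * u ^ (2 * i)) sums bessel_j k u"
proof -
  have pp: "pochhammer (k + 1) i > 0" for i using k by (intro pochhammer_pos) auto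
  have G: "Gamma (real i + k + 1) = Gamma (k + 1) * pochhammer (k + 1) i" for i
  proof -
    have "Gamma (k + 1) \<noteq> 0" using k Gamma_real_pos[of "k + 1"] by linarith
    moreover have "k + 1 \<notin> \<int>\<^sub>\<le>\<^sub>0" using k by (auto elim!: nonpos_Ints_cases)
    ultimately show ?thesis using pochhammer_Gamma[of "k + 1" i]
      by (simp add: field_simps)
  qed
  have Gk: "Gamma (k + 1) > 0" using k by (intro Gamma_real_pos) auto
  define t where "t i = (- 1) ^ i / of_real (4 ^ i * fact i * pochhammer (k + 1) i) * u ^ (2 * i)" for i
  have eq: "(- 1) ^ n * (u / 2) ^ (2 * n) / of_real (fact n * Gamma (real n + k + 1)) = t n / of_real (Gamma (k + 1))" for n
  proof -
    have "(2::complex) ^ (2 * n) = 4 ^ n" by (simp add: power_mult)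
    then show ?thesis using Gk pp[of n] unfolding G t_def by (simp add: power_divide)
  qed
  have "summable t"
  proof (rule summable_comparison_test')
    show "summable (\<lambda>n. (norm u ^ 2) ^ n / fact n)"
      using summable_exp[of "norm u ^ 2"] by (simp add: field_simps)
    fix n :: nat
    have "fact n \<le> (fact (2 * n) :: real)" by (rule fact_mono) auto
    then have "fact n \<le> 4 ^ n * fact n * pochhammer (k + 1) n"
      using fact_even_le[OF k, of n] by linarith
    moreover have "norm (t n) = (norm u ^ 2) ^ n / (4 ^ n * fact n * pochhammer (k + 1) n)"
      using pp[of n] by (simp add: t_def norm_mult norm_divide norm_power power_mult)
    ultimately show "norm (t n) \<le> (norm u ^ 2) ^ n / fact n"
      by (simp only:) (intro divide_left_mono mult_pos_pos, auto simp: pp)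
  qed
  then have "t sums (\<Sum>n. t n)" by (rule summable_sums)
  moreover have "bessel_j k u = (\<Sum>n. t n)"
    unfolding bessel_j_def eq using Gk \<open>summable t\<close> by (subst suminf_divide) auto
  ultimately show ?thesis unfolding t_def by simp
qed

text \<open>The even and the odd subseries are each padded with zeros by reindexing along a strictly
  monotone map, after which they can be added termwise.\<close>

lemma dunkl_kernel_series:
  assumes k: "k \<ge> - 1 / 2"
  shows "dunkl_kernel k l x = (\<Sum>j. dunkl_coeff k j * (l * of_real x) ^ j)"
proof -
  define u where "u = l * complex_of_real x"
  have k1: "k + 1 > 0" using k by simp
  define f where "f j = dunkl_coeff k j * u ^ j" for j
  have even: "(\<lambda>j. if even j then f j else 0) sums bessel_j k u"
  proof -
    have "(\<lambda>i. (\<lambda>j. if even j then f j else 0) (2 * i)) sums bessel_j k u"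
      using bessel_j_sums[OF k, of u] by (simp add: f_def dunkl_coeff_def)
    then show ?thesis
      by (subst (asm) sums_mono_reindex) (auto simp: strict_mono_def elim!: evenE)
  qed
  have odd: "(\<lambda>j. if odd j then f j else 0) sums (- \<i> * u / (2 * (of_real k + 1)) * bessel_j (k + 1) u)"
  proof -
    have "(\<lambda>i. - \<i> * u / (2 * (of_real k + 1)) *
       ((- 1) ^ i / of_real (4 ^ i * fact i * pochhammer (k + 1 + 1) i) * u ^ (2 * i)))
       sums (- \<i> * u / (2 * (of_real k + 1)) * bessel_j (k + 1) u)"
      by (intro sums_mult bessel_j_sums) (use k in auto)
    moreover have "- \<i> * u / (2 * (of_real k + 1)) *
       ((- 1) ^ i / of_real (4 ^ i * fact i * pochhammer (k + 1 + 1) i) * u ^ (2 * i)) = f (2 * i + 1)" for i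
    proof -
      have p: "complex_of_real (pochhammer (k + 1) (Suc i)) = (of_real k + 1) * of_real (pochhammer (k + 1 + 1) i)"
        by (simp only: pochhammer_rec of_real_mult of_real_add of_real_1)
      show ?thesis
        unfolding f_def dunkl_coeff_def by (simp add: p) (simp add: algebra_simps)
    qed
    ultimately have "(\<lambda>i. (\<lambda>j. if odd j then f j else 0) (2 * i + 1)) sums (- \<i> * u / (2 * (of_real k + 1)) * bessel_j (k + 1) u)"
      by simp
    then show ?thesis
      by (subst (asm) sums_mono_reindex) (auto simp: strict_mono_def elim!: oddE)
  qed
  have "(\<lambda>j. (if even j then f j else 0) + (if odd j then f j else 0)) sums
     (bessel_j k u + (- \<i> * u / (2 * (of_real k + 1)) * bessel_j (k + 1) u))"
    by (rule sums_add[OF even odd])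
  moreover have "(\<lambda>j. (if even j then f j else 0) + (if odd j then f j else 0)) = f" by auto
  ultimately have "f sums dunkl_kernel k l x"
    by (simp add: dunkl_kernel_def u_def mult.assoc)
  then show ?thesis unfolding f_def u_def by (rule sums_unique)
qed

lemma measurable_ident_lebesgue [measurable]: "(\<lambda>x::real. x) \<in> borel_measurable lebesgue"
  by (intro measurable_completion) measurable

section \<open>Gaussian bounds and degrees\<close>

lemma poly_gauss_bounded:
  fixes s L :: real
  assumes s: "s > 0"
  obtains K where "K \<ge> 0" and "\<And>x. (1 + \<bar>x\<bar>) powr L * exp (- s * x\<^sup>2) \<le> K"
proof -
  have "((\<lambda>x. (1 + x) powr L * exp (- s * x\<^sup>2)) \<longlongrightarrow> 0) at_top"
    using s by real_asymp
  then have "eventually (\<lambda>x. (1 + x) powr L * exp (- s * x\<^sup>2) < 1) at_top"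
    by (rule order_tendstoD) auto
  then obtain X where X: "\<And>x. x \<ge> X \<Longrightarrow> (1 + x) powr L * exp (- s * x\<^sup>2) < 1"
    by (auto simp: eventually_at_top_linorder)
  have "(1 + \<bar>x\<bar>) powr L * exp (- s * x\<^sup>2) \<le> 1 + (1 + \<bar>X\<bar>) powr \<bar>L\<bar>" for x
  proof (cases "\<bar>x\<bar> \<ge> X")
    case True
    then have "(1 + \<bar>x\<bar>) powr L * exp (- s * x\<^sup>2) < 1" using X[of "\<bar>x\<bar>"] by simp
    then show ?thesis by (simp add: add_increasing2)
  next
    case False
    have "(1 + \<bar>x\<bar>) powr L * exp (- s * x\<^sup>2) \<le> (1 + \<bar>x\<bar>) powr \<bar>L\<bar> * 1"
      using s by (intro mult_mono powr_mono) auto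
    also have "\<dots> \<le> (1 + \<bar>X\<bar>) powr \<bar>L\<bar>" using False by (simp add: powr_mono2)
    finally show ?thesis by simp
  qed
  then show thesis by (intro that[of "1 + (1 + \<bar>X\<bar>) powr \<bar>L\<bar>"]) auto
qed

text \<open>With u = |x| - r/(2s) one has r|x| - s x^2 = -s u^2 + r^2/(4s). Since 1 + |x| is at most
  a constant times (1 + r)(1 + |u|), the part in u is bounded and the polynomial loss falls on r
  alone, so the exponent r^2/(4s) stays sharp.\<close>

lemma gauss_exp_bound:
  fixes s :: real
  assumes s: "s > 0"
  obtains K where "K \<ge> 0"
    and "\<And>x r. r \<ge> 0 \<Longrightarrow> (1 + \<bar>x\<bar>) ^ N * exp (r * \<bar>x\<bar> - s * x\<^sup>2) \<le> K * (1 + r) ^ N * exp (r\<^sup>2 / (4 * s))"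
proof -
  obtain K0 where K0: "K0 \<ge> 0" "\<And>u. (1 + \<bar>u\<bar>) powr real N * exp (- s * u\<^sup>2) \<le> K0"
    using poly_gauss_bounded[OF s] by metis
  have gen: "1 + (u + a) \<le> (1 + a) * (1 + u)" if "a \<ge> 0" "u \<ge> 0" for a u :: real
    using that by (simp add: algebra_simps)
  define c where "c = 1 + 1 / (2 * s)"
  have c: "c \<ge> 1" using s by (simp add: c_def)
  have "(1 + \<bar>x\<bar>) ^ N * exp (r * \<bar>x\<bar> - s * x\<^sup>2) \<le> (c ^ N * K0) * (1 + r) ^ N * exp (r\<^sup>2 / (4 * s))" if r: "r \<ge> 0" for x r
  proof -
    define u where "u = \<bar>x\<bar> - r / (2 * s)"
    have sq: "r * \<bar>x\<bar> - s * x\<^sup>2 = - s * u\<^sup>2 + r\<^sup>2 / (4 * s)"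
    proof -
      have "x\<^sup>2 = \<bar>x\<bar>\<^sup>2" by simp
      then show ?thesis unfolding u_def using s by (simp add: power2_eq_square field_simps)
    qed
    have "1 + \<bar>x\<bar> \<le> 1 + (\<bar>u\<bar> + r / (2 * s))" unfolding u_def by linarith
    also have "\<dots> \<le> (1 + r / (2 * s)) * (1 + \<bar>u\<bar>)" using r s by (intro gen) auto
    also have "\<dots> \<le> (c * (1 + r)) * (1 + \<bar>u\<bar>)"
      using r s by (intro mult_right_mono) (simp_all add: c_def field_simps)
    finally have "(1 + \<bar>x\<bar>) ^ N \<le> ((c * (1 + r)) * (1 + \<bar>u\<bar>)) ^ N" by (intro power_mono) auto
    then have "(1 + \<bar>x\<bar>) ^ N * exp (r * \<bar>x\<bar> - s * x\<^sup>2)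
        \<le> ((c * (1 + r)) * (1 + \<bar>u\<bar>)) ^ N * exp (r * \<bar>x\<bar> - s * x\<^sup>2)"
      by (rule mult_right_mono) auto
    also have "\<dots> = (c ^ N * ((1 + \<bar>u\<bar>) powr real N * exp (- s * u\<^sup>2))) * ((1 + r) ^ N * exp (r\<^sup>2 / (4 * s)))"
      unfolding sq exp_add by (simp add: power_mult_distrib powr_realpow add_pos_nonneg mult_ac)
    also have "\<dots> \<le> (c ^ N * K0) * ((1 + r) ^ N * exp (r\<^sup>2 / (4 * s)))"
      using c r K0(2)[of u] by (intro mult_right_mono mult_left_mono) auto
    finally show ?thesis by (simp add: mult_ac)
  qed
  then show thesis using c K0(1) by (intro that[of "c ^ N * K0"]) auto
qed

lemma integrable_inverse_square_abs: "integrable lebesgue (\<lambda>x::real. (1 + \<bar>x\<bar>) powr (- 2))"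
proof -
  have "einterval (-\<infinity>) \<infinity> = UNIV" by (auto simp: einterval_def)
  then have "integrable lborel (\<lambda>x::real. inverse (1 + x\<^sup>2))"
    using integrable_inverse_1_plus_square by (simp add: set_integrable_def)
  then have *: "integrable lebesgue (\<lambda>x::real. inverse (1 + x\<^sup>2))"
    by (subst integrable_completion) auto
  have eq: "(1 + \<bar>x\<bar>) powr (- 2) = inverse ((1 + \<bar>x\<bar>)\<^sup>2)" for x :: real
    by (simp add: powr_minus powr_numeral)
  show ?thesis
  proof (rule Bochner_Integration.integrable_bound[OF *])
    show "(\<lambda>x::real. (1 + \<bar>x\<bar>) powr (- 2)) \<in> borel_measurable lebesgue" by measurable
    have "norm ((1 + \<bar>x\<bar>) powr (- 2)) \<le> norm (inverse (1 + x\<^sup>2))" for x :: real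
      unfolding eq by (auto simp: power2_eq_square algebra_simps intro!: le_imp_inverse_le add_pos_nonneg)
    then show "AE x::real in lebesgue. norm ((1 + \<bar>x\<bar>) powr (- 2)) \<le> norm (inverse (1 + x\<^sup>2))"
      by (rule AE_I2)
  qed
qed

text \<open>Two further powers of 1 + |x| are charged to the Gaussian, which leaves the integrable
  majorant (1 + |x|)^(-2).\<close>

lemma gauss_dominated_integrable:
  fixes h :: "real \<Rightarrow> 'b :: {banach, second_countable_topology}"
  assumes meas: "h \<in> borel_measurable lebesgue" and \<epsilon>: "\<epsilon> > 0"
    and le: "\<And>x. norm (h x) \<le> C * ((1 + \<bar>x\<bar>) powr L * exp (- \<epsilon> * x\<^sup>2))"
  shows "integrable lebesgue h"
proof -
  obtain K where K: "K \<ge> 0" "\<And>x. (1 + \<bar>x\<bar>) powr (L + 2) * exp (- \<epsilon> * x\<^sup>2) \<le> K"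
    using poly_gauss_bounded[OF \<epsilon>] by metis
  have "(1 + \<bar>x\<bar>) powr L * exp (- \<epsilon> * x\<^sup>2) \<le> K * (1 + \<bar>x\<bar>) powr (- 2)" for x
  proof -
    have "(1 + \<bar>x\<bar>) powr L * exp (- \<epsilon> * x\<^sup>2) = ((1 + \<bar>x\<bar>) powr (L + 2) * exp (- \<epsilon> * x\<^sup>2)) * (1 + \<bar>x\<bar>) powr (- 2)"
      by (simp add: powr_add powr_minus field_simps add_nonneg_eq_0_iff)
    also have "\<dots> \<le> K * (1 + \<bar>x\<bar>) powr (- 2)" by (intro mult_right_mono K) auto
    finally show ?thesis .
  qed
  then have *: "\<bar>C\<bar> * ((1 + \<bar>x\<bar>) powr L * exp (- \<epsilon> * x\<^sup>2)) \<le> \<bar>C\<bar> * (K * (1 + \<bar>x\<bar>) powr (- 2))" for x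
    by (rule mult_left_mono) auto
  have "norm (h x) \<le> \<bar>C\<bar> * (K * (1 + \<bar>x\<bar>) powr (- 2))" for x
  proof -
    have "norm (h x) \<le> \<bar>C\<bar> * ((1 + \<bar>x\<bar>) powr L * exp (- \<epsilon> * x\<^sup>2))"
      by (rule order_trans[OF le mult_right_mono]) auto
    then show ?thesis using * by (rule order_trans)
  qed
  then have "norm (h x) \<le> norm (\<bar>C\<bar> * (K * (1 + \<bar>x\<bar>) powr (- 2)))" for x
    by (rule order_trans) simp
  then show ?thesis
    by (intro Bochner_Integration.integrable_bound[OF integrable_mult_right[OF integrable_mult_right[OF integrable_inverse_square_abs]] meas]) auto
qed

section \<open>Size of polynomials, and divergence as a bound on their degree\<close>

lemma poly_upper_bound:
  fixes Q :: "complex poly"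
  obtains C where "C \<ge> 0" and "\<And>x. norm (poly Q (of_real x)) \<le> C * (1 + \<bar>x\<bar>) ^ degree Q"
proof
  show "0 \<le> (\<Sum>i\<le>degree Q. norm (coeff Q i))" by (intro sum_nonneg) auto
  fix x :: real
  have "norm (poly Q (of_real x)) \<le> (\<Sum>i\<le>degree Q. norm (coeff Q i) * \<bar>x\<bar> ^ i)"
    unfolding poly_altdef by (rule sum_norm_le) (simp add: norm_mult norm_power)
  also have "\<dots> \<le> (\<Sum>i\<le>degree Q. norm (coeff Q i) * (1 + \<bar>x\<bar>) ^ degree Q)"
  proof (intro sum_mono mult_left_mono)
    fix i assume "i \<in> {..degree Q}"
    have "\<bar>x\<bar> ^ i \<le> (1 + \<bar>x\<bar>) ^ i" by (intro power_mono) auto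
    also have "\<dots> \<le> (1 + \<bar>x\<bar>) ^ degree Q" using \<open>i \<in> _\<close> by (intro power_increasing) auto
    finally show "\<bar>x\<bar> ^ i \<le> (1 + \<bar>x\<bar>) ^ degree Q" .
  qed auto
  finally show "norm (poly Q (of_real x)) \<le> (\<Sum>i\<le>degree Q. norm (coeff Q i)) * (1 + \<bar>x\<bar>) ^ degree Q"
    by (simp add: sum_distrib_right)
qed

text \<open>Each coefficient step multiplies by x and adds a constant, absorbed for large x at the
  cost of halving c. The positive half-line is enough, since a divergence there already makes the
  integral in \<open>degree_less_of_integrable\<close> infinite.\<close>

lemma poly_lower_bound:
  fixes Q :: "complex poly"
  assumes "Q \<noteq> 0"
  obtains c X where "c > 0" "X \<ge> 1" and "\<And>x. x \<ge> X \<Longrightarrow> c * x ^ degree Q \<le> norm (poly Q (of_real x))"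
proof -
  have "\<exists>c X. c > 0 \<and> X \<ge> 1 \<and> (\<forall>x\<ge>X. c * x ^ degree Q \<le> norm (poly Q (of_real x)))"
    using assms
  proof (induction Q)
    case (pCons a Q)
    show ?case
    proof (cases "Q = 0")
      case True
      then have "a \<noteq> 0" using pCons by auto
      then show ?thesis using True by (intro exI[of _ "norm a"] exI[of _ 1]) auto
    next
      case False
      then obtain c X where c: "c > 0" "X \<ge> 1" "\<And>x. x \<ge> X \<Longrightarrow> c * x ^ degree Q \<le> norm (poly Q (of_real x))"
        using pCons by blast
      have "c / 2 * x ^ degree (pCons a Q) \<le> norm (poly (pCons a Q) (of_real x))"
        if x: "x \<ge> max X (2 * norm a / c)" for x
      proof -
        have x1: "x \<ge> 1" "x \<ge> X" using x c by auto
        have "norm a \<le> c / 2 * x" using x c by (simp add: field_simps)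
        also have "\<dots> \<le> c / 2 * x ^ Suc (degree Q)"
          using x1 c self_le_power[of x "Suc (degree Q)"] by (intro mult_left_mono) auto
        finally have a: "norm a \<le> c / 2 * x ^ Suc (degree Q)" .
        have "c * x ^ Suc (degree Q) = x * (c * x ^ degree Q)" by simp
        also have "\<dots> \<le> x * norm (poly Q (of_real x))" using x1 c by (intro mult_left_mono) auto
        also have "\<dots> = norm (of_real x * poly Q (of_real x))" using x1 by (simp add: norm_mult)
        also have "\<dots> \<le> norm a + norm (poly (pCons a Q) (of_real x))"
          using norm_triangle_ineq4[of "poly (pCons a Q) (of_real x)" a] by simp
        finally have "c * x ^ Suc (degree Q) \<le> norm a + norm (poly (pCons a Q) (of_real x))" .
        then show ?thesis using a False by simp
      qed
      then show ?thesis using c by (intro exI[of _ "c / 2"] exI[of _ "max X (2 * norm a / c)"]) auto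
    qed
  qed auto
  then show thesis using that by blast
qed

lemma nn_integral_inverse_infinite:
  fixes h :: "real \<Rightarrow> real"
  assumes c: "c > 0" and X: "X \<ge> 1" and le: "\<And>x. x \<ge> X \<Longrightarrow> c / x \<le> h x"
  shows "(\<integral>\<^sup>+ x. ennreal (h x) \<partial>lebesgue) = \<infinity>"
proof (rule ccontr)
  assume "\<not> ?thesis"
  then obtain I where I: "(\<integral>\<^sup>+ x. ennreal (h x) \<partial>lebesgue) = ennreal I" "I \<ge> 0"
    by (metis ennreal_cases infinity_ennreal_def)
  \<comment> \<open>T is chosen so that the integral of c/x over [X, T] is c ln(T/X) = I + 1, above
    the supposed value I.\<close>
  define T where "T = X * exp ((I + 1) / c)"
  have T: "T \<ge> X" using X I c mult_left_mono[of 1 "exp ((I + 1) / c)" X] by (simp add: T_def)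
  have "(\<integral>\<^sup>+ x. ennreal (c / x) * indicator {X..T} x \<partial>lborel) = ennreal (c * ln T - c * ln X)"
  proof (rule nn_integral_FTC_Icc)
    fix x assume x: "x \<in> {X..T}"
    show "((\<lambda>x. c * ln x) has_real_derivative c / x) (at x)"
      using x X by (auto intro!: derivative_eq_intros)
    show "0 \<le> c / x" using x X c by simp
  qed (use T in auto)
  also have "c * ln T - c * ln X = I + 1"
  proof -
    have "ln T - ln X = (I + 1) / c" using X by (simp add: T_def ln_mult)
    then show ?thesis using c by (simp add: field_simps flip: right_diff_distrib)
  qed
  finally have "ennreal (I + 1) = (\<integral>\<^sup>+ x. ennreal (c / x) * indicator {X..T} x \<partial>lebesgue)"
    by (simp add: nn_integral_completion)
  also have "\<dots> \<le> (\<integral>\<^sup>+ x. ennreal (h x) \<partial>lebesgue)"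
    using le by (intro nn_integral_mono) (auto simp: indicator_def intro: ennreal_leI)
  finally show False using I by (simp add: I)
qed

text \<open>For large x the integrand is at least a constant times x^(p deg Q + e - n), the constant
  containing 2^(-n) from 1 + x \<le> 2x, and such a power is integrable at infinity only if its
  exponent is below -1. The strict inequality matters: it reduces the polynomial to a constant when
  m \<le> 1 + q.\<close>

lemma degree_less_of_integrable:
  fixes Q :: "complex poly"
  assumes Q: "Q \<noteq> 0" and p: "p \<ge> 0" and n: "n \<ge> 0"
    and fin: "(\<integral>\<^sup>+ x. ennreal (\<bar>x\<bar> powr e * norm (poly Q (of_real x)) powr p / (1 + \<bar>x\<bar>) powr n) \<partial>lebesgue) < \<infinity>"
  shows "p * degree Q + e - n < - 1"
proof (rule ccontr)
  assume ge: "\<not> ?thesis"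
  obtain c X where c: "c > 0" "X \<ge> 1" "\<And>x. x \<ge> X \<Longrightarrow> c * x ^ degree Q \<le> norm (poly Q (of_real x))"
    using poly_lower_bound[OF Q] by blast
  have "(\<integral>\<^sup>+ x. ennreal (\<bar>x\<bar> powr e * norm (poly Q (of_real x)) powr p / (1 + \<bar>x\<bar>) powr n) \<partial>lebesgue) = \<infinity>"
  proof (rule nn_integral_inverse_infinite)
    show "0 < c powr p / 2 powr n" using c by simp
    show "X \<ge> 1" by (rule c)
    fix x assume x: "x \<ge> X"
    then have x1: "x \<ge> 1" using c by simp
    have "c powr p / 2 powr n / x = c powr p / 2 powr n * x powr (- 1)"
      using x1 by (simp add: powr_minus divide_inverse)
    also have "\<dots> \<le> c powr p / 2 powr n * x powr (p * degree Q + e - n)"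
      using x1 ge by (intro mult_left_mono powr_mono) auto
    also have "\<dots> = x powr e * (c powr p * x powr (p * degree Q)) / (2 powr n * x powr n)"
      using x1 by (simp add: powr_add powr_diff)
    also have "c powr p * x powr (p * degree Q) = (c * x ^ degree Q) powr p"
      using x1 c by (simp add: powr_mult powr_powr mult.commute flip: powr_realpow)
    also have "2 powr n * x powr n = (2 * x) powr n" using x1 by (simp add: powr_mult)
    also have "x powr e = \<bar>x\<bar> powr e" using x1 by simp
    also have "\<bar>x\<bar> powr e * (c * x ^ degree Q) powr p / (2 * x) powr n
       \<le> \<bar>x\<bar> powr e * norm (poly Q (of_real x)) powr p / (1 + \<bar>x\<bar>) powr n"
      using x1 c x p n by (intro frac_le mult_left_mono powr_mono2) (auto simp: abs_of_nonneg)
    finally show "c powr p / 2 powr n / x \<le> \<bar>x\<bar> powr e * norm (poly Q (of_real x)) powr p / (1 + \<bar>x\<bar>) powr n" .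
  qed
  with fin show False by simp
qed

section \<open>The measure mu_k as a weight over Lebesgue measure\<close>

definition dunkl_density :: "real \<Rightarrow> real \<Rightarrow> real" where
  "dunkl_density k x = \<bar>x\<bar> powr (2 * k + 1) / (2 powr (k + 1) * Gamma (k + 1))"

lemma dunkl_measure_eq: "dunkl_measure k = density lebesgue (\<lambda>x. ennreal (dunkl_density k x))"
  by (simp add: dunkl_measure_def dunkl_density_def)

lemma dunkl_density_measurable [measurable]: "dunkl_density k \<in> borel_measurable borel"
  unfolding dunkl_density_def by measurable

lemma dunkl_density_lebesgue: "dunkl_density k \<in> borel_measurable lebesgue"
  by measurable

lemma dunkl_const_pos: "k \<ge> - 1 / 2 \<Longrightarrow> 2 powr (k + 1) * Gamma (k + 1) > (0::real)"
  by (intro mult_pos_pos Gamma_real_pos) auto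

lemma dunkl_density_nonneg: "k \<ge> - 1 / 2 \<Longrightarrow> dunkl_density k x \<ge> 0"
  using dunkl_const_pos[of k] unfolding dunkl_density_def by (intro divide_nonneg_pos) auto

lemma dunkl_density_pos: "k \<ge> - 1 / 2 \<Longrightarrow> x \<noteq> 0 \<Longrightarrow> dunkl_density k x > 0"
  using dunkl_const_pos[of k] unfolding dunkl_density_def by (intro divide_pos_pos) auto

lemma dunkl_density_le:
  "k \<ge> - 1 / 2 \<Longrightarrow> dunkl_density k x \<le> (1 + \<bar>x\<bar>) powr (2 * k + 1) / (2 powr (k + 1) * Gamma (k + 1))"
  using dunkl_const_pos[of k] unfolding dunkl_density_def by (intro divide_right_mono powr_mono2) auto

lemma borel_measurable_dunkl [simp]: "borel_measurable (dunkl_measure k) = borel_measurable lebesgue"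
  by (simp add: dunkl_measure_def measurable_def)

lemma dunkl_integrable_iff:
  fixes h :: "real \<Rightarrow> 'b :: {banach, second_countable_topology}"
  assumes k: "k \<ge> - 1 / 2" and h: "h \<in> borel_measurable lebesgue"
  shows "integrable (dunkl_measure k) h \<longleftrightarrow> integrable lebesgue (\<lambda>x. dunkl_density k x *\<^sub>R h x)"
  unfolding dunkl_measure_eq
  by (rule integrable_density[OF h dunkl_density_lebesgue]) (simp add: dunkl_density_nonneg[OF k])

lemma dunkl_integral:
  fixes h :: "real \<Rightarrow> 'b :: {banach, second_countable_topology}"
  assumes k: "k \<ge> - 1 / 2" and h: "h \<in> borel_measurable lebesgue"
  shows "integral\<^sup>L (dunkl_measure k) h = integral\<^sup>L lebesgue (\<lambda>x. dunkl_density k x *\<^sub>R h x)"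
  unfolding dunkl_measure_eq
  by (rule integral_density[OF h dunkl_density_lebesgue]) (simp add: dunkl_density_nonneg[OF k])

lemma dunkl_nn_integral:
  assumes k: "k \<ge> - 1 / 2" and h: "h \<in> borel_measurable lebesgue"
  shows "(\<integral>\<^sup>+ x. ennreal (h x) \<partial>dunkl_measure k) = (\<integral>\<^sup>+ x. ennreal (dunkl_density k x * h x) \<partial>lebesgue)"
proof -
  have "ennreal (dunkl_density k x) * ennreal (h x) = ennreal (dunkl_density k x * h x)" for x
    by (rule ennreal_mult'[symmetric]) (rule dunkl_density_nonneg[OF k])
  then show ?thesis unfolding dunkl_measure_eq using h by (subst nn_integral_density) auto
qed

text \<open>The exponent is (2k + 1) + 2: the first summand compensates the growth of the density,
  the second leaves (1 + |x|)^(-2).\<close>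

lemma dunkl_power_integrable:
  assumes k: "k \<ge> - 1 / 2"
  shows "integrable (dunkl_measure k) (\<lambda>x. (1 + \<bar>x\<bar>) powr (- (2 * k + 3)))"
proof -
  have m: "(\<lambda>x::real. (1 + \<bar>x\<bar>) powr (- (2 * k + 3))) \<in> borel_measurable lebesgue"
    by measurable
  define C where "C = 2 powr (k + 1) * Gamma (k + 1)"
  have C: "C > 0" using dunkl_const_pos[OF k] by (simp add: C_def)
  have le: "norm (dunkl_density k x *\<^sub>R (1 + \<bar>x\<bar>) powr (- (2 * k + 3))) \<le> norm (1 / C * (1 + \<bar>x\<bar>) powr (- 2))" for x
  proof -
    have "dunkl_density k x * (1 + \<bar>x\<bar>) powr (- (2 * k + 3)) \<le> (1 + \<bar>x\<bar>) powr (2 * k + 1) / C * (1 + \<bar>x\<bar>) powr (- (2 * k + 3))"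
      unfolding C_def by (intro mult_right_mono dunkl_density_le[OF k]) auto
    also have "\<dots> = 1 / C * (1 + \<bar>x\<bar>) powr (- 2)"
      by (simp flip: powr_add)
    finally show ?thesis using C dunkl_density_nonneg[OF k] by simp
  qed
  show ?thesis
    unfolding dunkl_integrable_iff[OF k m]
    by (rule Bochner_Integration.integrable_bound[OF integrable_mult_right[OF integrable_inverse_square_abs, of "1 / C"]])
      (use le m dunkl_density_lebesgue[of k] in auto)
qed

text \<open>For h = |f| exp(s x^2) (1 + |x|)^(-n/p), h^p is the integrable H, and h \<le> 1 + H
  because p \<ge> 1. The constant 1 is not integrable for mu_k; replacing it by the second summand
  of w costs a power of 1 + |x|. Hence |f| \<le> w (1 + |x|)^N exp(-s x^2) with w integrable, and
  \<open>gauss_exp_bound\<close> controls everything except w uniformly in x.\<close>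

lemma exponential_integral_bound:
  fixes f :: "real \<Rightarrow> complex"
  assumes k: "k \<ge> - 1 / 2" and s: "s > 0" and p: "p \<ge> 1" and n: "n \<ge> 0"
    and f[measurable]: "f \<in> borel_measurable lebesgue"
    and fin: "(\<integral>\<^sup>+ x. ennreal (exp (s * p * x\<^sup>2) * norm (f x) powr p / (1 + \<bar>x\<bar>) powr n) \<partial>dunkl_measure k) < \<infinity>"
  obtains C N where "C \<ge> 0"
    and "\<And>r. integrable (dunkl_measure k) (\<lambda>x. norm (f x) * exp (r * \<bar>x\<bar>))"
    and "\<And>r. r \<ge> 0 \<Longrightarrow> (LINT x|dunkl_measure k. norm (f x) * exp (r * \<bar>x\<bar>)) \<le> C * (1 + r) ^ N * exp (r\<^sup>2 / (4 * s))"
proof -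
  define H where "H x = exp (s * p * x\<^sup>2) * norm (f x) powr p / (1 + \<bar>x\<bar>) powr n" for x
  have Hm[measurable]: "H \<in> borel_measurable lebesgue" unfolding H_def by measurable
  have H_int: "integrable (dunkl_measure k) H"
    using fin unfolding H_def[symmetric] by (intro integrableI_nonneg) (auto simp: H_def)
  define w where "w x = H x + (1 + \<bar>x\<bar>) powr (- (2 * k + 3))" for x
  have w_int: "integrable (dunkl_measure k) w"
    unfolding w_def using H_int dunkl_power_integrable[OF k] by (rule Bochner_Integration.integrable_add)
  have w_nn: "w x \<ge> 0" for x by (simp add: w_def H_def)
  obtain N :: nat where N: "n / p + (2 * k + 3) \<le> real N" using real_arch_simple by blast
  have f_le: "norm (f x) \<le> w x * (1 + \<bar>x\<bar>) ^ N * exp (- s * x\<^sup>2)" for x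
  proof -
    define h where "h = norm (f x) * exp (s * x\<^sup>2) / (1 + \<bar>x\<bar>) powr (n / p)"
    have hp: "h powr p = H x"
    proof -
      have "h powr p = norm (f x) powr p * exp (s * x\<^sup>2) powr p / ((1 + \<bar>x\<bar>) powr (n / p)) powr p"
        unfolding h_def by (subst powr_divide) (auto simp: powr_mult)
      also have "exp (s * x\<^sup>2) powr p = exp (s * p * x\<^sup>2)" by (simp add: powr_def)
      also have "((1 + \<bar>x\<bar>) powr (n / p)) powr p = (1 + \<bar>x\<bar>) powr n" using p by (simp add: powr_powr)
      finally show ?thesis by (simp add: H_def)
    qed
    have h1: "h \<le> 1 + H x"
    proof (cases "h \<le> 1")
      case True
      then show ?thesis by (simp add: H_def add_increasing2)
    next
      case False
      then have "h powr 1 \<le> h powr p" using p by (intro powr_mono) auto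
      then show ?thesis using False hp by simp
    qed
    have "norm (f x) = h * (1 + \<bar>x\<bar>) powr (n / p) * exp (- s * x\<^sup>2)"
      by (simp add: h_def exp_minus field_simps add_nonneg_eq_0_iff)
    also have "\<dots> \<le> (w x * (1 + \<bar>x\<bar>) powr (2 * k + 3)) * (1 + \<bar>x\<bar>) powr (n / p) * exp (- s * x\<^sup>2)"
    proof (intro mult_right_mono)
      have "1 + H x \<le> H x * (1 + \<bar>x\<bar>) powr (2 * k + 3) + 1"
        using k mult_left_mono[of 1 "(1 + \<bar>x\<bar>) powr (2 * k + 3)" "H x"]
        by (simp add: ge_one_powr_ge_zero H_def)
      also have "\<dots> = w x * (1 + \<bar>x\<bar>) powr (2 * k + 3)"
        unfolding w_def distrib_right by (simp flip: powr_add)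
      finally show "h \<le> w x * (1 + \<bar>x\<bar>) powr (2 * k + 3)" using h1 by simp
    qed auto
    also have "\<dots> = w x * (1 + \<bar>x\<bar>) powr (n / p + (2 * k + 3)) * exp (- s * x\<^sup>2)"
      by (simp add: powr_add mult_ac)
    also have "\<dots> \<le> w x * (1 + \<bar>x\<bar>) powr real N * exp (- s * x\<^sup>2)"
      using N by (intro mult_right_mono mult_left_mono powr_mono w_nn) auto
    finally show ?thesis by (simp add: powr_realpow add_pos_nonneg)
  qed
  obtain K where K: "K \<ge> 0" "\<And>x r. r \<ge> 0 \<Longrightarrow> (1 + \<bar>x\<bar>) ^ N * exp (r * \<bar>x\<bar> - s * x\<^sup>2) \<le> K * (1 + r) ^ N * exp (r\<^sup>2 / (4 * s))"
    using gauss_exp_bound[OF s] by blast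
  have le: "norm (f x) * exp (r * \<bar>x\<bar>) \<le> (K * (1 + r) ^ N * exp (r\<^sup>2 / (4 * s))) * w x" if "r \<ge> 0" for r x
  proof -
    have "norm (f x) * exp (r * \<bar>x\<bar>) \<le> (w x * (1 + \<bar>x\<bar>) ^ N * exp (- s * x\<^sup>2)) * exp (r * \<bar>x\<bar>)"
      by (intro mult_right_mono f_le) auto
    also have "\<dots> = w x * ((1 + \<bar>x\<bar>) ^ N * exp (r * \<bar>x\<bar> - s * x\<^sup>2))"
      by (simp add: exp_diff exp_minus field_simps)
    also have "\<dots> \<le> w x * (K * (1 + r) ^ N * exp (r\<^sup>2 / (4 * s)))"
      using that by (intro mult_left_mono K w_nn)
    finally show ?thesis by (simp add: mult_ac)
  qed
  have int0: "integrable (dunkl_measure k) (\<lambda>x. norm (f x) * exp (r * \<bar>x\<bar>))" if "r \<ge> 0" for r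
  proof (rule Bochner_Integration.integrable_bound[OF integrable_mult_right[OF w_int, of "K * (1 + r) ^ N * exp (r\<^sup>2 / (4 * s))"]])
    show "AE x in dunkl_measure k. norm (norm (f x) * exp (r * \<bar>x\<bar>)) \<le> norm (K * (1 + r) ^ N * exp (r\<^sup>2 / (4 * s)) * w x)"
      using le[OF that] by (auto intro!: AE_I2 order_trans[OF _ abs_ge_self])
  qed simp
  show thesis
  proof (rule that[of "K * (LINT x|dunkl_measure k. w x)" N])
    show "0 \<le> K * (LINT x|dunkl_measure k. w x)"
      using K(1) w_nn by (intro mult_nonneg_nonneg integral_nonneg_AE) auto
    show "integrable (dunkl_measure k) (\<lambda>x. norm (f x) * exp (r * \<bar>x\<bar>))" for r
    proof (rule Bochner_Integration.integrable_bound[OF int0[of "\<bar>r\<bar>"]])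
      show "AE x in dunkl_measure k. norm (norm (f x) * exp (r * \<bar>x\<bar>)) \<le> norm (norm (f x) * exp (\<bar>r\<bar> * \<bar>x\<bar>))"
        by (auto intro!: AE_I2 mult_left_mono mult_right_mono)
    qed auto
    fix r :: real assume r: "r \<ge> 0"
    have "(LINT x|dunkl_measure k. norm (f x) * exp (r * \<bar>x\<bar>)) \<le>
       (LINT x|dunkl_measure k. (K * (1 + r) ^ N * exp (r\<^sup>2 / (4 * s))) * w x)"
      by (intro integral_mono int0 integrable_mult_right w_int le r)
    then show "(LINT x|dunkl_measure k. norm (f x) * exp (r * \<bar>x\<bar>)) \<le>
       K * (LINT x|dunkl_measure k. w x) * (1 + r) ^ N * exp (r\<^sup>2 / (4 * s))"
      by (simp add: mult_ac)
  qed
qed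

section \<open>Transforms of polynomials times Gaussians\<close>

text \<open>(\<alpha> + i)_l is a polynomial in i, and a factor i shifts the exponential series by
  one index. The recursion is (\<alpha> + i)_(l+1) = (\<alpha> + l) (\<alpha> + i)_l + i (\<alpha> +
  i)_l, whose last term sums to w times the series for \<alpha> + 1. Up to normalisation R is a
  Laguerre polynomial in -w.\<close>

lemma pochhammer_exp_sums:
  "\<exists>R :: complex poly. degree R = l \<and> R \<noteq> 0 \<and>
     (\<forall>w. (\<lambda>i. of_real (pochhammer (\<alpha> + real i) l) * w ^ i / fact i) sums (poly R w * exp w))"
proof (induction l arbitrary: \<alpha>)
  case 0
  have "(\<lambda>i. w ^ i / fact i) sums exp w" for w :: complex
    using exp_converges[of w] by (simp add: scaleR_conv_of_real field_simps)
  then show ?case by (intro exI[of _ 1]) simp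
next
  case (Suc l)
  obtain R :: "complex poly" where R: "degree R = l" "R \<noteq> 0"
    "\<And>w. (\<lambda>i. of_real (pochhammer (\<alpha> + real i) l) * w ^ i / fact i) sums (poly R w * exp w)"
    using Suc[of \<alpha>] by blast
  obtain S :: "complex poly" where S: "degree S = l" "S \<noteq> 0"
    "\<And>w. (\<lambda>i. of_real (pochhammer (\<alpha> + 1 + real i) l) * w ^ i / fact i) sums (poly S w * exp w)"
    using Suc[of "\<alpha> + 1"] by blast
  define P where "P = smult (of_real (\<alpha> + real l)) R + pCons 0 S"
  \<comment> \<open>This summand alone reaches degree l + 1, so no cancellation can occur and the
    degree is exact for every \<alpha>.\<close>
  have dS: "degree (pCons 0 S) = Suc l" using S by simp
  have "degree P = Suc l"
    unfolding P_def using R dS by (subst degree_add_eq_right) (auto intro!: le_imp_less_Suc degree_smult_le[THEN order_trans])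
  moreover have "(\<lambda>i. of_real (pochhammer (\<alpha> + real i) (Suc l)) * w ^ i / fact i) sums (poly P w * exp w)" for w
  proof -
    define u where "u i = of_nat i * of_real (pochhammer (\<alpha> + real i) l) * w ^ i / (fact i :: complex)" for i
    have S1: "(\<lambda>i. w * (of_real (pochhammer (\<alpha> + 1 + real i) l) * w ^ i / fact i)) sums (w * (poly S w * exp w))"
      by (rule sums_mult) (rule S)
    have eqi: "pochhammer (\<alpha> + real (Suc i)) l = pochhammer (\<alpha> + 1 + real i) l" for i
      by (simp add: ac_simps)
    have "w * (of_real (pochhammer (\<alpha> + 1 + real i) l) * w ^ i / fact i) = u (Suc i)" for i
      unfolding u_def eqi fact_Suc of_nat_mult using of_nat_neq_0[of i, where 'a=complex]
      by (simp add: field_simps del: of_nat_Suc)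
    with S1 have "(\<lambda>i. u (Suc i)) sums (w * (poly S w * exp w))" by simp
    then have "u sums (w * (poly S w * exp w))"
      by (subst (asm) sums_Suc_iff) (simp add: u_def)
    from sums_add[OF sums_mult[OF R(3), of "of_real (\<alpha> + real l)" w] this]
    have "(\<lambda>i. of_real (\<alpha> + real l) * (of_real (pochhammer (\<alpha> + real i) l) * w ^ i / fact i) + u i)
       sums (poly P w * exp w)" by (simp add: P_def algebra_simps)
    moreover have "of_real (\<alpha> + real l) * (of_real (pochhammer (\<alpha> + real i) l) * w ^ i / fact i) + u i
       = of_real (pochhammer (\<alpha> + real i) (Suc l)) * w ^ i / fact i" for i
      unfolding u_def pochhammer_Suc by (simp add: field_simps)
    ultimately show ?thesis by simp
  qed
  ultimately show ?case by (intro exI[of _ P]) auto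
qed

lemma even_integral:
  fixes h :: "real \<Rightarrow> real"
  assumes [measurable]: "h \<in> borel_measurable borel" and even: "\<And>x. h (- x) = h x"
    and int: "set_integrable lborel {0<..} h"
  shows "integrable lborel h" and "(LINT x|lborel. h x) = 2 * (LINT x:{0<..}|lborel. h x)"
proof -
  have i1: "integrable lborel (\<lambda>x. indicator {0<..} x * h x)"
    using int by (simp add: set_integrable_def)
  have eq: "indicator {0<..} (0 + (- 1) * x) * h (0 + (- 1) * x) = indicator {..<0} x * h x" for x
    by (simp add: even indicator_def)
  have i2: "integrable lborel (\<lambda>x. indicator {..<0} x * h x)"
    using lborel_integrable_real_affine[OF i1, of "- 1" 0] unfolding eq by simp
  have e2: "(LINT x|lborel. indicator {..<0} x * h x) = (LINT x|lborel. indicator {0<..} x * h x)"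
    using lborel_integral_real_affine[of "- 1" "\<lambda>x. indicator {0<..} x * h x" 0] unfolding eq by simp
  have ae: "AE x in lborel. indicator {0<..} x * h x + indicator {..<0} x * h x = h x"
    using AE_lborel_singleton[of 0] by eventually_elim (auto simp: indicator_def)
  have i3: "integrable lborel (\<lambda>x. indicator {0<..} x * h x + indicator {..<0} x * h x)"
    using i1 i2 by simp
  show "integrable lborel h"
    by (rule integrable_cong_AE_imp[OF i3 _ ae]) simp
  have "(LINT x|lborel. h x) = (LINT x|lborel. indicator {0<..} x * h x + indicator {..<0} x * h x)"
    using ae by (intro integral_cong_AE) auto
  then show "(LINT x|lborel. h x) = 2 * (LINT x:{0<..}|lborel. h x)"
    using i1 i2 e2 by (simp add: set_lebesgue_integral_def)
qed

text \<open>The substitution t = s x^2 turns the Gamma integral into one over the positive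
  half-line; the doubling by evenness cancels the factor 2 of the derivative.\<close>

lemma gaussian_abs_moment:
  fixes a s :: real
  assumes a: "a > 0" and s: "s > 0"
  shows "(LINT x|lebesgue. \<bar>x\<bar> powr (2 * a - 1) * exp (- s * x\<^sup>2)) = Gamma a / s powr a"
proof -
  define f where "f t = t powr (a - 1) / exp t" for t :: real
  have "(f has_integral Gamma a) {0..}"
    unfolding f_def by (rule Gamma_integral_real[OF a])
  then have f0: "(f has_integral Gamma a) {0<..}"
    by (rule has_integral_spike_set_eq[THEN iffD1, rotated 2])
      (auto intro: negligible_subset[of "{0}"])
  have f1: "f absolutely_integrable_on {0<..}"
    using f0 by (intro nonnegative_absolutely_integrable_1) (auto simp: f_def has_integral_iff)
  have img: "(\<lambda>x. s * x\<^sup>2) ` {0<..} = {0<..}"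
  proof safe
    fix t :: real assume "t > 0"
    then show "t \<in> (\<lambda>x. s * x\<^sup>2) ` {0<..}" using s by (intro image_eqI[of _ _ "sqrt (t / s)"]) auto
  qed (use s in auto)
  have iff: "(\<lambda>x. \<bar>2 * s * x\<bar> * f (s * x\<^sup>2)) absolutely_integrable_on {0<..} \<and>
        integral {0<..} (\<lambda>x. \<bar>2 * s * x\<bar> * f (s * x\<^sup>2)) = Gamma a \<longleftrightarrow>
        f absolutely_integrable_on (\<lambda>x. s * x\<^sup>2) ` {0<..} \<and> integral ((\<lambda>x. s * x\<^sup>2) ` {0<..}) f = Gamma a"
    by (rule has_absolute_integral_change_of_variables_1')
      (use s in \<open>auto intro!: derivative_eq_intros simp: inj_on_def\<close>)
  have "(\<lambda>x. \<bar>2 * s * x\<bar> * f (s * x\<^sup>2)) absolutely_integrable_on {0<..} \<and>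
        integral {0<..} (\<lambda>x. \<bar>2 * s * x\<bar> * f (s * x\<^sup>2)) = Gamma a"
    using iff f0 f1 unfolding img by (simp add: has_integral_iff)
  moreover have pt: "\<bar>2 * s * x\<bar> * f (s * x\<^sup>2) = 2 * s powr a * (\<bar>x\<bar> powr (2 * a - 1) * exp (- s * x\<^sup>2))" if "x \<in> {0<..}" for x
  proof -
    have "f (s * x\<^sup>2) = s powr (a - 1) * x powr (2 * (a - 1)) * exp (- s * x\<^sup>2)"
      using that s by (simp add: f_def powr_mult exp_minus field_simps powr_powr flip: powr_numeral)
    moreover have "s * s powr (a - 1) = s powr a" using s by (simp add: powr_diff)
    moreover have "x * x powr (2 * (a - 1)) = x powr (2 * a - 1)"
      using that powr_add[of x 1 "2 * (a - 1)"] by (simp add: algebra_simps)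
    moreover have "\<bar>2 * s * x\<bar> * (s powr (a - 1) * x powr (2 * (a - 1)) * exp (- s * x\<^sup>2))
       = 2 * (s * s powr (a - 1)) * ((x * x powr (2 * (a - 1))) * exp (- s * x\<^sup>2))"
      using that s by (simp add: abs_mult)
    ultimately show ?thesis using that by (simp only:) simp
  qed
  moreover have "(\<lambda>x. \<bar>2 * s * x\<bar> * f (s * x\<^sup>2)) absolutely_integrable_on {0<..} \<longleftrightarrow>
      (\<lambda>x. 2 * s powr a * (\<bar>x\<bar> powr (2 * a - 1) * exp (- s * x\<^sup>2))) absolutely_integrable_on {0<..}"
    by (rule set_integrable_cong[OF refl refl pt])
  moreover have "integral {0<..} (\<lambda>x. \<bar>2 * s * x\<bar> * f (s * x\<^sup>2)) =
      integral {0<..} (\<lambda>x. 2 * s powr a * (\<bar>x\<bar> powr (2 * a - 1) * exp (- s * x\<^sup>2)))"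
    by (rule Henstock_Kurzweil_Integration.integral_cong[OF pt])
  ultimately have ab: "(\<lambda>x. 2 * s powr a * (\<bar>x\<bar> powr (2 * a - 1) * exp (- s * x\<^sup>2))) absolutely_integrable_on {0<..}"
    and eq: "integral {0<..} (\<lambda>x. 2 * s powr a * (\<bar>x\<bar> powr (2 * a - 1) * exp (- s * x\<^sup>2))) = Gamma a"
    by auto
  define h where "h x = \<bar>x\<bar> powr (2 * a - 1) * exp (- s * x\<^sup>2)" for x
  have hb: "h \<in> borel_measurable borel" unfolding h_def by measurable
  then have hl': "h \<in> borel_measurable lborel" by simp
  have hab: "h absolutely_integrable_on {0<..}"
    using ab s absolutely_integrable_on_scaleR_iff[where c = "2 * s powr a" and f = h and S = "{0<..}"] by (simp add: h_def)
  have hl: "set_integrable lborel {0<..} h"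
    using hab unfolding set_integrable_def by (subst (asm) integrable_completion) (use hb in auto)
  have "2 * s powr a * integral {0<..} h = Gamma a"
    using eq unfolding h_def by simp
  moreover have "integral {0<..} h = (LINT x:{0<..}|lborel. h x)"
    using set_lebesgue_integral_eq_integral(2)[OF hab]
    unfolding set_lebesgue_integral_def by (subst (asm) integral_completion) (use hb in auto)
  moreover have "(LINT x|lborel. h x) = 2 * (LINT x:{0<..}|lborel. h x)"
  proof (rule even_integral(2)[OF _ _ hl])
    show "h (- x) = h x" for x by (simp add: h_def)
  qed (rule hb)
  moreover have "(LINT x|lebesgue. h x) = (LINT x|lborel. h x)" by (rule integral_completion) (rule hl')
  ultimately have "(LINT x|lebesgue. h x) * s powr a = Gamma a" by (simp add: mult_ac)
  then show ?thesis using s unfolding h_def by (simp add: field_simps)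
qed

text \<open>The even moments are Gaussian moments with parameter a = k + 1 + i, and Gamma(k + 1 + i)
  / Gamma(k + 1) is the rising factorial. The odd ones equal their own negatives under x ->
  -x.\<close>

lemma dunkl_gaussian_moment:
  assumes k: "k \<ge> - 1 / 2" and s: "s > 0"
  shows "(LINT x|dunkl_measure k. of_real (exp (- s * x\<^sup>2)) * of_real x ^ (2 * i)) =
           complex_of_real (pochhammer (k + 1) i / ((2 * s) powr (k + 1) * s ^ i))" (is ?even)
    and "(LINT x|dunkl_measure k. of_real (exp (- s * x\<^sup>2)) * of_real x ^ (2 * i + 1)) = (0 :: complex)" (is ?odd)
proof -
  have conv: "(LINT x|dunkl_measure k. of_real (exp (- s * x\<^sup>2)) * of_real x ^ j) =
      complex_of_real (LINT x|lebesgue. dunkl_density k x * (exp (- s * x\<^sup>2) * x ^ j))" for j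
  proof -
    have "(\<lambda>x. of_real (exp (- s * x\<^sup>2)) * of_real x ^ j :: complex) \<in> borel_measurable lebesgue" by measurable
    from dunkl_integral[OF k this] show ?thesis
      by (simp add: scaleR_conv_of_real flip: of_real_power of_real_mult)
  qed
  have C: "2 powr (k + 1) * Gamma (k + 1) > 0" by (rule dunkl_const_pos[OF k])
  have Gk: "Gamma (k + 1) > 0" using k by (intro Gamma_real_pos) auto
  have "dunkl_density k x * (exp (- s * x\<^sup>2) * x ^ (2 * i)) =
     1 / (2 powr (k + 1) * Gamma (k + 1)) * (\<bar>x\<bar> powr (2 * (k + 1 + real i) - 1) * exp (- s * x\<^sup>2))" for x
  proof (cases "x = 0")
    case False
    then have "x ^ (2 * i) = \<bar>x\<bar> powr (2 * real i)"
      using powr_realpow[of "\<bar>x\<bar>" "2 * i"] by (simp add: power_mult)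
    moreover have "\<bar>x\<bar> powr (2 * (k + 1 + real i) - 1) = \<bar>x\<bar> powr (2 * k + 1) * \<bar>x\<bar> powr (2 * real i)"
      by (simp add: algebra_simps flip: powr_add)
    ultimately show ?thesis by (simp add: dunkl_density_def)
  qed (simp add: dunkl_density_def)
  then have "(LINT x|lebesgue. dunkl_density k x * (exp (- s * x\<^sup>2) * x ^ (2 * i))) =
     1 / (2 powr (k + 1) * Gamma (k + 1)) * (Gamma (k + 1 + real i) / s powr (k + 1 + real i))"
    using k s by (simp only: Bochner_Integration.integral_mult_right_zero) (subst gaussian_abs_moment, auto)
  also have "Gamma (k + 1 + real i) = pochhammer (k + 1) i * Gamma (k + 1)"
  proof -
    have "k + 1 \<notin> \<int>\<^sub>\<le>\<^sub>0" using k by (auto elim!: nonpos_Ints_cases)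
    then show ?thesis using pochhammer_Gamma[of "k + 1" i] Gk by (simp add: field_simps)
  qed
  also have "s powr (k + 1 + real i) = s powr (k + 1) * s ^ i"
    using s by (simp add: powr_add powr_realpow)
  also have "1 / (2 powr (k + 1) * Gamma (k + 1)) * (pochhammer (k + 1) i * Gamma (k + 1) / (s powr (k + 1) * s ^ i))
     = pochhammer (k + 1) i / ((2 * s) powr (k + 1) * s ^ i)"
    using Gk s by (simp add: powr_mult)
  finally show ?even unfolding conv by simp
  define h where "h x = dunkl_density k x * (exp (- s * x\<^sup>2) * x ^ (2 * i + 1))" for x
  have hm: "h \<in> borel_measurable borel" unfolding h_def by measurable
  have odd: "h (0 + (- 1) * x) = - h x" for x by (simp add: h_def dunkl_density_def)
  have "(LINT x|lborel. h x) = - (LINT x|lborel. h x)"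
    using lborel_integral_real_affine[of "- 1" h 0] unfolding odd by simp
  then have "(LINT x|lebesgue. h x) = 0" using hm by (subst integral_completion) auto
  then show ?odd unfolding conv h_def by simp
qed

lemma poly_gauss_exp_integrable:
  fixes Q :: "complex poly"
  assumes k: "k \<ge> - 1 / 2" and s: "s > 0"
  shows "integrable (dunkl_measure k) (\<lambda>x. norm (poly Q (of_real x) * of_real (exp (- s * x\<^sup>2))) * exp (r * \<bar>x\<bar>))"
proof -
  obtain C where C: "C \<ge> 0" "\<And>x. norm (poly Q (of_real x)) \<le> C * (1 + \<bar>x\<bar>) ^ degree Q"
    using poly_upper_bound by blast
  have m: "(\<lambda>x. norm (poly Q (of_real x) * of_real (exp (- s * x\<^sup>2))) * exp (r * \<bar>x\<bar>)) \<in> borel_measurable lebesgue"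
  proof -
    have "(\<lambda>x. poly Q (of_real x)) \<in> borel_measurable borel"
      by (intro borel_measurable_continuous_onI continuous_intros)
    then have [measurable]: "(\<lambda>x. poly Q (of_real x)) \<in> borel_measurable lebesgue"
      by (intro measurable_completion) simp
    show ?thesis by measurable
  qed
  define D where "D = 2 powr (k + 1) * Gamma (k + 1)"
  have D: "D > 0" unfolding D_def by (rule dunkl_const_pos[OF k])
  \<comment> \<open>(s|x| - r)^2 \<ge> 0 trades exp(r|x|) for half of the Gaussian; the other half
    still dominates every power.\<close>
  have e: "exp (- s * x\<^sup>2) * exp (r * \<bar>x\<bar>) \<le> exp (r\<^sup>2 / (2 * s)) * exp (- (s / 2) * x\<^sup>2)" for x
  proof -
    have "0 \<le> (s * \<bar>x\<bar> - r)\<^sup>2 / (2 * s)" using s by simp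
    also have "\<dots> = s / 2 * x\<^sup>2 - r * \<bar>x\<bar> + r\<^sup>2 / (2 * s)"
      using s by (simp add: power2_eq_square field_simps)
    finally show ?thesis by (simp flip: exp_add)
  qed
  show ?thesis
    unfolding dunkl_integrable_iff[OF k m]
  proof (rule gauss_dominated_integrable)
    show "(\<lambda>x. dunkl_density k x *\<^sub>R (norm (poly Q (of_real x) * of_real (exp (- s * x\<^sup>2))) * exp (r * \<bar>x\<bar>))) \<in> borel_measurable lebesgue"
      using m by measurable
    show "s / 2 > 0" using s by simp
    fix x
    have "norm (dunkl_density k x *\<^sub>R (norm (poly Q (of_real x) * of_real (exp (- s * x\<^sup>2))) * exp (r * \<bar>x\<bar>)))
       = dunkl_density k x * (norm (poly Q (of_real x)) * (exp (- s * x\<^sup>2) * exp (r * \<bar>x\<bar>)))"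
      using dunkl_density_nonneg[OF k, of x] by (simp add: norm_mult abs_mult)
    also have "\<dots> \<le> ((1 + \<bar>x\<bar>) powr (2 * k + 1) / D) * ((C * (1 + \<bar>x\<bar>) ^ degree Q) * (exp (r\<^sup>2 / (2 * s)) * exp (- (s / 2) * x\<^sup>2)))"
      using C dunkl_density_nonneg[OF k, of x] D unfolding D_def
      by (intro mult_mono dunkl_density_le k e) auto
    also have "\<dots> = (C * exp (r\<^sup>2 / (2 * s)) / D) * ((1 + \<bar>x\<bar>) powr (2 * k + 1 + degree Q) * exp (- (s / 2) * x\<^sup>2))"
      by (simp add: powr_add powr_realpow add_pos_nonneg)
    finally show "norm (dunkl_density k x *\<^sub>R (norm (poly Q (of_real x) * of_real (exp (- s * x\<^sup>2))) * exp (r * \<bar>x\<bar>)))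
      \<le> (C * exp (r\<^sup>2 / (2 * s)) / D) * ((1 + \<bar>x\<bar>) powr (2 * k + 1 + degree Q) * exp (- (s / 2) * x\<^sup>2))" .
  qed
qed

lemma poly_measurable_lebesgue [measurable]:
  "(\<lambda>x. poly Q (complex_of_real x)) \<in> borel_measurable lebesgue"
proof -
  have "(\<lambda>x. poly Q (complex_of_real x)) \<in> borel_measurable borel"
    by (intro borel_measurable_continuous_onI continuous_intros)
  then show ?thesis by (intro measurable_completion) simp
qed

text \<open>The argument is complex, as growth bounds and Taylor series demand. Of the factors of
  \<open>lc_dunkl_transform\<close> only the kernel is kept: the chirp in x is to be absorbed into
  g, and the rest changes the modulus only by a constant.\<close>

definition dunkl_transform :: "real \<Rightarrow> (real \<Rightarrow> complex) \<Rightarrow> complex \<Rightarrow> complex" where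
  "dunkl_transform k g z = (LINT x|dunkl_measure k. g x * dunkl_kernel k z x)"

lemma dunkl_transform_series:
  assumes k: "k \<ge> - 1 / 2" and g: "g \<in> borel_measurable lebesgue"
    and int: "\<And>r. integrable (dunkl_measure k) (\<lambda>x. norm (g x) * exp (r * \<bar>x\<bar>))"
  shows "(\<lambda>j. dunkl_coeff k j * (LINT x|dunkl_measure k. g x * of_real x ^ j) * z ^ j) sums dunkl_transform k g z"
    and "norm (dunkl_transform k g z) \<le> (LINT x|dunkl_measure k. norm (g x) * exp (norm z * \<bar>x\<bar>))"
    and "integrable (dunkl_measure k) (\<lambda>x. g x * dunkl_kernel k z x)"
proof -
  have m: "g \<in> borel_measurable (dunkl_measure k)" "(\<lambda>x. x) \<in> borel_measurable (dunkl_measure k)"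
    using g by simp_all
  show "(\<lambda>j. dunkl_coeff k j * (LINT x|dunkl_measure k. g x * of_real x ^ j) * z ^ j) sums dunkl_transform k g z"
    unfolding dunkl_transform_def dunkl_kernel_series[OF k]
    by (rule moment_series(1)[OF m int norm_dunkl_coeff_le[OF k]])
  show "norm (dunkl_transform k g z) \<le> (LINT x|dunkl_measure k. norm (g x) * exp (norm z * \<bar>x\<bar>))"
    unfolding dunkl_transform_def dunkl_kernel_series[OF k]
    by (rule moment_series(2)[OF m int norm_dunkl_coeff_le[OF k]])
  show "integrable (dunkl_measure k) (\<lambda>x. g x * dunkl_kernel k z x)"
    unfolding dunkl_kernel_series[OF k]
    by (rule moment_series(3)[OF m int norm_dunkl_coeff_le[OF k]])
qed

lemma dunkl_transform_poly_gauss_integrable: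
  assumes k: "k \<ge> - 1 / 2" and s: "s > 0"
  shows "integrable (dunkl_measure k) (\<lambda>x. poly Q (of_real x) * of_real (exp (- s * x\<^sup>2)) * dunkl_kernel k z x)"
  by (rule dunkl_transform_series(3)[OF k _ poly_gauss_exp_integrable[OF k s]]) measurable

text \<open>Only Taylor coefficients whose index has the parity of n survive. For even n the factor
  (k + 1)_i of the kernel cancels against the moment by (k + 1)_(i+l) = (k + 1)_i (k + 1 + i)_l, and
  what remains is the series of \<open>pochhammer_exp_sums\<close> at w = -z^2/(4s). Odd n works
  alike with a further factor z, so the degree is n in both cases.\<close>

lemma dunkl_transform_monomial_gauss:
  assumes k: "k \<ge> - 1 / 2" and s: "s > 0"
  obtains P where "degree P = n" "P \<noteq> 0"
    and "\<And>z. dunkl_transform k (\<lambda>x. of_real x ^ n * of_real (exp (- s * x\<^sup>2))) z = poly P z * exp (- z\<^sup>2 / of_real (4 * s))"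
proof -
  define g where "g x = complex_of_real x ^ n * of_real (exp (- s * x\<^sup>2))" for x
  define l where "l = n div 2"
  define A where "A = (2 * s) powr (k + 1)"
  have A: "A > 0" using s by (simp add: A_def)
  have pp: "pochhammer (k + 1) i > 0" for i using k by (intro pochhammer_pos) auto
  \<comment> \<open>For odd n the kernel carries (k + 1)_(i+1), so the rising factorial left after
    cancellation starts at k + 2 + i.\<close>
  define \<alpha> where "\<alpha> = (if even n then k + 1 else k + 2)"
  obtain R :: "complex poly" where R: "degree R = l" "R \<noteq> 0"
    "\<And>w. (\<lambda>i. of_real (pochhammer (\<alpha> + real i) l) * w ^ i / fact i) sums (poly R w * exp w)"
    using pochhammer_exp_sums[of l \<alpha>] by blast
  define S where "S = pcompose R [:0, 0, - 1 / of_real (4 * s):]"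
  have S: "poly S z = poly R (- z\<^sup>2 / of_real (4 * s))" for z
    by (simp add: S_def poly_pcompose power2_eq_square)
  have dS: "degree S = 2 * l" unfolding S_def using s R by (simp add: degree_pcompose)
  have S0: "S \<noteq> 0"
  proof (cases "l = 0")
    case True
    then obtain c where "R = [:c:]" using R degree_eq_zeroE by blast
    then show ?thesis using R by (simp add: S_def pcompose_const)
  qed (use dS in auto)
  have mom: "(LINT x|dunkl_measure k. g x * of_real x ^ j) = (LINT x|dunkl_measure k. of_real (exp (- s * x\<^sup>2)) * of_real x ^ (n + j))" for j
    by (simp add: g_def power_add mult_ac)
  have "(\<lambda>x. norm (g x) * exp (r * \<bar>x\<bar>)) = (\<lambda>x. norm (poly (monom 1 n) (complex_of_real x) * of_real (exp (- s * x\<^sup>2))) * exp (r * \<bar>x\<bar>))" for r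
    by (simp add: g_def poly_monom)
  then have gi: "integrable (dunkl_measure k) (\<lambda>x. norm (g x) * exp (r * \<bar>x\<bar>))" for r
    using poly_gauss_exp_integrable[OF k s, of "monom 1 n" r] by simp
  have gm: "g \<in> borel_measurable lebesgue" unfolding g_def by measurable
  have pw: "(- z\<^sup>2 / of_real (4 * s)) ^ i = (- 1) ^ i * z ^ (2 * i) / (4 ^ i * of_real s ^ i)" for z :: complex and i
  proof -
    have "- z\<^sup>2 / of_real (4 * s) = (- 1) * (z\<^sup>2 / (4 * of_real s))" by simp
    then show ?thesis by (simp only: power_mult_distrib power_divide power_mult) simp
  qed
  \<comment> \<open>The regrouping shared by both parities: p is the rising factorial that cancels,
    e y / (f' u) becomes the power of -z^2/(4s), and F keeps i!, up to constants for odd n.\<close>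
  have cancel: "e / (f * p) * (p * q / (a * (u * v))) * y = 1 / (a * v) * (q * (e * y / (f' * u)) / F)"
    if "p \<noteq> 0" "f = f' * F" for e f p q a u v y f' F :: complex
    using that by (simp add: mult_ac)
  define t where "t z j = dunkl_coeff k j * (LINT x|dunkl_measure k. g x * of_real x ^ j) * z ^ j" for z j
  have T: "t z sums dunkl_transform k g z" for z
    unfolding t_def by (rule dunkl_transform_series(1)[OF k gm gi])
  show thesis
  proof (cases "even n")
    case True
    then have n: "n = 2 * l" by (simp add: l_def)
    define c where "c = complex_of_real (1 / (A * s ^ l))"
    have c: "c \<noteq> 0" using A s by (simp add: c_def)
    have "t z (2 * i) = c * (of_real (pochhammer (\<alpha> + real i) l) * (- z\<^sup>2 / of_real (4 * s)) ^ i / fact i)" for z i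
    proof -
      have "n + 2 * i = 2 * (i + l)" by (simp add: n)
      then have "t z (2 * i) = dunkl_coeff k (2 * i) * of_real (pochhammer (k + 1) (i + l) / (A * s ^ (i + l))) * z ^ (2 * i)"
        unfolding t_def mom by (simp only: dunkl_gaussian_moment(1)[OF k s] A_def)
      also have "pochhammer (k + 1) (i + l) = pochhammer (k + 1) i * pochhammer (\<alpha> + real i) l"
        using True by (simp add: pochhammer_product' \<alpha>_def)
      finally show ?thesis
        using pp[of i] cancel[of "of_real (pochhammer (k + 1) i)" "4 ^ i * fact i" "4 ^ i" "fact i" "(- 1) ^ i"
            "of_real (pochhammer (\<alpha> + real i) l)" "of_real A" "of_real s ^ i" "of_real s ^ l" "z ^ (2 * i)"]
        unfolding pw by (simp add: dunkl_coeff_def c_def power_add)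
    qed
    then have "(\<lambda>i. t z (2 * i)) sums (c * (poly R (- z\<^sup>2 / of_real (4 * s)) * exp (- z\<^sup>2 / of_real (4 * s))))" for z
      by (simp only:) (intro sums_mult R)
    moreover have "t z j = 0" if "j \<notin> range (\<lambda>i. 2 * i)" for z j
    proof -
      have "odd j" using that by (auto elim!: evenE)
      then obtain i where "j = 2 * i + 1" using oddE by blast
      then have "n + j = 2 * (l + i) + 1" by (simp add: n)
      then show ?thesis unfolding t_def mom by (simp only: dunkl_gaussian_moment(2)[OF k s]) simp
    qed
    ultimately have "t z sums (c * (poly R (- z\<^sup>2 / of_real (4 * s)) * exp (- z\<^sup>2 / of_real (4 * s))))" for z
      by (subst sums_mono_reindex[of "\<lambda>i. 2 * i", symmetric]) (auto simp: strict_mono_def)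
    from sums_unique2[OF T this]
    have "dunkl_transform k g z = poly (smult c S) z * exp (- z\<^sup>2 / of_real (4 * s))" for z
      by (simp add: S mult.assoc)
    then show thesis using c S0 dS n unfolding g_def by (intro that[of "smult c S"]) auto
  next
    case False
    then have n: "n = 2 * l + 1" by (simp add: l_def)
    define c where "c = - \<i> * complex_of_real (1 / (2 * A * s ^ (l + 1)))"
    have c: "c \<noteq> 0" using A s by (simp add: c_def)
    have "t z (2 * i + 1) = c * z * (of_real (pochhammer (\<alpha> + real i) l) * (- z\<^sup>2 / of_real (4 * s)) ^ i / fact i)" for z i
    proof -
      have "n + (2 * i + 1) = 2 * (Suc i + l)" by (simp add: n)
      then have "t z (2 * i + 1) = dunkl_coeff k (2 * i + 1) * of_real (pochhammer (k + 1) (Suc i + l) / (A * s ^ (Suc i + l))) * z ^ (2 * i + 1)"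
        unfolding t_def mom by (simp only: dunkl_gaussian_moment(1)[OF k s] A_def)
      also have "pochhammer (k + 1) (Suc i + l) = pochhammer (k + 1) (Suc i) * pochhammer (\<alpha> + real i) l"
        unfolding pochhammer_product' using False by (simp add: \<alpha>_def ac_simps)
      finally show ?thesis
        using pp[of "Suc i"] cancel[of "of_real (pochhammer (k + 1) (Suc i))" "2 * (4 ^ i * fact i)" "4 ^ i" "2 * fact i" "- \<i> * (- 1) ^ i"
            "of_real (pochhammer (\<alpha> + real i) l)" "of_real A" "of_real s ^ i" "of_real s ^ (l + 1)" "z ^ (2 * i)"]
        unfolding pw by (simp add: dunkl_coeff_def c_def power_add mult_ac)
    qed
    then have "(\<lambda>i. t z (2 * i + 1)) sums (c * z * (poly R (- z\<^sup>2 / of_real (4 * s)) * exp (- z\<^sup>2 / of_real (4 * s))))" for z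
      by (simp only:) (intro sums_mult R)
    moreover have "t z j = 0" if "j \<notin> range (\<lambda>i. 2 * i + 1)" for z j
    proof -
      have "even j" using that by (metis oddE rangeI)
      then obtain i where "j = 2 * i" by blast
      then have "n + j = 2 * (l + i) + 1" by (simp add: n)
      then show ?thesis unfolding t_def mom by (simp only: dunkl_gaussian_moment(2)[OF k s]) simp
    qed
    ultimately have "t z sums (c * z * (poly R (- z\<^sup>2 / of_real (4 * s)) * exp (- z\<^sup>2 / of_real (4 * s))))" for z
      by (subst sums_mono_reindex[of "\<lambda>i. 2 * i + 1", symmetric]) (auto simp: strict_mono_def)
    from sums_unique2[OF T this]
    have "dunkl_transform k g z = poly (smult c (pCons 0 S)) z * exp (- z\<^sup>2 / of_real (4 * s))" for z
      by (simp add: S mult_ac)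
    then show thesis using c S0 dS n unfolding g_def by (intro that[of "smult c (pCons 0 S)"]) auto
  qed
qed

lemma dunkl_transform_lincomb:
  assumes k: "k \<ge> - 1 / 2" and s: "s > 0"
  shows "dunkl_transform k (\<lambda>x. poly (Q + smult a R) (of_real x) * of_real (exp (- s * x\<^sup>2))) z =
    dunkl_transform k (\<lambda>x. poly Q (of_real x) * of_real (exp (- s * x\<^sup>2))) z +
    a * dunkl_transform k (\<lambda>x. poly R (of_real x) * of_real (exp (- s * x\<^sup>2))) z"
proof -
  note i = dunkl_transform_poly_gauss_integrable[OF k s]
  have "dunkl_transform k (\<lambda>x. poly (Q + smult a R) (of_real x) * of_real (exp (- s * x\<^sup>2))) z =
    (LINT x|dunkl_measure k. poly Q (of_real x) * of_real (exp (- s * x\<^sup>2)) * dunkl_kernel k z x +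
       a * (poly R (of_real x) * of_real (exp (- s * x\<^sup>2)) * dunkl_kernel k z x))"
    unfolding dunkl_transform_def by (intro Bochner_Integration.integral_cong) (auto simp: algebra_simps)
  also have "\<dots> = (LINT x|dunkl_measure k. poly Q (of_real x) * of_real (exp (- s * x\<^sup>2)) * dunkl_kernel k z x) +
       (LINT x|dunkl_measure k. a * (poly R (of_real x) * of_real (exp (- s * x\<^sup>2)) * dunkl_kernel k z x))"
    by (intro Bochner_Integration.integral_add integrable_mult_right i)
  finally show ?thesis unfolding dunkl_transform_def by simp
qed

text \<open>Monomials have images of exact degree, so the map from Q to P is triangular with nonzero
  diagonal; subtracting a multiple of R removes the leading coefficient, and the induction keeps the
  degree bound.\<close>

lemma dunkl_transform_poly_gauss_surj:
  assumes k: "k \<ge> - 1 / 2" and s: "s > 0"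
  shows "\<exists>Q. degree Q \<le> degree P \<and> (\<forall>z. dunkl_transform k (\<lambda>x. poly Q (of_real x) * of_real (exp (- s * x\<^sup>2))) z
     = poly P z * exp (- z\<^sup>2 / of_real (4 * s)))"
proof (induction "degree P" arbitrary: P rule: less_induct)
  case less
  obtain R where R: "degree R = degree P" "R \<noteq> 0"
    "\<And>z. dunkl_transform k (\<lambda>x. of_real x ^ degree P * of_real (exp (- s * x\<^sup>2))) z = poly R z * exp (- z\<^sup>2 / of_real (4 * s))"
    using dunkl_transform_monomial_gauss[OF k s, of "degree P"] by blast
  define a where "a = lead_coeff P / lead_coeff R"
  define P' where "P' = P - smult a R"
  have "coeff R (degree P) \<noteq> 0" using R by (metis leading_coeff_0_iff)
  then have "coeff P' (degree P) = 0" using R(1) by (simp add: P'_def a_def)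
  moreover have "degree P' \<le> degree P"
    unfolding P'_def using R by (intro degree_diff_le order_trans[OF degree_smult_le]) auto
  \<comment> \<open>For a constant P the difference is the zero polynomial, whose degree is again 0
    and does not drop, hence the separate case.\<close>
  ultimately have P': "P' = 0 \<or> degree P' < degree P" by (rule eq_zero_or_degree_less[rotated])
  obtain Q where Q: "degree Q \<le> degree P"
    "\<And>z. dunkl_transform k (\<lambda>x. poly Q (of_real x) * of_real (exp (- s * x\<^sup>2))) z = poly P' z * exp (- z\<^sup>2 / of_real (4 * s))"
  proof (cases "P' = 0")
    case True
    then show ?thesis by (intro that[of 0]) (auto simp: dunkl_transform_def)
  next
    case False
    then have "degree P' < degree P" using P' by simp
    from less[OF this] obtain Q where "degree Q \<le> degree P'"
      "\<forall>z. dunkl_transform k (\<lambda>x. poly Q (of_real x) * of_real (exp (- s * x\<^sup>2))) z = poly P' z * exp (- z\<^sup>2 / of_real (4 * s))"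
      by blast
    then show ?thesis using \<open>degree P' < degree P\<close> by (intro that[of Q]) auto
  qed
  define Q' where "Q' = Q + smult a (monom 1 (degree P))"
  have "degree Q' \<le> degree P"
    unfolding Q'_def using Q by (intro degree_add_le order_trans[OF degree_smult_le]) (auto simp: degree_monom_eq)
  moreover have "dunkl_transform k (\<lambda>x. poly Q' (of_real x) * of_real (exp (- s * x\<^sup>2))) z = poly P z * exp (- z\<^sup>2 / of_real (4 * s))" for z
    unfolding Q'_def dunkl_transform_lincomb[OF k s] Q(2) using R(3)[of z]
    by (simp add: poly_monom P'_def algebra_simps)
  ultimately show ?case by blast
qed

text \<open>The same elimination in the forward direction. It serves part (iii), where only the
  shape of the transform matters, so no degree is recorded.\<close>

lemma dunkl_transform_poly_gauss:
  assumes k: "k \<ge> - 1 / 2" and s: "s > 0"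
  shows "\<exists>P. \<forall>z. dunkl_transform k (\<lambda>x. poly Q (of_real x) * of_real (exp (- s * x\<^sup>2))) z
     = poly P z * exp (- z\<^sup>2 / of_real (4 * s))"
proof (induction "degree Q" arbitrary: Q rule: less_induct)
  case less
  define a where "a = lead_coeff Q"
  define Q' where "Q' = Q - smult a (monom 1 (degree Q))"
  have "coeff Q' (degree Q) = 0" by (simp add: Q'_def a_def)
  moreover have "degree Q' \<le> degree Q"
    unfolding Q'_def by (intro degree_diff_le order_trans[OF degree_smult_le]) (auto simp: degree_monom_eq)
  ultimately have Q': "Q' = 0 \<or> degree Q' < degree Q" by (rule eq_zero_or_degree_less[rotated])
  obtain P' where P': "\<And>z. dunkl_transform k (\<lambda>x. poly Q' (of_real x) * of_real (exp (- s * x\<^sup>2))) z = poly P' z * exp (- z\<^sup>2 / of_real (4 * s))"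
  proof (cases "Q' = 0")
    case True
    then show ?thesis by (intro that[of 0]) (auto simp: dunkl_transform_def)
  next
    case False
    then have "degree Q' < degree Q" using Q' by simp
    from less[OF this] show ?thesis using that by blast
  qed
  obtain R where R:
    "\<And>z. dunkl_transform k (\<lambda>x. of_real x ^ degree Q * of_real (exp (- s * x\<^sup>2))) z = poly R z * exp (- z\<^sup>2 / of_real (4 * s))"
    using dunkl_transform_monomial_gauss[OF k s, of "degree Q"] by blast
  have "Q = Q' + smult a (monom 1 (degree Q))" by (simp add: Q'_def)
  then have "dunkl_transform k (\<lambda>x. poly Q (of_real x) * of_real (exp (- s * x\<^sup>2))) z = poly (P' + smult a R) z * exp (- z\<^sup>2 / of_real (4 * s))" for z
    using dunkl_transform_lincomb[OF k s, of Q' a "monom 1 (degree Q)" z] P'[of z] R[of z]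
    by (simp add: poly_monom algebra_simps)
  then show ?case by blast
qed

section \<open>Injectivity\<close>

text \<open>Exponential moments let the Fourier transform be summed from the ordinary moments, so it
  vanishes. Levy's uniqueness theorem concerns probability measures, hence the positive and negative
  parts are compared: the zeroth moment gives them equal mass c, and for c > 0 division by c makes
  them probability densities with the same characteristic function.\<close>

lemma AE_zero_of_moments_zero:
  fixes h :: "real \<Rightarrow> real"
  assumes h: "h \<in> borel_measurable lebesgue"
    and int: "\<And>r. integrable lebesgue (\<lambda>x. \<bar>h x\<bar> * exp (r * \<bar>x\<bar>))"
    and moments: "\<And>j. (LINT x|lebesgue. h x * x ^ j) = 0"
  shows "AE x in lebesgue. h x = 0"
proof -
  \<comment> \<open>Characteristic functions belong to Borel measures, while h is only Lebesgue
    measurable; g is a Borel version of h.\<close>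
  obtain g where g: "g \<in> borel_measurable lborel" and "AE x in lborel. h x = g x"
    using completion_ex_borel_measurable_real[OF h] by blast
  then have ae: "AE x in lebesgue. h x = g x" by (intro AE_completion)
  have gb: "g \<in> borel_measurable borel" using g by simp
  have gl: "g \<in> borel_measurable lebesgue" using g by (rule measurable_completion)
  have int_g: "integrable lborel (\<lambda>x. \<bar>g x\<bar> * exp (r * \<bar>x\<bar>))" for r
  proof -
    have "integrable lebesgue (\<lambda>x. \<bar>g x\<bar> * exp (r * \<bar>x\<bar>))"
    proof (rule integrable_cong_AE_imp[OF int[of r]])
      show "(\<lambda>x. \<bar>g x\<bar> * exp (r * \<bar>x\<bar>)) \<in> borel_measurable lebesgue" using gl by measurable
      show "AE x in lebesgue. \<bar>h x\<bar> * exp (r * \<bar>x\<bar>) = \<bar>g x\<bar> * exp (r * \<bar>x\<bar>)"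
        using ae by eventually_elim simp
    qed
    moreover have "(\<lambda>x. \<bar>g x\<bar> * exp (r * \<bar>x\<bar>)) \<in> borel_measurable lborel" using gb by simp
    ultimately show ?thesis by (simp add: integrable_completion)
  qed
  have mom_g: "(LINT x|lborel. g x * x ^ j) = 0" for j
  proof -
    have "(LINT x|lebesgue. h x * x ^ j) = (LINT x|lebesgue. g x * x ^ j)"
    proof (rule integral_cong_AE)
      show "AE x in lebesgue. h x * x ^ j = g x * x ^ j" using ae by eventually_elim simp
      show "(\<lambda>x. h x * x ^ j) \<in> borel_measurable lebesgue" using h by measurable
      show "(\<lambda>x. g x * x ^ j) \<in> borel_measurable lebesgue" using gl by measurable
    qed
    moreover have "(\<lambda>x. g x * x ^ j) \<in> borel_measurable lborel" using gb by simp
    ultimately show ?thesis using moments[of j] by (simp add: integral_completion)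
  qed
  have four: "(LINT x|lborel. of_real (g x) * iexp (\<xi> * x)) = 0" for \<xi>
  proof -
    define c where "c j = \<i> ^ j / fact j" for j :: nat
    have "(\<lambda>j. c j * (LINT x|lborel. of_real (g x) * of_real x ^ j) * of_real \<xi> ^ j) sums
            (LINT x|lborel. of_real (g x) * (\<Sum>j. c j * (of_real \<xi> * of_real x) ^ j))"
    proof (rule moment_series(1))
      show "(\<lambda>x. complex_of_real (g x)) \<in> borel_measurable lborel" using gb by simp
      show "integrable lborel (\<lambda>x. norm (complex_of_real (g x)) * exp (r * \<bar>x\<bar>))" for r
        using int_g[of r] by simp
      show "norm (c j) \<le> 1 / fact j" for j by (simp add: c_def norm_divide norm_power)
    qed simp
    moreover have "(LINT x|lborel. of_real (g x) * of_real x ^ j) = complex_of_real (LINT x|lborel. g x * x ^ j)" for j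
      by (simp flip: integral_complex_of_real)
    moreover have "(\<Sum>j. c j * (of_real \<xi> * of_real x) ^ j) = iexp (\<xi> * x)" for x
    proof -
      have "(\<lambda>j. c j * (of_real \<xi> * of_real x) ^ j) sums exp (\<i> * (of_real \<xi> * of_real x))"
        using exp_converges[of "\<i> * (of_real \<xi> * of_real x)"]
        by (simp add: c_def scaleR_conv_of_real power_mult_distrib field_simps)
      then show ?thesis by (simp add: sums_iff)
    qed
    ultimately have "(\<lambda>j. 0) sums (LINT x|lborel. of_real (g x) * iexp (\<xi> * x))" by (simp add: mom_g)
    then show ?thesis by (simp add: sums_iff)
  qed
  define p where "p x = max (g x) 0" for x
  define n where "n x = max (- g x) 0" for x
  have pm: "p \<in> borel_measurable lborel" unfolding p_def using gb by simp
  have nm: "n \<in> borel_measurable lborel" unfolding n_def using gb by simp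
  have gi: "integrable lborel (\<lambda>x. \<bar>g x\<bar>)" using int_g[of 0] by simp
  have pi: "integrable lborel p"
    by (rule Bochner_Integration.integrable_bound[OF gi pm]) (auto simp: p_def)
  have ni: "integrable lborel n"
    by (rule Bochner_Integration.integrable_bound[OF gi nm]) (auto simp: n_def)
  have gpn: "g x = p x - n x" for x by (simp add: p_def n_def)
  have nn: "p x \<ge> 0" "n x \<ge> 0" for x by (simp_all add: p_def n_def)
  define c where "c = (LINT x|lborel. p x)"
  have cn: "(LINT x|lborel. n x) = c"
    using mom_g[of 0] pi ni by (simp add: gpn c_def)
  have c0: "c \<ge> 0" unfolding c_def by (intro integral_nonneg_AE) (simp add: nn)
  have "AE x in lborel. g x = 0"
  \<comment> \<open>With mass 0 there is nothing to normalise, but then both nonnegative parts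
    vanish almost everywhere.\<close>
  proof (cases "c = 0")
    case True
    have "AE x in lborel. p x = 0"
      using integral_nonneg_eq_0_iff_AE[OF pi] True nn by (simp add: c_def)
    moreover have "AE x in lborel. n x = 0"
      using integral_nonneg_eq_0_iff_AE[OF ni] True nn cn by simp
    ultimately show ?thesis by eventually_elim (simp add: gpn)
  next
    case False
    then have c: "c > 0" using c0 by simp
    have dist: "real_distribution (density lborel (\<lambda>x. ennreal (u x / c)))"
      if um: "u \<in> borel_measurable lborel" and ui: "integrable lborel u" and u0: "\<And>x. u x \<ge> 0"
        and uc: "(LINT x|lborel. u x) = c" for u
    proof -
      have "(\<integral>\<^sup>+ x. ennreal (u x / c) \<partial>lborel) = ennreal (LINT x|lborel. u x / c)"
        using u0 c ui by (intro nn_integral_eq_integral) auto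
      also have "\<dots> = 1" using c uc by simp
      finally have "emeasure (density lborel (\<lambda>x. ennreal (u x / c))) (space (density lborel (\<lambda>x. ennreal (u x / c)))) = 1"
        using um by (subst emeasure_density) auto
      then show ?thesis by (intro real_distribution.intro prob_spaceI real_distribution_axioms.intro) auto
    qed
    have ch: "char (density lborel (\<lambda>x. ennreal (u x / c))) \<xi> = (LINT x|lborel. of_real (u x) * iexp (\<xi> * x)) / of_real c"
      if um: "u \<in> borel_measurable lborel" and u0: "\<And>x. u x \<ge> 0" for u \<xi>
    proof -
      have "char (density lborel (\<lambda>x. ennreal (u x / c))) \<xi> = (LINT x|lborel. (u x / c) *\<^sub>R iexp (\<xi> * x))"
        unfolding char_def using um u0 c by (intro integral_density) auto
      also have "\<dots> = (LINT x|lborel. of_real (u x) * iexp (\<xi> * x) / of_real c)"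
        by (intro Bochner_Integration.integral_cong) (auto simp: scaleR_conv_of_real)
      finally show ?thesis by simp
    qed
    have ei: "integrable lborel (\<lambda>x. of_real (u x) * iexp (\<xi> * x))"
      if um: "u \<in> borel_measurable lborel" and ui: "integrable lborel u" for u \<xi>
      by (rule Bochner_Integration.integrable_bound[OF ui]) (use um in \<open>auto simp: norm_mult\<close>)
    have "char (density lborel (\<lambda>x. ennreal (p x / c))) = char (density lborel (\<lambda>x. ennreal (n x / c)))"
    proof
      fix \<xi>
      have "(LINT x|lborel. of_real (p x) * iexp (\<xi> * x)) - (LINT x|lborel. of_real (n x) * iexp (\<xi> * x)) =
         (LINT x|lborel. of_real (p x) * iexp (\<xi> * x) - of_real (n x) * iexp (\<xi> * x))"
        by (rule Bochner_Integration.integral_diff[symmetric, OF ei[OF pm pi] ei[OF nm ni]])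
      also have "\<dots> = (LINT x|lborel. of_real (g x) * iexp (\<xi> * x))" by (simp add: gpn algebra_simps)
      finally have "(LINT x|lborel. of_real (p x) * iexp (\<xi> * x)) = (LINT x|lborel. of_real (n x) * iexp (\<xi> * x))"
        unfolding four by simp
      then show "char (density lborel (\<lambda>x. ennreal (p x / c))) \<xi> = char (density lborel (\<lambda>x. ennreal (n x / c))) \<xi>"
        unfolding ch[OF pm nn(1)] ch[OF nm nn(2)] by (rule arg_cong)
    qed
    then have "density lborel (\<lambda>x. ennreal (p x / c)) = density lborel (\<lambda>x. ennreal (n x / c))"
      by (intro Levy_uniqueness dist pm nm pi ni nn cn) (simp_all add: c_def)
    then have "AE x in lborel. ennreal (p x / c) = ennreal (n x / c)"
      using pm nm by (intro sigma_finite_measure.density_unique[OF sigma_finite_lborel]) auto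
    then show ?thesis
    proof eventually_elim
      case (elim x)
      then have "p x / c = n x / c" using nn[of x] c by (subst (asm) ennreal_inj) auto
      then show ?case using c by (simp add: gpn)
    qed
  qed
  then have "AE x in lebesgue. g x = 0" by (rule AE_completion)
  with ae show ?thesis by eventually_elim simp
qed

text \<open>Multiplying by the density turns moments for mu_k into Lebesgue moments. The real and
  imaginary parts are treated at once through a functional \<open>\<phi>\<close>.\<close>

lemma AE_zero_of_dunkl_moments_zero:
  fixes g :: "real \<Rightarrow> complex"
  assumes k: "k \<ge> - 1 / 2" and g: "g \<in> borel_measurable lebesgue"
    and int: "\<And>r. integrable (dunkl_measure k) (\<lambda>x. norm (g x) * exp (r * \<bar>x\<bar>))"
    and moments: "\<And>j. (LINT x|dunkl_measure k. g x * of_real x ^ j) = 0"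
  shows "AE x in lebesgue. g x = 0"
proof -
  have part: "AE x in lebesgue. \<phi> (g x) = 0"
    if lin: "bounded_linear \<phi>" and le: "\<And>z. \<bar>\<phi> z\<bar> \<le> norm z" and re: "\<And>z r. \<phi> (z * of_real r) = \<phi> z * r"
    for \<phi> :: "complex \<Rightarrow> real"
  proof -
    have \<phi>m: "\<phi> \<in> borel_measurable borel"
      by (intro borel_measurable_continuous_onI linear_continuous_on lin)
    have m: "(\<lambda>x. \<phi> (g x)) \<in> borel_measurable lebesgue"
      using measurable_compose[OF g \<phi>m] .
    define h where "h x = dunkl_density k x * \<phi> (g x)" for x
    have "AE x in lebesgue. h x = 0"
    proof (rule AE_zero_of_moments_zero)
      show "h \<in> borel_measurable lebesgue" unfolding h_def using m by measurable
      fix r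
      have "(\<lambda>x. norm (g x) * exp (r * \<bar>x\<bar>)) \<in> borel_measurable lebesgue" using g by measurable
      then have "integrable lebesgue (\<lambda>x. dunkl_density k x *\<^sub>R (norm (g x) * exp (r * \<bar>x\<bar>)))"
        using int[of r] dunkl_integrable_iff[OF k] by blast
      then show "integrable lebesgue (\<lambda>x. \<bar>h x\<bar> * exp (r * \<bar>x\<bar>))"
      proof (rule Bochner_Integration.integrable_bound)
        show "(\<lambda>x. \<bar>h x\<bar> * exp (r * \<bar>x\<bar>)) \<in> borel_measurable lebesgue" unfolding h_def using m by measurable
        show "AE x in lebesgue. norm (\<bar>h x\<bar> * exp (r * \<bar>x\<bar>)) \<le> norm (dunkl_density k x *\<^sub>R (norm (g x) * exp (r * \<bar>x\<bar>)))"
          unfolding h_def using le dunkl_density_nonneg[OF k]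
          by (intro AE_I2) (simp add: abs_mult mult_left_mono mult_right_mono mult.assoc)
      qed
    next
      fix j
      have mj: "(\<lambda>x. g x * of_real x ^ j) \<in> borel_measurable lebesgue" using g by measurable
      have "integrable (dunkl_measure k) (\<lambda>x. g x * of_real x ^ j)"
        using moment_integrable[of g "dunkl_measure k" j] g int[of 1] by simp
      then have "integrable lebesgue (\<lambda>x. dunkl_density k x *\<^sub>R (g x * of_real x ^ j))"
        using dunkl_integrable_iff[OF k mj] by blast
      from integral_bounded_linear[OF lin this]
      have "(LINT x|lebesgue. \<phi> (dunkl_density k x *\<^sub>R (g x * of_real x ^ j))) = \<phi> 0"
        using moments[of j] dunkl_integral[OF k mj] by simp
      also have "(\<lambda>x. \<phi> (dunkl_density k x *\<^sub>R (g x * of_real x ^ j))) = (\<lambda>x. h x * x ^ j)"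
        by (simp add: h_def linear_cmul[OF bounded_linear.linear[OF lin]] re mult.assoc flip: of_real_power)
      finally show "(LINT x|lebesgue. h x * x ^ j) = 0"
        using linear_0[OF bounded_linear.linear[OF lin]] by simp
    qed
    \<comment> \<open>\<open>dunkl_density\<close> is 0 at the origin for every k, so that point has
      to be removed before the density is cancelled.\<close>
    moreover have "AE x in lebesgue. x \<noteq> (0::real)"
      by (rule AE_completion) (rule AE_lborel_singleton)
    ultimately show ?thesis
    proof eventually_elim
      case (elim x)
      then show ?case using dunkl_density_pos[OF k, of x] by (simp add: h_def)
    qed
  qed
  have "AE x in lebesgue. Re (g x) = 0"
    by (rule part) (auto simp: bounded_linear_Re abs_Re_le_cmod)
  moreover have "AE x in lebesgue. Im (g x) = 0"
    by (rule part) (auto simp: bounded_linear_Im abs_Im_le_cmod)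
  ultimately show ?thesis by eventually_elim (simp add: complex_eq_iff)
qed

section \<open>The uncertainty principle\<close>

lemma dunkl_transform_holomorphic:
  assumes k: "k \<ge> - 1 / 2" and g: "g \<in> borel_measurable lebesgue"
    and int: "\<And>r. integrable (dunkl_measure k) (\<lambda>x. norm (g x) * exp (r * \<bar>x\<bar>))"
  shows "dunkl_transform k g holomorphic_on A"
proof -
  have "dunkl_transform k g holomorphic_on ball 0 r" for r
  proof (rule power_series_holomorphic)
    fix w
    show "(\<lambda>j. (dunkl_coeff k j * (LINT x|dunkl_measure k. g x * of_real x ^ j)) * (w - 0) ^ j) sums dunkl_transform k g w"
      using dunkl_transform_series(1)[OF k g int, of w] by simp
  qed
  then have "dunkl_transform k g field_differentiable at z" for z
    by (rule holomorphic_on_imp_differentiable_at[of _ "ball 0 (norm z + 1)"]) auto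
  then show ?thesis
    unfolding holomorphic_on_def by (blast intro: field_differentiable_at_within)
qed

lemma AE_zero_of_dunkl_transform_zero:
  assumes k: "k \<ge> - 1 / 2" and g: "g \<in> borel_measurable lebesgue"
    and int: "\<And>r. integrable (dunkl_measure k) (\<lambda>x. norm (g x) * exp (r * \<bar>x\<bar>))"
    and zero: "\<And>z. dunkl_transform k g z = 0"
  shows "AE x in lebesgue. g x = 0"
proof (rule AE_zero_of_dunkl_moments_zero[OF k g int])
  fix j
  define a where "a i = dunkl_coeff k i * (LINT x|dunkl_measure k. g x * of_real x ^ i)" for i
  have sums: "(\<lambda>i. a i * (z - 0) ^ i) sums 0" for z
    unfolding a_def using dunkl_transform_series(1)[OF k g int, of z] by (simp add: zero)
  have "a j = 0"
  \<comment> \<open>\<open>powser_0_nonzero\<close> isolates the zero at the centre by means of a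
    coefficient of positive index; the constant coefficient is read off at z = 0 instead.\<close>
  proof (cases "j = 0")
    case True
    then show ?thesis using sums[of 0] by simp
  next
    case False
    show ?thesis
    proof (rule ccontr)
      assume aj: "a j \<noteq> 0"
      show False
      proof (rule powser_0_nonzero[of 1 0 a "\<lambda>_. 0" j])
        fix s :: real
        assume "0 < s" and s: "\<And>z :: complex. z \<in> cball 0 s - {0} \<Longrightarrow> (\<lambda>_. 0 :: complex) z \<noteq> 0"
        then show False using s[of "of_real s"] by simp
      qed (use sums False aj in auto)
    qed
  qed
  then show "(LINT x|dunkl_measure k. g x * of_real x ^ j) = 0"
    unfolding a_def using dunkl_coeff_nonzero[OF k, of j] by simp
qed

text \<open>Stated at the critical t only; a larger t is reduced to it by weakening the second
  condition. Both P and Q are returned because the decay of the transform limits the degree of P,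
  and the decay of g that of Q.\<close>

lemma hardy_dunkl:
  fixes g :: "real \<Rightarrow> complex"
  assumes k: "k \<ge> - 1 / 2" and s: "s > 0" and b: "b \<noteq> 0" and p: "p \<ge> 1" and q: "q \<ge> 1"
    and n: "n \<ge> 0" and m: "m \<ge> 0" and t: "t = 1 / (4 * s * b\<^sup>2)"
    and g: "g \<in> borel_measurable lebesgue"
    and fin1: "(\<integral>\<^sup>+ x. ennreal (exp (s * p * x\<^sup>2) * norm (g x) powr p / (1 + \<bar>x\<bar>) powr n) \<partial>dunkl_measure k) < \<infinity>"
    and fin2: "(\<integral>\<^sup>+ l. ennreal (exp (t * q * l\<^sup>2) * norm (dunkl_transform k g (of_real (l / b))) powr q / (1 + \<bar>l\<bar>) powr m) \<partial>lebesgue) < \<infinity>"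
  obtains P Q where "degree Q \<le> degree P" "P = 0 \<Longrightarrow> Q = 0"
    and "\<And>l. dunkl_transform k g (of_real (l / b)) = poly P (of_real l) * of_real (exp (- t * l\<^sup>2))"
    and "AE x in lebesgue. g x = poly Q (of_real x) * of_real (exp (- s * x\<^sup>2))"
proof -
  obtain C N where C: "C \<ge> 0"
    and int: "\<And>r. integrable (dunkl_measure k) (\<lambda>x. norm (g x) * exp (r * \<bar>x\<bar>))"
    and bound: "\<And>r. r \<ge> 0 \<Longrightarrow> (LINT x|dunkl_measure k. norm (g x) * exp (r * \<bar>x\<bar>)) \<le> C * (1 + r) ^ N * exp (r\<^sup>2 / (4 * s))"
    by (rule exponential_integral_bound[OF k s p n g fin1]) blast
  have t0: "t > 0" using s b by (simp add: t)
  have tb: "t * b\<^sup>2 = 1 / (4 * s)" using s b by (simp add: t)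
  define F where "F z = dunkl_transform k g (z / of_real b)" for z
  have F_hol: "F holomorphic_on UNIV"
  proof -
    have "(dunkl_transform k g \<circ> (\<lambda>z. z / of_real b)) holomorphic_on UNIV"
      using b by (intro holomorphic_on_compose dunkl_transform_holomorphic[OF k g int] holomorphic_intros) auto
    then show ?thesis by (simp add: F_def[abs_def] o_def)
  qed
  define \<Phi> where "\<Phi> z = F z * exp (of_real t * z\<^sup>2)" for z
  have "\<Phi> holomorphic_on UNIV"
    unfolding \<Phi>_def by (intro holomorphic_intros F_hol)
  moreover have "norm (\<Phi> z) \<le> (C * (1 + 1 / \<bar>b\<bar>) ^ N) * (1 + norm z) ^ N * exp (2 * t * (Re z)\<^sup>2)" for z
  proof -
    have "norm (F z) \<le> C * (1 + norm (z / of_real b)) ^ N * exp ((norm (z / of_real b))\<^sup>2 / (4 * s))"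
      unfolding F_def by (rule order_trans[OF dunkl_transform_series(2)[OF k g int] bound]) simp
    also have "(norm (z / of_real b))\<^sup>2 / (4 * s) = t * (norm z)\<^sup>2"
      using b s by (simp add: t norm_divide power_divide)
    also have "C * (1 + norm (z / of_real b)) ^ N \<le> C * ((1 + 1 / \<bar>b\<bar>) * (1 + norm z)) ^ N"
      using C b by (intro mult_left_mono power_mono) (auto simp: norm_divide algebra_simps add_divide_distrib)
    finally have Fz: "norm (F z) \<le> C * ((1 + 1 / \<bar>b\<bar>) * (1 + norm z)) ^ N * exp (t * (norm z)\<^sup>2)"
      by (simp add: mult_right_mono)
    have "norm (\<Phi> z) = norm (F z) * exp (t * ((Re z)\<^sup>2 - (Im z)\<^sup>2))"
      by (simp add: \<Phi>_def norm_mult Re_power2)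
    also have "\<dots> \<le> (C * ((1 + 1 / \<bar>b\<bar>) * (1 + norm z)) ^ N * exp (t * (norm z)\<^sup>2)) * exp (t * ((Re z)\<^sup>2 - (Im z)\<^sup>2))"
      by (intro mult_right_mono Fz) auto
    \<comment> \<open>|z|^2 + (Re z)^2 - (Im z)^2 = 2 (Re z)^2 is the whole gain from the factor
      exp(t z^2).\<close>
    also have "\<dots> = (C * (1 + 1 / \<bar>b\<bar>) ^ N) * (1 + norm z) ^ N * exp (2 * t * (Re z)\<^sup>2)"
      by (simp add: power_mult_distrib cmod_power2 mult.assoc flip: exp_add) (simp add: algebra_simps)
    finally show ?thesis .
  qed
  moreover have "(\<integral>\<^sup>+ x. ennreal (norm (\<Phi> (of_real x)) powr q / (1 + \<bar>x\<bar>) powr m) \<partial>lebesgue) < \<infinity>"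
  proof -
    have "norm (\<Phi> (of_real x)) powr q = exp (t * q * x\<^sup>2) * norm (dunkl_transform k g (of_real (x / b))) powr q" for x
    proof -
      have "norm (\<Phi> (of_real x)) = norm (dunkl_transform k g (of_real (x / b))) * exp (t * x\<^sup>2)"
        by (simp add: \<Phi>_def F_def norm_mult flip: of_real_power of_real_mult)
      moreover have "exp (t * x\<^sup>2) powr q = exp (t * q * x\<^sup>2)" by (simp add: powr_def mult_ac)
      ultimately show ?thesis by (simp add: powr_mult mult.commute)
    qed
    with fin2 show ?thesis by simp
  qed
  ultimately obtain P where "\<And>z. \<Phi> z = poly P z"
    using polynomial_of_gaussian_growth[of \<Phi> "2 * t" "C * (1 + 1 / \<bar>b\<bar>) ^ N" N q m] t0 C q m by auto
  then have FP: "F z = poly P z * exp (- of_real t * z\<^sup>2)" for z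
    unfolding \<Phi>_def by (simp add: exp_minus field_simps)
  \<comment> \<open>This undoes the scaling by b: in the variable of \<open>dunkl_transform\<close>
    the Gaussian is exp(-z^2/(4s)), the one produced by polynomials times exp(-s x^2).\<close>
  define P' where "P' = pcompose P [:0, of_real b:]"
  have dP': "degree P' = degree P" using b by (simp add: P'_def degree_pcompose)
  have P'0: "P' = 0" if "P = 0" using that by (simp add: P'_def)
  obtain Q where Q: "degree Q \<le> degree P" "P = 0 \<Longrightarrow> Q = 0"
    "\<And>z. dunkl_transform k (\<lambda>x. poly Q (of_real x) * of_real (exp (- s * x\<^sup>2))) z = poly P' z * exp (- z\<^sup>2 / of_real (4 * s))"
  \<comment> \<open>For P = 0 the degree bound alone would still admit a nonzero constant Q, so Q =
    0 is chosen directly. Later, Q \<noteq> 0 has to imply P \<noteq> 0.\<close>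
  proof (cases "P = 0")
    case True
    then show ?thesis by (intro that[of 0]) (auto simp: dunkl_transform_def P'0)
  next
    case False
    obtain Q where Q: "degree Q \<le> degree P'"
      "\<forall>z. dunkl_transform k (\<lambda>x. poly Q (of_real x) * of_real (exp (- s * x\<^sup>2))) z = poly P' z * exp (- z\<^sup>2 / of_real (4 * s))"
      using dunkl_transform_poly_gauss_surj[OF k s, of P'] by blast
    show ?thesis
    proof (rule that[of Q])
      show "degree Q \<le> degree P" using Q(1) dP' by simp
    qed (use Q(2) False in blast)+
  qed
  define u where "u x = poly Q (of_real x) * of_real (exp (- s * x\<^sup>2))" for x
  have um: "u \<in> borel_measurable lebesgue" unfolding u_def by measurable
  have ui: "integrable (dunkl_measure k) (\<lambda>x. norm (u x) * exp (r * \<bar>x\<bar>))" for r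
    unfolding u_def by (rule poly_gauss_exp_integrable[OF k s])
  have "dunkl_transform k (\<lambda>x. g x - u x) z = 0" for z
  proof -
    have "dunkl_transform k (\<lambda>x. g x - u x) z = dunkl_transform k g z - dunkl_transform k u z"
      unfolding dunkl_transform_def left_diff_distrib
      by (intro Bochner_Integration.integral_diff dunkl_transform_series(3)[OF k g int] dunkl_transform_series(3)[OF k um ui])
    moreover have "dunkl_transform k g z = poly P' z * exp (- z\<^sup>2 / of_real (4 * s))"
    proof -
      have "dunkl_transform k g z = F (of_real b * z)" using b by (simp add: F_def)
      moreover have "of_real t * (of_real b * z)\<^sup>2 = z\<^sup>2 / of_real (4 * s)"
        using arg_cong[OF tb, of complex_of_real] by (simp add: power_mult_distrib flip: mult.assoc)
      ultimately show ?thesis by (simp add: FP P'_def poly_pcompose mult.commute)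
    qed
    ultimately show ?thesis using Q(3)[of z] by (simp add: u_def[abs_def])
  qed
  moreover have "integrable (dunkl_measure k) (\<lambda>x. norm (g x - u x) * exp (r * \<bar>x\<bar>))" for r
  proof (rule Bochner_Integration.integrable_bound[OF Bochner_Integration.integrable_add[OF int[of r] ui[of r]]])
    show "(\<lambda>x. norm (g x - u x) * exp (r * \<bar>x\<bar>)) \<in> borel_measurable (dunkl_measure k)"
      using g um by simp
    show "AE x in dunkl_measure k. norm (norm (g x - u x) * exp (r * \<bar>x\<bar>)) \<le> norm (norm (g x) * exp (r * \<bar>x\<bar>) + norm (u x) * exp (r * \<bar>x\<bar>))"
      by (auto simp flip: distrib_right intro!: AE_I2 mult_right_mono norm_triangle_ineq4)
  qed
  moreover have "(\<lambda>x. g x - u x) \<in> borel_measurable lebesgue" using g um by simp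
  ultimately have "AE x in lebesgue. g x - u x = 0"
    by (intro AE_zero_of_dunkl_transform_zero[OF k]) auto
  then have "AE x in lebesgue. g x = poly Q (of_real x) * of_real (exp (- s * x\<^sup>2))"
    by eventually_elim (simp add: u_def)
  moreover have "dunkl_transform k g (of_real (l / b)) = poly P (of_real l) * of_real (exp (- t * l\<^sup>2))" for l
    using FP[of "of_real l"] by (simp add: F_def exp_of_real[symmetric])
  ultimately show thesis using that Q by blast
qed

lemma poly_gauss_nn_integral_finite:
  fixes h :: "real \<Rightarrow> real"
  assumes \<epsilon>: "\<epsilon> > 0" and p: "p \<ge> 0"
    and le: "\<And>x. h x \<le> C * ((1 + \<bar>x\<bar>) powr e * norm (poly Q (complex_of_real x)) powr p * exp (- \<epsilon> * x\<^sup>2))"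
  shows "(\<integral>\<^sup>+ x. ennreal (h x) \<partial>lebesgue) < \<infinity>"
proof -
  obtain D where D: "D \<ge> 0" "\<And>x. norm (poly Q (of_real x)) \<le> D * (1 + \<bar>x\<bar>) ^ degree Q"
    using poly_upper_bound by blast
  define W where "W x = C * ((1 + \<bar>x\<bar>) powr e * norm (poly Q (complex_of_real x)) powr p * exp (- \<epsilon> * x\<^sup>2))" for x
  have "integrable lebesgue W"
  proof (rule gauss_dominated_integrable[OF _ \<epsilon>])
    show "W \<in> borel_measurable lebesgue" unfolding W_def by measurable
    fix x
    have "norm (poly Q (of_real x)) powr p \<le> (D * (1 + \<bar>x\<bar>) ^ degree Q) powr p"
      using D p by (intro powr_mono2) auto
    also have "\<dots> = D powr p * (1 + \<bar>x\<bar>) powr (degree Q * p)"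
      using D by (simp add: powr_mult powr_powr powr_realpow[symmetric] add_pos_nonneg)
    finally have Qp: "norm (poly Q (of_real x)) powr p \<le> D powr p * (1 + \<bar>x\<bar>) powr (degree Q * p)" .
    have "norm (W x) = \<bar>C\<bar> * ((1 + \<bar>x\<bar>) powr e * norm (poly Q (complex_of_real x)) powr p * exp (- \<epsilon> * x\<^sup>2))"
      by (simp add: W_def abs_mult)
    also have "\<dots> \<le> \<bar>C\<bar> * ((1 + \<bar>x\<bar>) powr e * (D powr p * (1 + \<bar>x\<bar>) powr (degree Q * p)) * exp (- \<epsilon> * x\<^sup>2))"
      by (intro mult_left_mono mult_right_mono Qp) auto
    also have "\<dots> = (\<bar>C\<bar> * D powr p) * ((1 + \<bar>x\<bar>) powr (e + degree Q * p) * exp (- \<epsilon> * x\<^sup>2))"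
      by (simp add: powr_add)
    finally show "norm (W x) \<le> (\<bar>C\<bar> * D powr p) * ((1 + \<bar>x\<bar>) powr (e + degree Q * p) * exp (- \<epsilon> * x\<^sup>2))" .
  qed
  then have "(\<integral>\<^sup>+ x. ennreal (norm (W x)) \<partial>lebesgue) < \<infinity>"
    by (simp add: integrable_iff_bounded)
  moreover have "(\<integral>\<^sup>+ x. ennreal (h x) \<partial>lebesgue) \<le> (\<integral>\<^sup>+ x. ennreal (norm (W x)) \<partial>lebesgue)"
    by (intro nn_integral_mono ennreal_leI order_trans[OF le]) (metis W_def abs_ge_self real_norm_def)
  ultimately show ?thesis by (rule le_less_trans[rotated])
qed

section \<open>From the linear canonical transform to the Dunkl transform\<close>

lemma lc_dunkl_transform_eq:
  fixes M :: "real^2^2"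
  assumes "M $ 1 $ 1 = a" "M $ 1 $ 2 = b"
  shows "lc_dunkl_transform k M f l =
    1 / (\<i> * of_real b) powr of_real (k + 1) * (exp (\<i> / 2 * of_real (M $ 2 $ 2 / b * l\<^sup>2)) *
      dunkl_transform k (\<lambda>x. f x * exp (\<i> / 2 * of_real (a / b * x\<^sup>2))) (of_real (l / b)))"
proof -
  have "f x * exp (\<i> / 2 * of_real (M $ 2 $ 2 / b * l\<^sup>2 + a / b * x\<^sup>2)) * dunkl_kernel k (of_real (l / b)) x =
    exp (\<i> / 2 * of_real (M $ 2 $ 2 / b * l\<^sup>2)) * (f x * exp (\<i> / 2 * of_real (a / b * x\<^sup>2)) * dunkl_kernel k (of_real (l / b)) x)" for x
    unfolding of_real_add distrib_left exp_add by (simp only: mult_ac)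
  then show ?thesis
    unfolding lc_dunkl_transform_def Let_def dunkl_transform_def assms
    by (simp only: Bochner_Integration.integral_mult_right_zero)
qed

text \<open>The chirp in \<lambda> is unimodular, so only the modulus of 1/(ib)^(k+1) remains, a
  constant independent of f and \<lambda>.\<close>

lemma norm_lc_dunkl_transform:
  fixes M :: "real^2^2"
  assumes "M $ 1 $ 1 = a" "M $ 1 $ 2 = b" "b \<noteq> 0"
  obtains \<kappa> where "\<kappa> > 0" and
    "\<And>f l. norm (lc_dunkl_transform k M f l) =
      \<kappa> * norm (dunkl_transform k (\<lambda>x. f x * exp (\<i> / 2 * of_real (a / b * x\<^sup>2))) (of_real (l / b)))"
proof
  show "norm (1 / (\<i> * of_real b) powr of_real (k + 1) :: complex) > 0"
    using assms by simp
  have "norm (exp (\<i> / 2 * of_real r)) = 1" for r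
    using norm_exp_i_times[of "r / 2"] by simp
  then show "norm (lc_dunkl_transform k M f l) = norm (1 / (\<i> * of_real b) powr of_real (k + 1) :: complex) *
     norm (dunkl_transform k (\<lambda>x. f x * exp (\<i> / 2 * of_real (a / b * x\<^sup>2))) (of_real (l / b)))" for f l
    unfolding lc_dunkl_transform_eq[OF assms(1,2)] norm_mult by simp
qed

text \<open>An entire function is continuous along a real line. Measurability is what allows
  constants to be pulled out of the nonnegative integrals below.\<close>

lemma dunkl_transform_measurable:
  assumes k: "k \<ge> - 1 / 2" and g: "g \<in> borel_measurable lebesgue"
    and int: "\<And>r. integrable (dunkl_measure k) (\<lambda>x. norm (g x) * exp (r * \<bar>x\<bar>))"
  shows "(\<lambda>l. dunkl_transform k g (of_real (l / b))) \<in> borel_measurable lebesgue"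
proof -
  have "continuous_on UNIV (dunkl_transform k g)"
    by (intro holomorphic_on_imp_continuous_on dunkl_transform_holomorphic[OF k g int])
  then have "continuous_on UNIV (\<lambda>l. dunkl_transform k g (of_real (l * inverse b)))"
    by (rule continuous_on_compose2) (auto intro!: continuous_intros)
  then show ?thesis
    by (intro measurable_completion) (simp add: borel_measurable_continuous_onI divide_inverse)
qed

text \<open>Passing from f to g multiplies by a unimodular chirp, so the first condition is
  unchanged; the second integral is only scaled by \<kappa>^q > 0.\<close>

lemma condition_H_imp_dunkl:
  fixes M :: "real^2^2"
  assumes k: "k \<ge> - 1 / 2" and M: "M $ 1 $ 1 = a" "M $ 1 $ 2 = b" and b: "b \<noteq> 0" and s: "s > 0"
    and n: "n \<ge> 0" and p: "p \<ge> 1" and H: "condition_H k M s t n m p q f"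
    and g_def: "g = (\<lambda>x. f x * exp (\<i> / 2 * of_real (a / b * x\<^sup>2)))"
  shows "g \<in> borel_measurable lebesgue"
    and "(\<integral>\<^sup>+ x. ennreal (exp (s * p * x\<^sup>2) * norm (g x) powr p / (1 + \<bar>x\<bar>) powr n) \<partial>dunkl_measure k) < \<infinity>"
    and "(\<integral>\<^sup>+ l. ennreal (exp (t * q * l\<^sup>2) * norm (dunkl_transform k g (of_real (l / b))) powr q / (1 + \<bar>l\<bar>) powr m) \<partial>lebesgue) < \<infinity>"
proof -
  have f: "f \<in> borel_measurable lebesgue" using H by (simp add: condition_H_def)
  show gm: "g \<in> borel_measurable lebesgue" unfolding g_def using f by measurable
  have ng: "norm (g x) = norm (f x)" for x
    using norm_exp_i_times[of "a / b * x\<^sup>2 / 2"] by (simp add: g_def norm_mult)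
  show fin1: "(\<integral>\<^sup>+ x. ennreal (exp (s * p * x\<^sup>2) * norm (g x) powr p / (1 + \<bar>x\<bar>) powr n) \<partial>dunkl_measure k) < \<infinity>"
    using H by (simp add: ng condition_H_def)
  have int: "integrable (dunkl_measure k) (\<lambda>x. norm (g x) * exp (r * \<bar>x\<bar>))" for r
    using exponential_integral_bound[OF k s p n gm fin1] by blast
  note [measurable] = dunkl_transform_measurable[OF k gm int, of b]
  obtain \<kappa> where \<kappa>: "\<kappa> > 0" "\<And>l. norm (lc_dunkl_transform k M f l) = \<kappa> * norm (dunkl_transform k g (of_real (l / b)))"
    unfolding g_def using norm_lc_dunkl_transform[OF M b, of k] by metis
  define u where "u l = exp (t * q * l\<^sup>2) * norm (dunkl_transform k g (of_real (l / b))) powr q / (1 + \<bar>l\<bar>) powr m" for l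
  have [measurable]: "u \<in> borel_measurable lebesgue" unfolding u_def by measurable
  have "ennreal (\<kappa> powr q) * (\<integral>\<^sup>+ l. ennreal (u l) \<partial>lebesgue) = (\<integral>\<^sup>+ l. ennreal (\<kappa> powr q) * ennreal (u l) \<partial>lebesgue)"
    by (intro nn_integral_cmult[symmetric]) measurable
  also have "\<dots> = (\<integral>\<^sup>+ l. ennreal (exp (t * q * l\<^sup>2) * norm (lc_dunkl_transform k M f l) powr q / (1 + \<bar>l\<bar>) powr m) \<partial>lebesgue)"
    using \<kappa>(1) by (intro nn_integral_cong) (simp add: u_def \<kappa>(2) powr_mult mult_ac flip: ennreal_mult')
  also have "\<dots> < \<infinity>" using H by (simp add: condition_H_def)
  finally show "(\<integral>\<^sup>+ l. ennreal (exp (t * q * l\<^sup>2) * norm (dunkl_transform k g (of_real (l / b))) powr q / (1 + \<bar>l\<bar>) powr m) \<partial>lebesgue) < \<infinity>"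
    using \<kappa>(1) unfolding u_def[symmetric] by (auto simp: ennreal_mult_less_top)
qed

theorem theorem4p6:
  fixes k s t n m p q a b c d :: real and M :: "real^2^2"
  assumes "k \<ge> - 1 / 2"
    and "M = vector [vector [a, b], vector [c, d]]" and "det M = 1" and "b \<noteq> 0"
    and "s > 0" and "t > 0" and "n > 0" and "m > 1" and "p \<ge> 1" and "q \<ge> 1"
  shows
    "(s * t > 1 / (4 * b\<^sup>2) \<longrightarrow>
        (\<forall>f. condition_H k M s t n m p q f \<longrightarrow> (AE x in lebesgue. f x = 0)))
     \<and>
     (s * t = 1 / (4 * b\<^sup>2) \<longrightarrow>
        (\<forall>f. condition_H k M s t n m p q f \<longrightarrow>
           (\<exists>Q :: complex poly.
              (Q = 0 \<or> real (degree Q)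
                 \<le> min (n / p + (2 * k + 1) * inv_conj_exponent p) ((m - 1) / q)) \<and>
              (AE x in lebesgue. f x =
                 poly Q (of_real x) *
                 exp (- (of_real s + \<i> / 2 * of_real (a / b)) * (of_real x)\<^sup>2))) \<and>
           (m \<le> 1 + q \<and> n > 2 * k + 1 \<longrightarrow>
              (\<exists>C :: complex. AE x in lebesgue. f x =
                 C * exp (- (of_real s + \<i> / 2 * of_real (a / b)) * (of_real x)\<^sup>2)))))
     \<and>
     (s * t < 1 / (4 * b\<^sup>2) \<longrightarrow>
        (\<forall>(\<delta> :: real) (Q :: complex poly). s < \<delta> \<and> \<delta> < 1 / (4 * t * b\<^sup>2) \<longrightarrow>
           condition_H k M s t n m p q
             (\<lambda>x. poly Q (of_real x) *
                exp (- (of_real \<delta> + \<i> / 2 * of_real (a / b)) * (of_real x)\<^sup>2))))"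
proof -
  note k = \<open>k \<ge> - 1 / 2\<close> and b = \<open>b \<noteq> 0\<close> and s = \<open>s > 0\<close> and t = \<open>t > 0\<close> and p = \<open>p \<ge> 1\<close> and q = \<open>q \<ge> 1\<close>
  have M: "M $ 1 $ 1 = a" "M $ 1 $ 2 = b" using assms(2) by simp_all
  have n0: "n \<ge> 0" and m0: "m \<ge> 0" using \<open>n > 0\<close> \<open>m > 1\<close> by simp_all
  \<comment> \<open>The value of t critical for s: comparing s t with 1/(4 b^2) means comparing t
    with \<open>\<tau>\<close>.\<close>
  define \<tau> where "\<tau> = 1 / (4 * s * b\<^sup>2)"
  define g where "g f x = f x * exp (\<i> / 2 * of_real (a / b * x\<^sup>2))" for f :: "real \<Rightarrow> complex" and x
  have g_fun: "g f = (\<lambda>x. f x * exp (\<i> / 2 * of_real (a / b * x\<^sup>2)))" for f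
    by (rule ext) (simp add: g_def)
  have f_eq: "f x = c * exp (- (of_real r + \<i> / 2 * of_real (a / b)) * (of_real x)\<^sup>2)"
    if "g f x = c * of_real (exp (- r * x\<^sup>2))" for f x c r
  proof -
    have "f x = g f x * exp (- (\<i> / 2 * of_real (a / b * x\<^sup>2)))"
      by (simp add: g_def exp_minus)
    also have "\<dots> = c * (exp (of_real (- r * x\<^sup>2)) * exp (- (\<i> / 2 * of_real (a / b * x\<^sup>2))))"
      by (simp only: that exp_of_real mult.assoc)
    also have "\<dots> = c * exp (- (of_real r + \<i> / 2 * of_real (a / b)) * (of_real x)\<^sup>2)"
      unfolding exp_add[symmetric] by (simp add: algebra_simps)
    finally show ?thesis .
  qed
  \<comment> \<open>For \<tau> \<le> t the decay condition with t implies the one with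
    \<open>\<tau>\<close>, so the critical theorem feeds both (i) and (ii).\<close>
  have main: "\<exists>P Q. degree Q \<le> degree P \<and> (P = 0 \<longrightarrow> Q = 0) \<and>
      (\<forall>l. dunkl_transform k (g f) (of_real (l / b)) = poly P (of_real l) * of_real (exp (- \<tau> * l\<^sup>2))) \<and>
      (AE x in lebesgue. g f x = poly Q (of_real x) * of_real (exp (- s * x\<^sup>2)))"
    if H: "condition_H k M s t n m p q f" and \<tau>t: "\<tau> \<le> t" for f
  proof -
    note HD = condition_H_imp_dunkl[OF k M b s n0 p H g_fun]
    have "(\<integral>\<^sup>+ l. ennreal (exp (\<tau> * q * l\<^sup>2) * norm (dunkl_transform k (g f) (of_real (l / b))) powr q / (1 + \<bar>l\<bar>) powr m) \<partial>lebesgue)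
      \<le> (\<integral>\<^sup>+ l. ennreal (exp (t * q * l\<^sup>2) * norm (dunkl_transform k (g f) (of_real (l / b))) powr q / (1 + \<bar>l\<bar>) powr m) \<partial>lebesgue)"
      using \<tau>t q by (intro nn_integral_mono ennreal_leI divide_right_mono mult_right_mono) (auto intro!: mult_right_mono)
    note fin = le_less_trans[OF this HD(3)]
    show ?thesis
    proof (rule hardy_dunkl[OF k s b p q n0 m0 \<tau>_def HD(1,2) fin])
      fix P Q
      assume "degree Q \<le> degree P" "P = 0 \<Longrightarrow> Q = 0"
        "\<And>l. dunkl_transform k (g f) (of_real (l / b)) = poly P (of_real l) * of_real (exp (- \<tau> * l\<^sup>2))"
        "AE x in lebesgue. g f x = poly Q (of_real x) * of_real (exp (- s * x\<^sup>2))"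
      then show ?thesis by (intro exI[of _ P] exI[of _ Q] conjI allI impI)
    qed
  qed
  have part1: "AE x in lebesgue. f x = 0"
    if st: "s * t > 1 / (4 * b\<^sup>2)" and H: "condition_H k M s t n m p q f" for f
  proof -
    have \<tau>t: "\<tau> < t" using st s b by (simp add: \<tau>_def field_simps)
    obtain P Q where PQ: "P = 0 \<longrightarrow> Q = 0"
      "\<And>l. dunkl_transform k (g f) (of_real (l / b)) = poly P (of_real l) * of_real (exp (- \<tau> * l\<^sup>2))"
      "AE x in lebesgue. g f x = poly Q (of_real x) * of_real (exp (- s * x\<^sup>2))"
      using main[OF H less_imp_le[OF \<tau>t]] by blast
    \<comment> \<open>Strictness leaves a factor exp(\<epsilon> l^2) in the second condition, enough
      to absorb the weight. Then |P|^q itself would be Lebesgue integrable, which no nonzero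
      polynomial allows: the degree criterion with e = n = 0 yields q deg P < -1.\<close>
    have "P = 0"
    proof (rule ccontr)
      assume P: "P \<noteq> 0"
      define \<epsilon> where "\<epsilon> = (t - \<tau>) * q"
      have \<epsilon>: "\<epsilon> > 0" using \<tau>t q by (simp add: \<epsilon>_def)
      obtain K where K: "K \<ge> 0" "\<And>x. (1 + \<bar>x\<bar>) powr m * exp (- \<epsilon> * x\<^sup>2) \<le> K"
        using poly_gauss_bounded[OF \<epsilon>] by blast
      define v where "v l = exp (\<epsilon> * l\<^sup>2) * norm (poly P (of_real l)) powr q / (1 + \<bar>l\<bar>) powr m" for l :: real
      have [measurable]: "v \<in> borel_measurable lebesgue" unfolding v_def by measurable
      have "exp (t * q * l\<^sup>2) * norm (dunkl_transform k (g f) (of_real (l / b))) powr q = exp (\<epsilon> * l\<^sup>2) * norm (poly P (of_real l)) powr q" for l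
      proof -
        have "exp (t * q * l\<^sup>2) * norm (dunkl_transform k (g f) (of_real (l / b))) powr q
          = norm (poly P (of_real l)) powr q * (exp (t * q * l\<^sup>2) * exp (- \<tau> * l\<^sup>2) powr q)"
          unfolding PQ(2) norm_mult by (simp add: powr_mult)
        also have "exp (- \<tau> * l\<^sup>2) powr q = exp (- \<tau> * q * l\<^sup>2)" by (simp add: powr_def mult_ac)
        also have "exp (t * q * l\<^sup>2) * exp (- \<tau> * q * l\<^sup>2) = exp (\<epsilon> * l\<^sup>2)"
          unfolding exp_add[symmetric] by (simp add: \<epsilon>_def algebra_simps)
        finally show ?thesis by simp
      qed
      then have vfin: "(\<integral>\<^sup>+ l. ennreal (v l) \<partial>lebesgue) < \<infinity>"
        using condition_H_imp_dunkl(3)[OF k M b s n0 p H g_fun] by (simp add: v_def)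
      have "norm (poly P (of_real l)) powr q \<le> K * v l" for l
      proof -
        have "norm (poly P (of_real l)) powr q = ((1 + \<bar>l\<bar>) powr m * exp (- \<epsilon> * l\<^sup>2)) * v l"
          by (simp add: v_def exp_minus add_nonneg_eq_0_iff)
        also have "\<dots> \<le> K * v l" by (intro mult_right_mono K) (simp add: v_def)
        finally show ?thesis .
      qed
      then have "(\<integral>\<^sup>+ l. ennreal (\<bar>l\<bar> powr 0 * norm (poly P (of_real l)) powr q / (1 + \<bar>l\<bar>) powr 0) \<partial>lebesgue)
         \<le> (\<integral>\<^sup>+ l. ennreal (K * v l) \<partial>lebesgue)"
        using K(1) by (intro nn_integral_mono ennreal_leI) (auto simp: v_def)
      also have "\<dots> = (\<integral>\<^sup>+ l. ennreal K * ennreal (v l) \<partial>lebesgue)"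
        using K(1) by (simp add: ennreal_mult')
      also have "\<dots> = ennreal K * (\<integral>\<^sup>+ l. ennreal (v l) \<partial>lebesgue)"
        by (intro nn_integral_cmult) measurable
      also have "\<dots> < \<infinity>" using vfin by (simp add: ennreal_mult_less_top)
      finally have "q * degree P + 0 - 0 < - 1"
        using q by (intro degree_less_of_integrable[OF P]) auto
      then show False using q by (smt (verit) mult_nonneg_nonneg of_nat_0_le_iff)
    qed
    then have "AE x in lebesgue. g f x = 0" using PQ by simp
    then show ?thesis by eventually_elim (simp add: g_def)
  qed
  \<comment> \<open>The strict bound by (m - 1)/q is carried along with the asserted one; the
    constant case depends on it.\<close>
  have part2: "\<exists>Q. (Q = 0 \<or> real (degree Q) \<le> min (n / p + (2 * k + 1) * inv_conj_exponent p) ((m - 1) / q)) \<and>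
      (Q = 0 \<or> real (degree Q) < (m - 1) / q) \<and>
      (AE x in lebesgue. f x = poly Q (of_real x) * exp (- (of_real s + \<i> / 2 * of_real (a / b)) * (of_real x)\<^sup>2))"
    if st: "s * t = 1 / (4 * b\<^sup>2)" and H: "condition_H k M s t n m p q f" for f
  proof -
    have \<tau>t: "\<tau> = t" using st s b by (simp add: \<tau>_def field_simps)
    obtain P Q where PQ: "degree Q \<le> degree P" "P = 0 \<longrightarrow> Q = 0"
      "\<And>l. dunkl_transform k (g f) (of_real (l / b)) = poly P (of_real l) * of_real (exp (- t * l\<^sup>2))"
      "AE x in lebesgue. g f x = poly Q (of_real x) * of_real (exp (- s * x\<^sup>2))"
      using main[OF H] \<tau>t by auto
    have deg1: "real (degree Q) < (m - 1) / q" if "Q \<noteq> 0"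
    proof -
      have P: "P \<noteq> 0" using PQ(2) that by blast
      have "exp (t * q * l\<^sup>2) * norm (dunkl_transform k (g f) (of_real (l / b))) powr q = norm (poly P (of_real l)) powr q" for l
      proof -
        have "exp (t * q * l\<^sup>2) * norm (dunkl_transform k (g f) (of_real (l / b))) powr q
          = norm (poly P (of_real l)) powr q * (exp (t * q * l\<^sup>2) * exp (- t * l\<^sup>2) powr q)"
          unfolding PQ(3) norm_mult by (simp add: powr_mult)
        also have "exp (t * q * l\<^sup>2) * exp (- t * l\<^sup>2) powr q = 1"
          by (simp add: powr_def mult_ac flip: exp_add)
        finally show ?thesis by simp
      qed
      then have "(\<integral>\<^sup>+ l. ennreal (norm (poly P (of_real l)) powr q / (1 + \<bar>l\<bar>) powr m) \<partial>lebesgue) < \<infinity>"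
        using condition_H_imp_dunkl(3)[OF k M b s n0 p H g_fun] by simp
      \<comment> \<open>Because \<open>0 powr 0 = 0\<close>, the integrand inserted here differs
        from the previous one at the origin, so the two are compared by an inequality.\<close>
      then have "(\<integral>\<^sup>+ l. ennreal (\<bar>l\<bar> powr 0 * norm (poly P (of_real l)) powr q / (1 + \<bar>l\<bar>) powr m) \<partial>lebesgue) < \<infinity>"
        by (rule le_less_trans[rotated]) (intro nn_integral_mono ennreal_leI divide_right_mono, auto)
      then have "q * degree P + 0 - m < - 1"
        using q m0 by (intro degree_less_of_integrable[OF P]) auto
      then have "real (degree P) < (m - 1) / q" using q by (simp add: field_simps)
      then show ?thesis using PQ(1) by linarith
    qed
    have deg2: "real (degree Q) \<le> n / p + (2 * k + 1) * inv_conj_exponent p" if Q: "Q \<noteq> 0"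
    proof -
      note HD = condition_H_imp_dunkl[OF k M b s n0 p H g_fun]
      define D where "D = 2 powr (k + 1) * Gamma (k + 1)"
      have D: "D > 0" unfolding D_def by (rule dunkl_const_pos[OF k])
      define v where "v x = \<bar>x\<bar> powr (2 * k + 1) * norm (poly Q (of_real x)) powr p / (1 + \<bar>x\<bar>) powr n" for x :: real
      have [measurable]: "v \<in> borel_measurable lebesgue" unfolding v_def by measurable
      have hm: "(\<lambda>x. exp (s * p * x\<^sup>2) * norm (g f x) powr p / (1 + \<bar>x\<bar>) powr n) \<in> borel_measurable lebesgue"
        using HD(1) by measurable
      \<comment> \<open>By the form of g, its Gaussian cancels exp(s p x^2) exactly, and what
        remains is |Q|^p against |x|^(2k+1) / (1 + |x|)^n: the degree criterion applies with e = 2k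
        + 1.\<close>
      have "(\<integral>\<^sup>+ x. ennreal (dunkl_density k x * (exp (s * p * x\<^sup>2) * norm (g f x) powr p / (1 + \<bar>x\<bar>) powr n)) \<partial>lebesgue) =
         (\<integral>\<^sup>+ x. ennreal (1 / D) * ennreal (v x) \<partial>lebesgue)"
      proof (rule nn_integral_cong_AE)
        show "AE x in lebesgue. ennreal (dunkl_density k x * (exp (s * p * x\<^sup>2) * norm (g f x) powr p / (1 + \<bar>x\<bar>) powr n))
           = ennreal (1 / D) * ennreal (v x)"
          using PQ(4)
        proof eventually_elim
          case (elim x)
          have "exp (s * p * x\<^sup>2) * norm (g f x) powr p
            = norm (poly Q (of_real x)) powr p * (exp (s * p * x\<^sup>2) * exp (- s * x\<^sup>2) powr p)"
            unfolding elim norm_mult by (simp add: powr_mult)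
          also have "exp (s * p * x\<^sup>2) * exp (- s * x\<^sup>2) powr p = 1"
            by (simp add: powr_def mult_ac flip: exp_add)
          finally have "exp (s * p * x\<^sup>2) * norm (g f x) powr p = norm (poly Q (of_real x)) powr p" by simp
          then show ?case using D
            by (simp add: dunkl_density_def D_def[symmetric] v_def flip: ennreal_mult')
        qed
      qed
      also have "\<dots> = ennreal (1 / D) * (\<integral>\<^sup>+ x. ennreal (v x) \<partial>lebesgue)"
        by (intro nn_integral_cmult) measurable
      finally have "ennreal (1 / D) * (\<integral>\<^sup>+ x. ennreal (v x) \<partial>lebesgue) < \<infinity>"
        using HD(2) unfolding dunkl_nn_integral[OF k hm] by simp
      then have "(\<integral>\<^sup>+ x. ennreal (v x) \<partial>lebesgue) < \<infinity>"
        using D by (auto simp: ennreal_mult_less_top)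
      then have "p * degree Q + (2 * k + 1) - n < - 1"
        unfolding v_def using p n0 by (intro degree_less_of_integrable[OF Q]) auto
      \<comment> \<open>The criterion gives p deg Q < n - (2k + 2); after weakening to n, the
        nonnegative term (2k + 1)/p' may be added on the right.\<close>
      then have "p * degree Q \<le> n" using k by simp
      then have "real (degree Q) \<le> n / p" using p by (simp add: field_simps)
      moreover have "(2 * k + 1) * inv_conj_exponent p \<ge> 0"
        using k p by (intro mult_nonneg_nonneg) (auto simp: inv_conj_exponent_def)
      ultimately show ?thesis by simp
    qed
    have "AE x in lebesgue. f x = poly Q (of_real x) * exp (- (of_real s + \<i> / 2 * of_real (a / b)) * (of_real x)\<^sup>2)"
      using PQ(4) by eventually_elim (rule f_eq)
    then show ?thesis using deg1 deg2 by (intro exI[of _ Q]) auto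
  qed
  have part2': "\<exists>C. AE x in lebesgue. f x = C * exp (- (of_real s + \<i> / 2 * of_real (a / b)) * (of_real x)\<^sup>2)"
    if st: "s * t = 1 / (4 * b\<^sup>2)" and H: "condition_H k M s t n m p q f" and mq: "m \<le> 1 + q" for f
  proof -
    obtain Q where Q: "Q = 0 \<or> real (degree Q) < (m - 1) / q"
      "AE x in lebesgue. f x = poly Q (of_real x) * exp (- (of_real s + \<i> / 2 * of_real (a / b)) * (of_real x)\<^sup>2)"
      using part2[OF st H] by blast
    \<comment> \<open>A degree strictly below 1 is 0; a bound with \<le> would still allow degree 1
      when m = 1 + q.\<close>
    have "(m - 1) / q \<le> 1" using mq q by simp
    then have "degree Q = 0" using Q(1) by auto
    then obtain C where "Q = [:C:]" by (rule degree_eq_zeroE)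
    then show ?thesis using Q(2) by auto
  qed
  have part3: "condition_H k M s t n m p q (\<lambda>x. poly Q (of_real x) * exp (- (of_real \<delta> + \<i> / 2 * of_real (a / b)) * (of_real x)\<^sup>2))"
    if \<delta>: "s < \<delta>" "\<delta> < 1 / (4 * t * b\<^sup>2)" for \<delta> :: real and Q :: "complex poly"
  proof -
    define f where "f x = poly Q (of_real x) * exp (- (of_real \<delta> + \<i> / 2 * of_real (a / b)) * (of_real x)\<^sup>2)" for x :: real
    have \<delta>0: "\<delta> > 0" using \<delta> s by simp
    have gf: "g f = (\<lambda>x. poly Q (of_real x) * of_real (exp (- \<delta> * x\<^sup>2)))"
    proof
      fix x :: real
      have "g f x = poly Q (of_real x) * (exp (- (of_real \<delta> + \<i> / 2 * of_real (a / b)) * (of_real x)\<^sup>2) * exp (\<i> / 2 * of_real (a / b * x\<^sup>2)))"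
        by (simp only: g_def f_def mult.assoc)
      also have "exp (- (of_real \<delta> + \<i> / 2 * of_real (a / b)) * (of_real x)\<^sup>2) * exp (\<i> / 2 * of_real (a / b * x\<^sup>2)) = exp (of_real (- \<delta> * x\<^sup>2))"
        unfolding exp_add[symmetric] by (simp add: algebra_simps)
      finally show "g f x = poly Q (of_real x) * of_real (exp (- \<delta> * x\<^sup>2))" by (simp only: exp_of_real)
    qed
    have fm: "f \<in> borel_measurable lebesgue"
    proof -
      have "continuous_on UNIV f" unfolding f_def by (intro continuous_intros)
      then show ?thesis by (intro measurable_completion) (simp add: borel_measurable_continuous_onI)
    qed
    have nf: "norm (f x) = norm (poly Q (of_real x)) * exp (- \<delta> * x\<^sup>2)" for x
      by (simp add: f_def norm_mult flip: of_real_power)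
    have div1: "u / (1 + \<bar>x\<bar>) powr r \<le> u" if "u \<ge> 0" "r \<ge> 0" for u x r :: real
    proof -
      have "1 \<le> (1 + \<bar>x\<bar>) powr r" using that by (simp add: ge_one_powr_ge_zero)
      then show ?thesis using that divide_left_mono[of 1 "(1 + \<bar>x\<bar>) powr r" u] by simp
    qed
    have e_powr: "(N * exp (- r * x\<^sup>2)) powr u = N powr u * exp (- (r * u * x\<^sup>2))" if "N \<ge> 0" for N r x u :: real
      using that by (simp add: powr_mult) (simp add: powr_def mult_ac)
    define D where "D = 2 powr (k + 1) * Gamma (k + 1)"
    have D: "D > 0" unfolding D_def by (rule dunkl_const_pos[OF k])
    have hm: "(\<lambda>x. exp (s * p * x\<^sup>2) * norm (f x) powr p / (1 + \<bar>x\<bar>) powr n) \<in> borel_measurable lebesgue"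
      using fm by measurable
    have "(\<integral>\<^sup>+ x. ennreal (exp (s * p * x\<^sup>2) * norm (f x) powr p / (1 + \<bar>x\<bar>) powr n) \<partial>dunkl_measure k) < \<infinity>"
      unfolding dunkl_nn_integral[OF k hm]
    \<comment> \<open>\<delta> > s leaves the decay exp(-(\<delta> - s) p x^2) once exp(s p x^2) is
      spent, so the weight 1/(1 + |x|)^n can simply be bounded by 1.\<close>
    proof (rule poly_gauss_nn_integral_finite[of "(\<delta> - s) * p" p])
      show "(\<delta> - s) * p > 0" "p \<ge> 0" using \<delta> p by auto
      fix x :: real
      have "exp (s * p * x\<^sup>2) * norm (f x) powr p / (1 + \<bar>x\<bar>) powr n \<le> exp (s * p * x\<^sup>2) * norm (f x) powr p"
        by (rule div1) (use n0 in auto)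
      also have "\<dots> = norm (poly Q (of_real x)) powr p * exp (- ((\<delta> - s) * p) * x\<^sup>2)"
        unfolding nf e_powr[OF norm_ge_zero] by (simp add: algebra_simps flip: exp_add)
      finally have "dunkl_density k x * (exp (s * p * x\<^sup>2) * norm (f x) powr p / (1 + \<bar>x\<bar>) powr n) \<le>
         (1 + \<bar>x\<bar>) powr (2 * k + 1) / D * (norm (poly Q (of_real x)) powr p * exp (- ((\<delta> - s) * p) * x\<^sup>2))"
        using dunkl_density_le[OF k, of x] dunkl_density_nonneg[OF k, of x] D unfolding D_def[symmetric]
        by (intro mult_mono) auto
      then show "dunkl_density k x * (exp (s * p * x\<^sup>2) * norm (f x) powr p / (1 + \<bar>x\<bar>) powr n) \<le>
         1 / D * ((1 + \<bar>x\<bar>) powr (2 * k + 1) * norm (poly Q (of_real x)) powr p * exp (- ((\<delta> - s) * p) * x\<^sup>2))"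
        by simp
    qed
    moreover have "(\<integral>\<^sup>+ l. ennreal (exp (t * q * l\<^sup>2) * norm (lc_dunkl_transform k M f l) powr q / (1 + \<bar>l\<bar>) powr m) \<partial>lebesgue) < \<infinity>"
    proof -
      obtain P where P: "\<And>z. dunkl_transform k (g f) z = poly P z * exp (- z\<^sup>2 / of_real (4 * \<delta>))"
        using dunkl_transform_poly_gauss[OF k \<delta>0, of Q] unfolding gf by blast
      obtain \<kappa> where \<kappa>: "\<kappa> > 0" "\<And>l. norm (lc_dunkl_transform k M f l) = \<kappa> * norm (dunkl_transform k (g f) (of_real (l / b)))"
        unfolding g_fun using norm_lc_dunkl_transform[OF M b, of k] by metis
      define R where "R = pcompose P [:0, of_real (1 / b):]"
      \<comment> \<open>The transform is a polynomial times exp(-r l^2), and \<delta> < 1/(4 t b^2)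
        says exactly that t < r.\<close>
      define r where "r = 1 / (4 * \<delta> * b\<^sup>2)"
      have r: "t < r" using \<delta> t \<delta>0 b by (simp add: r_def field_simps)
      have T: "norm (dunkl_transform k (g f) (of_real (l / b))) = norm (poly R (of_real l)) * exp (- r * l\<^sup>2)" for l
      proof -
        have "- (of_real (l / b))\<^sup>2 / of_real (4 * \<delta>) = complex_of_real (- r * l\<^sup>2)"
          by (simp add: r_def power_divide)
        moreover have "poly R (of_real l) = poly P (of_real (l / b))"
          by (simp add: R_def poly_pcompose)
        ultimately show ?thesis unfolding P by (simp add: norm_mult)
      qed
      show ?thesis
      proof (rule poly_gauss_nn_integral_finite[of "(r - t) * q" q])
        show "(r - t) * q > 0" "q \<ge> 0" using r q by auto
        fix l :: real
        have "exp (t * q * l\<^sup>2) * norm (lc_dunkl_transform k M f l) powr q / (1 + \<bar>l\<bar>) powr m \<le> exp (t * q * l\<^sup>2) * norm (lc_dunkl_transform k M f l) powr q"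
          by (rule div1) (use m0 in auto)
        also have "\<dots> = exp (t * q * l\<^sup>2) * (\<kappa> powr q * (norm (poly R (of_real l)) powr q * exp (- (r * q * l\<^sup>2))))"
          unfolding \<kappa>(2) T using \<kappa>(1) e_powr[of "norm (poly R (of_real l))" r l q] by (simp add: powr_mult)
        also have "\<dots> = \<kappa> powr q * ((1 + \<bar>l\<bar>) powr 0 * norm (poly R (of_real l)) powr q * exp (- ((r - t) * q) * l\<^sup>2))"
          by (simp add: algebra_simps exp_diff exp_minus divide_inverse add_nonneg_eq_0_iff)
        finally show "exp (t * q * l\<^sup>2) * norm (lc_dunkl_transform k M f l) powr q / (1 + \<bar>l\<bar>) powr m
           \<le> \<kappa> powr q * ((1 + \<bar>l\<bar>) powr 0 * norm (poly R (of_real l)) powr q * exp (- ((r - t) * q) * l\<^sup>2))" .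
      qed
    qed
    ultimately show ?thesis
      unfolding condition_H_def using fm by (simp add: f_def[abs_def])
  qed
  show ?thesis
    using part1 part2 part2' part3 by blast
qed

end
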